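(* Let $a\in L^\infty(0,1)$ satisfy $\int_0^1a(x)\,dx<0$ and suppose there is $z\in(0,1)$ such that $a(x)>0$ for a.e. $x\in(0,z)$ and $a(x)<0$ for a.e. $x\in(z,1)$. Let $f\in\mathcal C(\mathbb R)$ satisfy $f(0)=0$, $f(u)>0$ for $u>0$, and, for some constants $h>0$, $p\in(1,\infty)$ and $q\in(0,1)$, $$\lim_{u\to0^+}\frac{f(u)}{u^p}=1,\qquad \lim_{u\to\infty}\frac{f(u)}{u^{-q}}=h.$$ Then there is a component $\mathfrak C_{r,\infty}^+$ of $\mathcal S_r^+$ such that $(\lambda^*,\infty)\subseteq\mathcal P_\lambda(\mathfrak C_{r,\infty}^+)$ for some $\lambda^*>0$, and $$\lim_{\lambda\to\infty}\min\{\|u_\lambda\|_{\mathcal C^1[0,1]}:(\lambda,u_\lambda)\in\mathfrak C_{r,\infty}^+\}=0.$$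
   Context: Consider the problem $$-\left(\frac{u'}{\sqrt{1+(u')^2}}\right)'=\lambda a(x)f(u),\quad 0<x<1,\qquad u'(0)=u'(1)=0.$$ A regular solution is a function $u\in W^{2,1}(0,1)$ satisfying the equation a.e. in $(0,1)$ and the boundary conditions; it is positive if $\min u\ge0$ and $\max u>0$. Let $\lambda_0>0$ be the unique positive eigenvalue of $-\varphi''=\lambda a(x)\varphi$, $\varphi'(0)=\varphi'(1)=0$, having a strictly positive eigenfunction. $\mathcal S_r^+$ is the set of pairs $(\lambda,u)\in[0,\infty)\times\mathcal C^1[0,1]$ such that $u$ is a positive regular solution for the parameter value $\lambda$, together with $(0,0)$ and $(\lambda_0,0)$. A component of $\mathcal S_r^+$ is a closed connected subset of $\mathcal S_r^+$, for the topology of $\mathbb R\times\mathcal C^1[0,1]$, which is maximal for inclusion. $\mathcal P_\lambda$ is the projection $\mathcal P_\lambda(\lambda,u)=\lambda$. *)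

theory Defs
  imports "HOL-Analysis.Analysis"
begin

section \<open>The normed space of continuously differentiable functions on the unit interval\<close>

text \<open>Functions are normalised to vanish outside \<open>[0,1]\<close>, so that equality of
  elements is equality on \<open>[0,1]\<close>. Derivatives at the endpoints are one-sided.\<close>

definition C1_set :: "(real \<Rightarrow> real) set" where
  "C1_set = {u. (\<exists>u'. (\<forall>x\<in>{0..1}. (u has_real_derivative u' x) (at x within {0..1})) \<and>
                      continuous_on {0..1} u') \<and>
                (\<forall>x. x \<notin> {0..1} \<longrightarrow> u x = 0)}"

typedef c1 = C1_set
  morphisms app Abs_c1
  by (rule exI[of _ "\<lambda>_. 0"]) (auto simp: C1_set_def intro!: exI[of _ "\<lambda>_. 0"])

definition D :: "c1 \<Rightarrow> real \<Rightarrow> real" where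
  "D u x = vector_derivative (app u) (at x within {0..1})"

lemma trivlim_01: "x \<in> {0..1::real} \<Longrightarrow> at x within {0..1} \<noteq> bot"
  by (simp add: trivial_limit_within islimpt_Icc)

lemma D_unique:
  assumes "x \<in> {0..1}" "(app u has_real_derivative d) (at x within {0..1})"
  shows "D u x = d"
  using assms unfolding D_def has_real_derivative_iff_has_vector_derivative
  by (intro vector_derivative_within trivlim_01)

lemma has_derivative_D:
  assumes "x \<in> {0..1}"
  shows "(app u has_real_derivative D u x) (at x within {0..1})"
proof -
  have "app u \<in> C1_set" by (rule app)
  then obtain d where "(app u has_real_derivative d) (at x within {0..1})"
    using assms unfolding C1_set_def by blast
  with D_unique[OF assms] show ?thesis by metis
qed

lemma continuous_D: "continuous_on {0..1} (D u)"
proof -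
  have "app u \<in> C1_set" by (rule app)
  then obtain u' where *: "\<forall>x\<in>{0..1}. (app u has_real_derivative u' x) (at x within {0..1})"
      and c: "continuous_on {0..1} u'"
    by (auto simp: C1_set_def)
  have "continuous_on {0..1} (D u) \<longleftrightarrow> continuous_on {0..1} u'"
    by (rule continuous_on_cong) (use * D_unique in auto)
  with c show ?thesis by simp
qed

lemma continuous_app: "continuous_on {0..1} (app u)"
  by (rule DERIV_continuous_on) (rule has_derivative_D)

lemma app_outside: "x \<notin> {0..1} \<Longrightarrow> app u x = 0"
  using app[of u] by (auto simp: C1_set_def)

lemma C1_setI:
  assumes "\<And>x. x \<in> {0..1} \<Longrightarrow> (u has_real_derivative u' x) (at x within {0..1})"
    and "continuous_on {0..1} u'" "\<And>x. x \<notin> {0..1} \<Longrightarrow> u x = 0"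
  shows "u \<in> C1_set"
  using assms unfolding C1_set_def by blast

definition sup01 :: "(real \<Rightarrow> real) \<Rightarrow> real" where
  "sup01 g = (SUP x\<in>{0..1}. \<bar>g x\<bar>)"

lemma sup01_bdd: "continuous_on {0..1} g \<Longrightarrow> bdd_above ((\<lambda>x. \<bar>g x\<bar>) ` {0..1::real})"
  for g :: "real \<Rightarrow> real"
  by (intro bounded_imp_bdd_above compact_imp_bounded compact_continuous_image continuous_intros) auto

lemma sup01_upper: "continuous_on {0..1} g \<Longrightarrow> x \<in> {0..1} \<Longrightarrow> \<bar>g x\<bar> \<le> sup01 g"
  unfolding sup01_def by (rule cSUP_upper[OF _ sup01_bdd])

lemma sup01_least: "(\<And>x. x \<in> {0..1} \<Longrightarrow> \<bar>g x\<bar> \<le> B) \<Longrightarrow> sup01 g \<le> B"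
  unfolding sup01_def by (rule cSUP_least) auto

lemma sup01_cong: "(\<And>x. x \<in> {0..1} \<Longrightarrow> g x = k x) \<Longrightarrow> sup01 g = sup01 k"
  unfolding sup01_def by simp

lemma sup01_nonneg: "continuous_on {0..1} g \<Longrightarrow> 0 \<le> sup01 g"
  using sup01_upper[of g 0] by fastforce

lemma sup01_add:
  assumes "continuous_on {0..1} g" "continuous_on {0..1} k"
  shows "sup01 (\<lambda>x. g x + k x) \<le> sup01 g + sup01 k"
  by (rule sup01_least) (use sup01_upper[OF assms(1)] sup01_upper[OF assms(2)] in fastforce)

lemma sup01_scale_le:
  assumes "continuous_on {0..1} g"
  shows "sup01 (\<lambda>x. r * g x) \<le> \<bar>r\<bar> * sup01 g"
  by (rule sup01_least)
    (auto simp: abs_mult intro!: mult_left_mono sup01_upper[OF assms])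

lemma sup01_scale:
  assumes "continuous_on {0..1} g"
  shows "sup01 (\<lambda>x. r * g x) = \<bar>r\<bar> * sup01 g"
proof (cases "r = 0")
  case True
  then show ?thesis by (simp add: sup01_def)
next
  case False
  have "sup01 g = sup01 (\<lambda>x. inverse r * (r * g x))"
    using False by (intro sup01_cong) (simp add: field_simps)
  also have "\<dots> \<le> \<bar>inverse r\<bar> * sup01 (\<lambda>x. r * g x)"
    by (rule sup01_scale_le) (intro continuous_intros assms)
  finally have "\<bar>r\<bar> * sup01 g \<le> sup01 (\<lambda>x. r * g x)"
    using False by (simp add: field_simps)
  with sup01_scale_le[OF assms, of r] show ?thesis by linarith
qed

instantiation c1 :: real_normed_vector
begin

definition zero_c1 :: c1 where "0 = Abs_c1 (\<lambda>_. 0)"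
definition plus_c1 :: "c1 \<Rightarrow> c1 \<Rightarrow> c1" where "u + v = Abs_c1 (\<lambda>x. app u x + app v x)"
definition minus_c1 :: "c1 \<Rightarrow> c1 \<Rightarrow> c1" where "u - v = Abs_c1 (\<lambda>x. app u x - app v x)"
definition uminus_c1 :: "c1 \<Rightarrow> c1" where "- u = Abs_c1 (\<lambda>x. - app u x)"
definition scaleR_c1 :: "real \<Rightarrow> c1 \<Rightarrow> c1" where "r *\<^sub>R u = Abs_c1 (\<lambda>x. r * app u x)"
definition norm_c1 :: "c1 \<Rightarrow> real" where "norm u = sup01 (app u) + sup01 (D u)"
definition dist_c1 :: "c1 \<Rightarrow> c1 \<Rightarrow> real" where "dist_c1 u v = norm (u - v)"
definition sgn_c1 :: "c1 \<Rightarrow> c1" where "sgn_c1 u = inverse (norm u) *\<^sub>R u"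
definition uniformity_c1 :: "(c1 \<times> c1) filter" where
  "uniformity_c1 = (INF e\<in>{0<..}. principal {(u, v). dist u v < e})"
definition open_c1 :: "c1 set \<Rightarrow> bool" where
  "open_c1 U \<longleftrightarrow> (\<forall>u\<in>U. \<forall>\<^sub>F (u', v) in uniformity. u' = u \<longrightarrow> v \<in> U)"

lemma app_simps:
  "app 0 x = 0" "app (u + v) x = app u x + app v x" "app (u - v) x = app u x - app v x"
  "app (- u) x = - app u x" "app (r *\<^sub>R u) x = r * app u x"
proof -
  have "(\<lambda>_. 0) \<in> C1_set"
    by (rule C1_setI[of _ "\<lambda>_. 0"]) auto
  then show "app 0 x = 0" by (simp add: zero_c1_def Abs_c1_inverse)
  have "(\<lambda>x. app u x + app v x) \<in> C1_set"
    by (rule C1_setI[of _ "\<lambda>x. D u x + D v x"])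
      (auto intro!: derivative_intros has_derivative_D continuous_intros continuous_D simp: app_outside)
  then show "app (u + v) x = app u x + app v x" by (simp add: plus_c1_def Abs_c1_inverse)
  have "(\<lambda>x. app u x - app v x) \<in> C1_set"
    by (rule C1_setI[of _ "\<lambda>x. D u x - D v x"])
      (auto intro!: derivative_intros has_derivative_D continuous_intros continuous_D simp: app_outside)
  then show "app (u - v) x = app u x - app v x" by (simp add: minus_c1_def Abs_c1_inverse)
  have "(\<lambda>x. - app u x) \<in> C1_set"
    by (rule C1_setI[of _ "\<lambda>x. - D u x"])
      (auto intro!: derivative_intros has_derivative_D continuous_intros continuous_D simp: app_outside)
  then show "app (- u) x = - app u x" by (simp add: uminus_c1_def Abs_c1_inverse)
  have "(\<lambda>x. r * app u x) \<in> C1_set"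
    by (rule C1_setI[of _ "\<lambda>x. r * D u x"])
      (auto intro!: DERIV_cmult has_derivative_D continuous_intros continuous_D simp: app_outside)
  then show "app (r *\<^sub>R u) x = r * app u x" by (simp add: scaleR_c1_def Abs_c1_inverse)
qed

lemma c1_eqI: "(\<And>x. app u x = app v x) \<Longrightarrow> u = v"
  by (simp add: app_inject[symmetric] fun_eq_iff)

lemma D_simps:
  assumes "x \<in> {0..1}"
  shows "D 0 x = 0" "D (u + v) x = D u x + D v x" "D (r *\<^sub>R u) x = r * D u x"
  by (rule D_unique[OF assms];
      auto simp: app_simps[abs_def] fun_eq_iff
        intro!: derivative_intros DERIV_cmult has_derivative_D assms)+

instance
proof
  fix u v w :: c1 and r s :: real
  show "u + v + w = u + (v + w)" "u + v = v + u" "0 + u = u" "- u + u = 0" "u - v = u + - v"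
    "r *\<^sub>R (u + v) = r *\<^sub>R u + r *\<^sub>R v" "(r + s) *\<^sub>R u = r *\<^sub>R u + s *\<^sub>R u"
    "r *\<^sub>R s *\<^sub>R u = (r * s) *\<^sub>R u" "1 *\<^sub>R u = u"
    by (rule c1_eqI; simp add: app_simps algebra_simps)+
  show "dist u v = norm (u - v)" by (rule dist_c1_def)
  show "sgn u = inverse (norm u) *\<^sub>R u" by (rule sgn_c1_def)
  show "uniformity = (INF e\<in>{0<..}. principal {(x, y::c1). dist x y < e})"
    by (rule uniformity_c1_def)
  show "open U = (\<forall>x\<in>U. \<forall>\<^sub>F (x', y) in uniformity. x' = x \<longrightarrow> y \<in> U)" for U :: "c1 set"
    by (rule open_c1_def)
  show "norm u = 0 \<longleftrightarrow> u = 0"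
  proof
    assume "norm u = 0"
    then have z: "sup01 (app u) = 0"
      unfolding norm_c1_def
      using sup01_nonneg[OF continuous_app, of u] sup01_nonneg[OF continuous_D, of u] by linarith
    have "app u x = 0" for x
      using sup01_upper[OF continuous_app, of x u] app_outside[of x u] z by fastforce
    then show "u = 0" by (intro c1_eqI) (simp add: app_simps)
  next
    assume "u = 0"
    then show "norm u = 0"
      using D_simps(1) by (simp add: norm_c1_def sup01_def app_simps)
  qed
  have "sup01 (app (u + v)) \<le> sup01 (app u) + sup01 (app v)"
    using sup01_add[OF continuous_app continuous_app] by (simp add: app_simps[abs_def])
  moreover have "sup01 (D (u + v)) \<le> sup01 (D u) + sup01 (D v)"
    using sup01_add[OF continuous_D continuous_D] D_simps(2)
    by (subst sup01_cong[of "D (u + v)" "\<lambda>x. D u x + D v x"]) auto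
  ultimately show "norm (u + v) \<le> norm u + norm v" by (simp add: norm_c1_def)
  have "sup01 (app (r *\<^sub>R u)) = \<bar>r\<bar> * sup01 (app u)"
    using sup01_scale[OF continuous_app] by (simp add: app_simps[abs_def])
  moreover have "sup01 (D (r *\<^sub>R u)) = \<bar>r\<bar> * sup01 (D u)"
    using sup01_scale[OF continuous_D] D_simps(3)
    by (subst sup01_cong[of "D (r *\<^sub>R u)" "\<lambda>x. r * D u x"]) auto
  ultimately show "norm (r *\<^sub>R u) = \<bar>r\<bar> * norm u" by (simp add: norm_c1_def algebra_simps)
qed

end

section \<open>Lebesgue and Sobolev spaces on the unit interval\<close>

definition Linfty01 :: "(real \<Rightarrow> real) set" where
  "Linfty01 = {a \<in> borel_measurable (lebesgue_on {0<..<1}).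
                 \<exists>K. AE x in lebesgue_on {0<..<1}. \<bar>a x\<bar> \<le> K}"

text \<open>\<open>v \<in> L\<^sup>1(0,1)\<close> is the weak derivative of \<open>u \<in> L\<^sup>1(0,1)\<close>; the test functions are
  the \<open>C\<^sup>1\<close> functions with compact support in \<open>(0,1)\<close> (the support is closed and bounded,
  so its inclusion in \<open>(0,1)\<close> already makes it a compact subset of that interval).\<close>

definition weak_derivative01 :: "(real \<Rightarrow> real) \<Rightarrow> (real \<Rightarrow> real) \<Rightarrow> bool" where
  "weak_derivative01 u v \<longleftrightarrow>
     integrable (lebesgue_on {0<..<1}) u \<and> integrable (lebesgue_on {0<..<1}) v \<and>
     (\<forall>\<phi>::real \<Rightarrow> real. \<phi> C1_differentiable_on UNIV \<and> closure {x. \<phi> x \<noteq> 0} \<subseteq> {0<..<1} \<longrightarrow>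
        (LINT x|lebesgue_on {0<..<1}. u x * deriv \<phi> x) =
        - (LINT x|lebesgue_on {0<..<1}. v x * \<phi> x))"

definition W21 :: "(real \<Rightarrow> real) set" where
  "W21 = {u. \<exists>v w. weak_derivative01 u v \<and> weak_derivative01 v w}"

section \<open>The boundary value problem\<close>

text \<open>Elements of \<open>W\<^sup>2\<^sup>,\<^sup>1(0,1)\<close> are identified with their continuously differentiable
  representatives on \<open>[0,1]\<close>, which gives the boundary conditions their meaning.\<close>

definition regular_solution ::
  "(real \<Rightarrow> real) \<Rightarrow> (real \<Rightarrow> real) \<Rightarrow> real \<Rightarrow> c1 \<Rightarrow> bool" where
  "regular_solution a f l u \<longleftrightarrow>
     app u \<in> W21 \<and>
     (\<exists>g. weak_derivative01 (\<lambda>x. D u x / sqrt (1 + (D u x)\<^sup>2)) g \<and>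
          (AE x in lebesgue_on {0<..<1}. - g x = l * a x * f (app u x))) \<and>
     D u 0 = 0 \<and> D u 1 = 0"

definition positive :: "c1 \<Rightarrow> bool" where
  "positive u \<longleftrightarrow> (\<forall>x\<in>{0..1}. 0 \<le> app u x) \<and> (\<exists>x\<in>{0..1}. 0 < app u x)"

definition Neumann_eigenpair :: "(real \<Rightarrow> real) \<Rightarrow> real \<Rightarrow> c1 \<Rightarrow> bool" where
  "Neumann_eigenpair a l \<phi> \<longleftrightarrow>
     \<phi> \<noteq> 0 \<and> app \<phi> \<in> W21 \<and>
     (\<exists>g. weak_derivative01 (D \<phi>) g \<and>
          (AE x in lebesgue_on {0<..<1}. - g x = l * a x * app \<phi> x)) \<and>
     D \<phi> 0 = 0 \<and> D \<phi> 1 = 0"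

text \<open>Existence and uniqueness of \<open>l\<close> are classical when \<open>a\<close> changes sign and has negative mean.\<close>

definition principal_eigenvalue :: "(real \<Rightarrow> real) \<Rightarrow> real" where
  "principal_eigenvalue a =
     (THE l. 0 < l \<and> (\<exists>\<phi>. Neumann_eigenpair a l \<phi> \<and> (\<forall>x\<in>{0..1}. 0 < app \<phi> x)))"

definition Sr_plus :: "(real \<Rightarrow> real) \<Rightarrow> (real \<Rightarrow> real) \<Rightarrow> (real \<times> c1) set" where
  "Sr_plus a f =
     {(l, u). 0 \<le> l \<and> regular_solution a f l u \<and> positive u} \<union>
     {(0, 0), (principal_eigenvalue a, 0)}"

text \<open>The library's \<^const>\<open>components\<close> are the maximal connected subsets; closedness comes for free,
  so they are exactly the maximal closed connected subsets.\<close>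

lemma components_Sr_plus_iff:
  "C \<in> components (Sr_plus a f) \<longleftrightarrow>
     closedin (top_of_set (Sr_plus a f)) C \<and> connected C \<and>
     (\<forall>C'. closedin (top_of_set (Sr_plus a f)) C' \<and> connected C' \<and> C \<subseteq> C' \<longrightarrow> C' = C)"
  (is "_ \<longleftrightarrow> ?R")
proof
  assume C: "C \<in> components (Sr_plus a f)"
  then show ?R
    using closedin_component[OF C] in_components_connected[OF C] in_components_nonempty[OF C]
    by (auto dest: closedin_imp_subset simp: in_components_maximal)
next
  assume R: ?R
  then have sub: "C \<subseteq> Sr_plus a f" by (blast dest: closedin_imp_subset)
  have "\<exists>x \<in> Sr_plus a f. C \<subseteq> connected_component_set (Sr_plus a f) x"
  proof (cases "C = {}")
    case True
    then show ?thesis by (auto simp: Sr_plus_def)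
  next
    case False
    then obtain x where "x \<in> C" by blast
    then show ?thesis using R sub connected_component_maximal by (metis subsetD)
  qed
  then obtain x where x: "x \<in> Sr_plus a f" "C \<subseteq> connected_component_set (Sr_plus a f) x" by blast
  have "connected_component_set (Sr_plus a f) x \<in> components (Sr_plus a f)"
    using x by (simp add: components_def)
  then show "C \<in> components (Sr_plus a f)"
    using R x(2) closedin_component in_components_connected by metis
qed

end

theory Submission
  imports Defs "HOL-Complex_Analysis.Great_Picard"
begin

text \<open>
  The branch consists of the solutions that are small of order \<open>\<lambda>\<^sup>-\<^sup>1\<^sup>/\<^sup>(\<^sup>p\<^sup>-\<^sup>1\<^sup>)\<close>. Write \<open>J = u' / \<surd>(1 + u'\<^sup>2)\<close> for
  the flux, so that \<open>J' = - \<lambda> a f(u)\<close>. As \<open>a\<close> changes sign once, the flux falls from \<open>0\<close> on \<open>[0, z]\<close> and rises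
  on \<open>[z, 1]\<close>; positive solutions are therefore non-increasing and governed by their start value \<open>s = u(0)\<close>, and
  a solution of the initial value problem solves the boundary value problem exactly if \<open>J(1) = 0\<close>.
  Near zero \<open>f(u)\<close> behaves like \<open>u\<^sup>p\<close>, and the sign of \<open>J(1)\<close> depends on \<open>t = \<lambda> s\<^sup>p\<^sup>-\<^sup>1\<close>. For small \<open>t\<close>
  the solution stays close to \<open>s\<close> and \<open>J(1)\<close> is about \<open>- \<lambda> s\<^sup>p \<integral> a > 0\<close> (\<open>flux_pos_of_small_start\<close>); for
  large \<open>t\<close> it becomes negative before \<open>z\<close>, and then \<open>J(1) < 0\<close> (\<open>flux_neg_of_large_start\<close>). So all small
  solutions have \<open>k\<^sub>1 < t < k\<^sub>2\<close>, for all large \<open>\<lambda>\<close>, and their \<open>C\<^sup>1\<close> norm is of order \<open>\<lambda>\<^sup>-\<^sup>1\<^sup>/\<^sup>(\<^sup>p\<^sup>-\<^sup>1\<^sup>)\<close>.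

  If the initial value problem were uniquely solvable, \<open>J(1)\<close> would be a continuous function on the
  rectangle \<open>[\<lambda>\<^sub>0, L] \<times> [k\<^sub>1, k\<^sub>2]\<close>, positive on the lower and negative on the upper edge, and its zero set could
  not be split into two closed parts that contain its zeros on the left and on the right edge: this is the planar
  Poincare-Miranda theorem (\<open>zero_set_not_separated\<close>). For a merely continuous \<open>f\<close> uniqueness fails. Delaying the
  argument of \<open>f\<close> by \<open>1/N\<close> restores it, since the solution is then computed interval by interval. A separation of the
  exact solutions in \<open>\<real> \<times> C\<^sup>1\<close> would by compactness (\<open>delayed_ivp_compactness\<close>) be inherited by the delayed
  problems for large \<open>N\<close>, which is impossible (\<open>Z_not_separated\<close>).

  In a compact set connected components are intersections of clopen sets. A covering argument over the first slice
  turns the absence of separations over every \<open>[\<lambda>\<^sub>0, L]\<close> into one connected set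
  of small solutions over all of \<open>[\<lambda>\<^sub>0, \<infinity>)\<close> (\<open>connected_set_over_half_line\<close>). The component of the
  solution set that contains it is the desired one: it meets every \<open>\<lambda> > \<lambda>\<^sub>0\<close> in solutions of norm
  \<open>O(\<lambda>\<^sup>-\<^sup>1\<^sup>/\<^sup>(\<^sup>p\<^sup>-\<^sup>1\<^sup>))\<close>, and the minimal norm is attained because the small solutions for a given \<open>\<lambda>\<close> form a compact
  set that does not contain zero.
\<close>

section \<open>Planar zero sets and connected branches\<close>

lemma Poincare_Miranda_2d:
  fixes G H :: "real \<times> real \<Rightarrow> real"
  assumes ab: "a \<le> b" "c \<le> d"
    and cont: "continuous_on ({a..b} \<times> {c..d}) G" "continuous_on ({a..b} \<times> {c..d}) H"
    and left: "\<And>y. y \<in> {c..d} \<Longrightarrow> 0 < G (a, y)" and right: "\<And>y. y \<in> {c..d} \<Longrightarrow> G (b, y) < 0"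
    and bottom: "\<And>x. x \<in> {a..b} \<Longrightarrow> 0 < H (x, c)" and top: "\<And>x. x \<in> {a..b} \<Longrightarrow> H (x, d) < 0"
  shows "\<exists>w \<in> {a..b} \<times> {c..d}. G w = 0 \<and> H w = 0"
proof -
  let ?R = "{a..b} \<times> {c..d}"
  \<comment> \<open>the fixed points of this retracted translation are exactly the common zeros\<close>
  define F where "F w = (max a (min b (fst w + G w)), max c (min d (snd w + H w)))" for w
  have "continuous_on ?R F"
    unfolding F_def by (intro continuous_intros cont)
  moreover have "F \<in> ?R \<rightarrow> ?R"
    using ab by (auto simp: F_def)
  moreover have "compact ?R" "convex ?R" "?R \<noteq> {}"
    using ab by (auto intro!: compact_Times convex_Times)
  ultimately obtain w where w: "w \<in> ?R" "F w = w"
    using brouwer by metis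
  obtain x y where xy: "w = (x, y)" by fastforce
  have x: "max a (min b (x + G (x, y))) = x" and y: "max c (min d (y + H (x, y))) = y"
    using w(2) by (auto simp: F_def xy)
  have mem: "x \<in> {a..b}" "y \<in> {c..d}" using w(1) xy by auto
  have "G (x, y) = 0"
    using x left[OF mem(2)] right[OF mem(2)] mem(1) by (cases "x = a"; cases "x = b") (auto simp: max_def min_def split: if_splits)
  moreover have "H (x, y) = 0"
    using y bottom[OF mem(1)] top[OF mem(1)] mem(2) by (cases "y = c"; cases "y = d") (auto simp: max_def min_def split: if_splits)
  ultimately show ?thesis using w(1) xy by (intro bexI[of _ w]) auto
qed

lemma Urysohn_metric:
  fixes A B :: "'a::metric_space set"
  assumes "closed A" "closed B" "A \<inter> B = {}"
  obtains Q :: "'a \<Rightarrow> real" where "continuous_on UNIV Q"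
    "\<And>x. x \<in> A \<Longrightarrow> Q x = 1" "\<And>x. x \<in> B \<Longrightarrow> Q x = -1"
proof -
  have "normal_space (euclidean :: 'a topology)"
    by (rule metrizable_imp_normal_space[OF metrizable_space_euclidean])
  then obtain q :: "'a \<Rightarrow> real" where q: "continuous_map euclidean (top_of_set {0..1}) q"
      "q ` A \<subseteq> {0}" "q ` B \<subseteq> {1}"
    using assms unfolding normal_space_iff_Urysohn
    by (metis closed_closedin disjnt_def)
  have "continuous_on UNIV q"
    using q(1) by (simp add: continuous_map_in_subtopology)
  then have "continuous_on UNIV (\<lambda>x. 1 - 2 * q x)"
    by (intro continuous_intros)
  then show ?thesis
    using q by (intro that[of "\<lambda>x. 1 - 2 * q x"]) auto
qed

text \<open>Were the zeros of \<open>H\<close> split by the sign of \<open>q\<close>, a Urysohn function for the two sign classes,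
  enlarged by the left and the right edge, would have no common zero with \<open>H\<close>.\<close>

lemma zero_set_not_separated:
  fixes q H :: "real \<times> real \<Rightarrow> real"
  assumes ab: "a < b" "c \<le> d"
    and cont: "continuous_on ({a..b} \<times> {c..d}) q" "continuous_on ({a..b} \<times> {c..d}) H"
    and bottom: "\<And>x. x \<in> {a..b} \<Longrightarrow> 0 < H (x, c)" and top: "\<And>x. x \<in> {a..b} \<Longrightarrow> H (x, d) < 0"
    and left: "\<And>y. y \<in> {c..d} \<Longrightarrow> H (a, y) = 0 \<Longrightarrow> 0 < q (a, y)"
    and right: "\<And>y. y \<in> {c..d} \<Longrightarrow> H (b, y) = 0 \<Longrightarrow> q (b, y) < 0"
  shows "\<exists>w \<in> {a..b} \<times> {c..d}. H w = 0 \<and> q w = 0"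
proof (rule ccontr)
  assume no: "\<not> ?thesis"
  let ?R = "{a..b} \<times> {c..d}"
  define A where "A = {w \<in> ?R. 0 \<le> q w} \<inter> {w \<in> ?R. H w = 0}"
  define B where "B = {w \<in> ?R. q w \<le> 0} \<inter> {w \<in> ?R. H w = 0}"
  have R: "closed ?R" by (intro closed_Times) auto
  have "closed {w \<in> ?R. 0 \<le> q w}" "closed {w \<in> ?R. q w \<le> 0}" "closed {w \<in> ?R. H w = 0}"
    using continuous_closed_preimage[OF cont(1) R, of "{0..}"] continuous_closed_preimage[OF cont(1) R, of "{..0}"]
      continuous_closed_preimage[OF cont(2) R, of "{0}"] by (auto simp: vimage_def Int_def)
  then have cl: "closed A" "closed B" unfolding A_def B_def by auto
  have cl': "closed (A \<union> {a} \<times> {c..d})" "closed (B \<union> {b} \<times> {c..d})"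
    using cl by (auto intro!: closed_Un closed_Times)
  have disj: "(A \<union> {a} \<times> {c..d}) \<inter> (B \<union> {b} \<times> {c..d}) = {}"
    using no ab left right unfolding A_def B_def by fastforce
  obtain Q :: "real \<times> real \<Rightarrow> real" where Q: "continuous_on UNIV Q"
      "\<And>w. w \<in> A \<union> {a} \<times> {c..d} \<Longrightarrow> Q w = 1" "\<And>w. w \<in> B \<union> {b} \<times> {c..d} \<Longrightarrow> Q w = -1"
    using Urysohn_metric[OF cl' disj] by metis
  have "\<exists>w \<in> ?R. Q w = 0 \<and> H w = 0"
    by (rule Poincare_Miranda_2d) (use ab cont bottom top Q in \<open>auto intro: continuous_on_subset\<close>)
  then obtain w where w: "w \<in> ?R" "Q w = 0" "H w = 0" by blast
  then have "w \<in> A \<or> w \<in> B" unfolding A_def B_def by (cases "0 \<le> q w") auto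
  then show False using Q(2,3)[of w] w(2) by auto
qed

text \<open>If the slice over \<open>c\<close> cannot be separated from the slice over any \<open>L > c\<close>, then one and the same point of the first
  slice has components that reach every parameter, and their union is the desired set. Otherwise finitely many clopen sets, each avoiding a slice, would
  cover the first slice, and their union would separate.\<close>

lemma connected_set_over_half_line:
  fixes Z :: "(real \<times> 'a::metric_space) set"
  assumes comp: "\<And>L. compact {w \<in> Z. fst w \<le> L}"
    and ge: "\<And>w. w \<in> Z \<Longrightarrow> c \<le> fst w"
    and nosep: "\<And>L A B. c < L \<Longrightarrow> compact A \<Longrightarrow> compact B \<Longrightarrow> A \<inter> B = {} \<Longrightarrow> A \<union> B = {w \<in> Z. fst w \<le> L} \<Longrightarrow>
          (\<And>w. w \<in> Z \<Longrightarrow> fst w = c \<Longrightarrow> w \<in> A) \<Longrightarrow> (\<And>w. w \<in> Z \<Longrightarrow> fst w = L \<Longrightarrow> w \<in> B) \<Longrightarrow> False"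
  shows "\<exists>K \<subseteq> Z. connected K \<and> {c..} \<subseteq> fst ` K"
proof -
  define S where "S L = {w \<in> Z. fst w \<le> L}" for L
  define E where "E = {w \<in> Z. fst w = c}"
  have compS: "compact (S L)" for L using comp by (simp add: S_def)
  have ES: "E = S c" unfolding E_def S_def using ge by force
  have compE: "compact E" unfolding ES by (rule compS)
  have "\<exists>k \<in> E. \<forall>n::nat. (0::nat) < n \<longrightarrow> (\<exists>C \<subseteq> S (c + n). connected C \<and> k \<in> C \<and> (\<exists>w\<in>C. fst w = c + n))"
  proof (rule ccontr)
    assume "\<not> ?thesis"
    then have "\<forall>k \<in> E. \<exists>n::nat. (0::nat) < n \<and> \<not> (\<exists>C \<subseteq> S (c + n). connected C \<and> k \<in> C \<and> (\<exists>w\<in>C. fst w = c + n))"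
      by simp
    from bchoice[OF this] obtain n :: "real \<times> 'a \<Rightarrow> nat" where n0: "\<forall>k\<in>E. (0::nat) < n k \<and>
        \<not> (\<exists>C \<subseteq> S (c + n k). connected C \<and> k \<in> C \<and> (\<exists>w\<in>C. fst w = c + n k))" ..
    have n: "(0::nat) < n k" "\<And>C w. C \<subseteq> S (c + n k) \<Longrightarrow> connected C \<Longrightarrow> k \<in> C \<Longrightarrow> w \<in> C \<Longrightarrow> fst w \<noteq> c + n k"
      if "k \<in> E" for k using n0[rule_format, OF that] by (blast, meson)
    have "\<exists>V. compact (fst V) \<and> fst V \<subseteq> Z \<and> open (snd V) \<and> fst V = Z \<inter> snd V \<and> k \<in> fst V \<and> (\<forall>w\<in>fst V. fst w < c + n k)" if k: "k \<in> E" for k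
    proof -
      let ?X = "top_of_set (S (c + n k))" and ?T = "{w \<in> S (c + n k). fst w = c + n k}"
      have kS: "k \<in> S (c + n k)" using k n(1)[OF k] unfolding E_def S_def by auto
      have "closed {w::real \<times> 'a. fst w = c + n k}"
        by (intro closed_Collect_eq continuous_intros)
      then have "closedin ?X ?T"
        by (auto simp: closedin_closed intro!: exI[of _ "{w. fst w = c + n k}"])
      moreover have "closedin ?X {k}" using kS by (intro closed_subset) auto
      moreover have "disjnt C {k} \<or> disjnt C ?T" if "connectedin ?X C" for C
      proof (cases "k \<in> C")
        case True
        have "C \<subseteq> S (c + n k)" "connected C" using that by (auto simp: connectedin_subtopology)
        then show ?thesis using n(2)[OF k _ _ True] by (auto simp: disjnt_def)
      qed (simp add: disjnt_def)
      ultimately have "separated_between ?X {k} ?T"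
        using compS by (intro cut_wire_fence_theorem) (auto simp: compact_space_subtopology Hausdorff_space_subtopology)
      then obtain U where U: "closedin ?X U" "openin ?X U" "k \<in> U" "?T \<inter> U = {}"
        unfolding separated_between by (auto simp: disjnt_iff)
      have "compact U" using U(1) compS closedin_compact by blast
      obtain O1 where O1: "open O1" "U = S (c + n k) \<inter> O1" using U(2) by (auto simp: openin_open)
      have lt: "\<forall>w\<in>U. fst w < c + n k"
        using U(4) unfolding O1(2) S_def by (auto simp: order_less_le)
      have "open {w::real \<times> 'a. fst w < c + n k}"
        by (intro open_Collect_less continuous_intros)
      then have "open (O1 \<inter> {w. fst w < c + n k})" using O1(1) by (rule open_Int[rotated])
      moreover have UZ: "U = Z \<inter> (O1 \<inter> {w. fst w < c + n k})"
        using lt unfolding O1(2) S_def by auto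
      moreover have "U \<subseteq> Z" unfolding UZ by (rule Int_lower1)
      ultimately show ?thesis using \<open>compact U\<close> U(3) lt
        by (intro exI[of _ "(U, O1 \<inter> {w. fst w < c + n k})"] conjI) (simp_all only: fst_conv snd_conv)
    qed
    then have "\<forall>k\<in>E. \<exists>V. compact (fst V) \<and> fst V \<subseteq> Z \<and> open (snd V) \<and> fst V = Z \<inter> snd V \<and> k \<in> fst V \<and> (\<forall>w\<in>fst V. fst w < c + n k)"
      by blast
    from bchoice[OF this] obtain V where V: "\<forall>k\<in>E. compact (fst (V k)) \<and> fst (V k) \<subseteq> Z \<and> open (snd (V k)) \<and>
        fst (V k) = Z \<inter> snd (V k) \<and> k \<in> fst (V k) \<and> (\<forall>w\<in>fst (V k). fst w < c + n k)" ..
    define U O' where "U k = fst (V k)" and "O' k = snd (V k)" for k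
    have U: "compact (U k) \<and> U k \<subseteq> Z \<and> open (O' k) \<and> U k = Z \<inter> O' k \<and> k \<in> U k \<and> (\<forall>w\<in>U k. fst w < c + n k)" if "k \<in> E" for k
      using bspec[OF V that] unfolding U_def O'_def .
    have "E \<subseteq> (\<Union>k\<in>E. O' k)" using U by blast
    then obtain F where F: "F \<subseteq> E" "finite F" "E \<subseteq> (\<Union>k\<in>F. O' k)"
      using compactE_image[OF compE, of E O'] U by blast
    define L where "L = c + real (Suc (sum n F))"
    have nL: "c + n k \<le> L" if "k \<in> F" for k
    proof -
      have "n k \<le> sum n F" using that F(2) by (intro member_le_sum) auto
      then have "real (n k) \<le> real (sum n F)" by (rule of_nat_mono)
      then show ?thesis by (simp add: L_def)
    qed
    define A where "A = (\<Union>k\<in>F. U k)"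
    define B where "B = S L - (\<Union>k\<in>F. O' k)"
    have "open (\<Union>k\<in>F. O' k)" using U F(1) by blast
    then have cB: "compact B" unfolding B_def by (intro compact_diff compS)
    have cA: "compact A" unfolding A_def using F U by (intro compact_UN) auto
    have AB: "A \<inter> B = {}" unfolding A_def B_def using F(1) U by blast
    have "U k = Z \<inter> O' k" "U k \<subseteq> S L" if "k \<in> F" for k
      using U[of k] F(1) that nL[OF that] unfolding S_def by force+
    then have AuB: "A \<union> B = S L" unfolding A_def B_def S_def by fastforce
    have EA: "w \<in> A" if "w \<in> Z" "fst w = c" for w
      using F(1,3) U that unfolding A_def E_def by blast
    have TB: "w \<in> B" if "w \<in> Z" "fst w = L" for w
    proof -
      have "w \<notin> A" using U F(1) nL that(2) unfolding A_def by force
      moreover have "w \<in> S L" using that by (simp add: S_def)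
      ultimately show ?thesis using AuB by blast
    qed
    have "c < L" unfolding L_def using of_nat_0_less_iff[of "Suc (sum n F)"] by linarith
    then show False
      using nosep[OF _ cA cB AB AuB[unfolded S_def]] EA TB by blast
  qed
  then obtain k where k: "k \<in> E"
    "\<And>n::nat. (0::nat) < n \<Longrightarrow> \<exists>C \<subseteq> S (c + n). connected C \<and> k \<in> C \<and> (\<exists>w\<in>C. fst w = c + n)"
    by blast
  then have "\<forall>n\<in>{0<..}. \<exists>C \<subseteq> S (c + real n). connected C \<and> k \<in> C \<and> (\<exists>w\<in>C. fst w = c + n)" by simp
  from bchoice[OF this] obtain C where C: "\<And>n::nat. (0::nat) < n \<Longrightarrow> C n \<subseteq> S (c + n) \<and> connected (C n) \<and> k \<in> C n \<and> (\<exists>w\<in>C n. fst w = c + n)"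
    by auto
  define K where "K = (\<Union>n\<in>{0<..}. C n)"
  have "connected K" unfolding K_def by (rule connected_Union) (use C in auto)
  moreover have "K \<subseteq> Z" unfolding K_def using C by (auto simp: S_def)
  moreover have "x \<in> fst ` K" if "c \<le> x" for x
  proof -
    obtain n :: nat where n: "x - c < n" using reals_Archimedean2 by blast
    with that have "0 < n" by (cases n) auto
    then have Cn: "connected (C n)" "k \<in> C n" "\<exists>w\<in>C n. fst w = c + n" using C[of n] by auto
    have cn: "connected (fst ` C n)"
      using Cn(1) by (intro connected_continuous_image continuous_intros)
    have cc: "c \<in> fst ` C n" using Cn(2) k(1) unfolding E_def by force
    have cd: "c + n \<in> fst ` C n" using Cn(3) by force
    then have "x \<in> fst ` C n"
      using connected_contains_Icc[OF cn cc cd] n that by (auto simp: subset_iff)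
    then show ?thesis using \<open>0 < n\<close> unfolding K_def by blast
  qed
  ultimately show ?thesis by blast
qed

section \<open>Primitives of bounded measurable functions\<close>

text \<open>Everywhere bounded representatives make every indefinite integral Lipschitz.\<close>

definition bounded_measurable01 :: "(real \<Rightarrow> real) \<Rightarrow> bool" where
  "bounded_measurable01 w \<longleftrightarrow> w \<in> borel_measurable (lebesgue_on {0..1}) \<and> (\<exists>B. \<forall>x\<in>{0..1}. \<bar>w x\<bar> \<le> B)"

lemma bounded_measurable01_continuous:
  "continuous_on {0..1} w \<Longrightarrow> bounded_measurable01 w"
  unfolding bounded_measurable01_def
  using sup01_upper[of w] continuous_imp_measurable_on_sets_lebesgue[of "{0..1}" w]
  by (intro conjI exI[of _ "sup01 w"] ballI) auto

lemma bounded_measurable01_mult: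
  assumes "bounded_measurable01 v" "bounded_measurable01 w"
  shows "bounded_measurable01 (\<lambda>x. v x * w x)"
proof -
  obtain B C where BC: "\<And>x. x \<in> {0..1} \<Longrightarrow> \<bar>v x\<bar> \<le> B" "\<And>x. x \<in> {0..1} \<Longrightarrow> \<bar>w x\<bar> \<le> C"
    using assms unfolding bounded_measurable01_def by blast
  have "\<bar>v x * w x\<bar> \<le> B * C" if "x \<in> {0..1}" for x
    unfolding abs_mult using BC(1)[OF that] BC(2)[OF that] by (intro mult_mono) auto
  then show ?thesis
    using assms unfolding bounded_measurable01_def by (blast intro: borel_measurable_times)
qed

lemma bounded_measurable01_cmult:
  "bounded_measurable01 w \<Longrightarrow> bounded_measurable01 (\<lambda>x. c * w x)"
  by (rule bounded_measurable01_mult[OF bounded_measurable01_continuous]) auto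

lemma bounded_measurable01_abs_integrable:
  assumes "bounded_measurable01 w" "0 \<le> x" "y \<le> 1"
  shows "w absolutely_integrable_on {x..y}"
proof -
  obtain B where B: "\<And>x. x \<in> {0..1} \<Longrightarrow> \<bar>w x\<bar> \<le> B" and m: "w \<in> borel_measurable (lebesgue_on {0..1})"
    using assms unfolding bounded_measurable01_def by blast
  have "(\<lambda>_. B) integrable_on {0..1::real}" by (rule Henstock_Kurzweil_Integration.integrable_const_ivl)
  then have "w absolutely_integrable_on {0..1}"
    using measurable_bounded_by_integrable_imp_absolutely_integrable[OF m _ \<open>(\<lambda>_. B) integrable_on {0..1::real}\<close>] B by auto
  then show ?thesis
    by (rule absolutely_integrable_on_subinterval) (use assms in auto)
qed

lemma bounded_measurable01_integrable:
  assumes "bounded_measurable01 w" "0 \<le> x" "y \<le> 1"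
  shows "w integrable_on {x..y}"
  using bounded_measurable01_abs_integrable[OF assms] absolutely_integrable_on_def by blast

lemma bounded_measurable01_lebesgue_integrable:
  assumes "bounded_measurable01 w"
  shows "integrable (lebesgue_on {0<..<1}) w" "(LINT x|lebesgue_on {0<..<1}. w x) = integral {0..1} w"
proof -
  have "w absolutely_integrable_on {0<..<1}"
    by (rule set_integrable_subset[OF bounded_measurable01_abs_integrable[OF assms, of 0 1]]) auto
  then show *: "integrable (lebesgue_on {0<..<1}) w"
    by (simp add: integrable_restrict_space set_integrable_def)
  then show "(LINT x|lebesgue_on {0<..<1}. w x) = integral {0..1} w"
    by (simp add: lebesgue_integral_eq_integral integral_open_interval_real)
qed

lemma integral_initial_diff:
  assumes "bounded_measurable01 w" "0 \<le> x" "x \<le> y" "y \<le> 1"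
  shows "integral {0..y} w - integral {0..x} w = integral {x..y} w"
  using Henstock_Kurzweil_Integration.integral_combine[of 0 x y w] bounded_measurable01_integrable[OF assms(1), of 0 y] assms by simp

lemma integral_diff_bound:
  assumes w: "bounded_measurable01 w" and "x \<in> {0..1}" "y \<in> {0..1}"
    and B: "\<And>t. t \<in> {0..1} \<Longrightarrow> min x y \<le> t \<Longrightarrow> t \<le> max x y \<Longrightarrow> \<bar>w t\<bar> \<le> B"
  shows "\<bar>integral {0..y} w - integral {0..x} w\<bar> \<le> B * \<bar>y - x\<bar>"
proof -
  have *: "\<bar>integral {0..v} w - integral {0..u} w\<bar> \<le> B * (v - u)"
    if "0 \<le> u" "u \<le> v" "v \<le> 1" and B: "\<And>t. u \<le> t \<Longrightarrow> t \<le> v \<Longrightarrow> \<bar>w t\<bar> \<le> B" for u v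
  proof -
    have "norm (integral {u..v} w) \<le> integral {u..v} (\<lambda>_. B)"
      by (rule integral_norm_bound_integral) (use that w bounded_measurable01_integrable in auto)
    then show ?thesis using integral_initial_diff[OF w] that by (simp add: mult.commute)
  qed
  show ?thesis
  proof (cases "x \<le> y")
    case True then show ?thesis using *[of x y] assms by auto
  next
    case False then show ?thesis using *[of y x] assms by (auto simp: abs_minus_commute)
  qed
qed

lemma continuous_on_primitive:
  assumes "bounded_measurable01 w"
  shows "continuous_on {0..1} (\<lambda>x. integral {0..x} w)"
  using indefinite_integral_continuous_1 bounded_measurable01_integrable[OF assms, of 0 1] by blast

text \<open>Both the chain rule and the product rule below rest on this expansion: the difference of the two
  sides of the rule has derivative \<open>0\<close> at every single point, although \<open>w\<close> is only measurable.\<close>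

lemma primitive_mult_continuous_expansion:
  assumes w: "bounded_measurable01 w" and k: "continuous_on {0..1} k" and x: "x \<in> {0..1}"
  shows "((\<lambda>y. integral {0..y} (\<lambda>t. k t * w t) - k x * integral {0..y} w) has_real_derivative 0) (at x within {0..1})"
proof -
  obtain B where B: "\<And>x. x \<in> {0..1} \<Longrightarrow> \<bar>w x\<bar> \<le> B"
    using w unfolding bounded_measurable01_def by blast
  have B0: "0 \<le> B" using B[OF x] by linarith
  have kw: "bounded_measurable01 (\<lambda>t. k t * w t)"
    by (intro bounded_measurable01_mult bounded_measurable01_continuous w k)
  have cw: "bounded_measurable01 (\<lambda>t. k x * w t)" by (rule bounded_measurable01_cmult[OF w])
  have dw: "bounded_measurable01 (\<lambda>t. (k t - k x) * w t)"
    by (intro bounded_measurable01_mult bounded_measurable01_continuous w continuous_intros k)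
  have eq: "integral {0..y} (\<lambda>t. k t * w t) - k x * integral {0..y} w = integral {0..y} (\<lambda>t. (k t - k x) * w t)"
    if "y \<in> {0..1}" for y
    using integral_diff[OF bounded_measurable01_integrable[OF kw, of 0 y] bounded_measurable01_integrable[OF cw, of 0 y]] that
    by (simp add: left_diff_distrib)
  have "((\<lambda>y. integral {0..y} (\<lambda>t. (k t - k x) * w t)) has_derivative (\<lambda>h. h * 0)) (at x within {0..1})"
    unfolding has_derivative_within_alt
  proof (intro conjI allI impI)
    fix e :: real assume e: "0 < e"
    obtain d where d: "0 < d" "\<And>t. t \<in> {0..1} \<Longrightarrow> \<bar>t - x\<bar> < d \<Longrightarrow> \<bar>k t - k x\<bar> < e / (B + 1)"
      using k x e B0 unfolding continuous_on_iff dist_real_def by (metis add_nonneg_pos divide_pos_pos zero_less_one)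
    have "\<bar>integral {0..y} (\<lambda>t. (k t - k x) * w t) - integral {0..x} (\<lambda>t. (k t - k x) * w t)\<bar> \<le> e * \<bar>y - x\<bar>"
      if y: "y \<in> {0..1}" "\<bar>y - x\<bar> < d" for y
    proof (rule integral_diff_bound[OF dw x y(1)])
      fix t assume t: "t \<in> {0..1}" "min x y \<le> t" "t \<le> max x y"
      then have "\<bar>t - x\<bar> < d" using y(2) by (auto simp: min_def max_def split: if_splits)
      then have "\<bar>k t - k x\<bar> * \<bar>w t\<bar> \<le> e / (B + 1) * (B + 1)"
        using d(2)[of t] t(1) B[of t] B0 e by (intro mult_mono) auto
      then show "\<bar>(k t - k x) * w t\<bar> \<le> e" using B0 by (simp add: abs_mult)
    qed
    then show "\<exists>d>0. \<forall>y\<in>{0..1}. norm (y - x) < d \<longrightarrow>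
        norm (integral {0..y} (\<lambda>t. (k t - k x) * w t) - integral {0..x} (\<lambda>t. (k t - k x) * w t) - (y - x) * 0) \<le> e * norm (y - x)"
      using d(1) by auto
  qed (auto intro: bounded_linear_mult_left)
  then have "((\<lambda>y. integral {0..y} (\<lambda>t. (k t - k x) * w t)) has_real_derivative 0) (at x within {0..1})"
    by (simp add: has_field_derivative_def mult.commute[of 0] lambda_zero)
  then show ?thesis
    by (rule has_field_derivative_transform_within[OF _ zero_less_one x]) (simp add: eq)
qed

lemma continuous_on_eq_primitive:
  assumes "bounded_measurable01 w" "\<And>x. x \<in> {0..1} \<Longrightarrow> F x = F 0 + integral {0..x} w"
  shows "continuous_on {0..1} F"
proof -
  have "continuous_on {0..1} (\<lambda>x. F 0 + integral {0..x} w)"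
    by (intro continuous_intros continuous_on_primitive assms(1))
  then show ?thesis by (rule continuous_on_eq) (rule assms(2)[symmetric])
qed

lemma constant_on_01:
  fixes g :: "real \<Rightarrow> real"
  assumes "\<And>x. x \<in> {0..1} \<Longrightarrow> (g has_real_derivative 0) (at x within {0..1})" "x \<in> {0..1}"
  shows "g x = g 0"
  using has_derivative_zero_unique[of "{0..1}" g 0 x] assms
  by (auto simp: has_field_derivative_def lambda_zero)

lemma chain_rule_primitive:
  assumes w: "bounded_measurable01 w" and F: "\<And>x. x \<in> {0..1} \<Longrightarrow> F x = F 0 + integral {0..x} w"
    and deriv: "\<And>x. x \<in> {0..1} \<Longrightarrow> (g has_real_derivative g' (F x)) (at (F x))"
    and cont: "continuous_on {0..1} (\<lambda>x. g' (F x))" and x: "x \<in> {0..1}"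
  shows "g (F x) = g (F 0) + integral {0..x} (\<lambda>t. g' (F t) * w t)"
proof -
  define R where "R y = g (F y) - integral {0..y} (\<lambda>t. g' (F t) * w t)" for y
  obtain B where B: "\<And>x. x \<in> {0..1} \<Longrightarrow> \<bar>w x\<bar> \<le> B"
    using w unfolding bounded_measurable01_def by blast
  have B0: "0 \<le> B" using B[OF x] by linarith
  have lip: "\<bar>F z - F y\<bar> \<le> B * \<bar>z - y\<bar>" if "y \<in> {0..1}" "z \<in> {0..1}" for y z
    using integral_diff_bound[OF w that B] F[OF that(1)] F[OF that(2)] by simp
  have "(R has_real_derivative 0) (at y within {0..1})" if y: "y \<in> {0..1}" for y
  proof -
    have "((\<lambda>z. g (F z) - g' (F y) * F z) has_derivative (\<lambda>h. h * 0)) (at y within {0..1})"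
      unfolding has_derivative_within_alt
    proof (intro conjI allI impI)
      fix e :: real assume e: "0 < e"
      have "(g has_derivative (\<lambda>h. g' (F y) * h)) (at (F y))"
        using deriv[OF y] by (simp add: has_field_derivative_def)
      moreover have "0 < e / (B + 1)" using e B0 by simp
      ultimately obtain d where d: "0 < d" "\<And>u. \<bar>u - F y\<bar> < d \<Longrightarrow> \<bar>g u - g (F y) - g' (F y) * (u - F y)\<bar> \<le> e / (B + 1) * \<bar>u - F y\<bar>"
        unfolding has_derivative_at_alt real_norm_def by blast
      have "\<bar>g (F z) - g' (F y) * F z - (g (F y) - g' (F y) * F y)\<bar> \<le> e * \<bar>z - y\<bar>"
        if z: "z \<in> {0..1}" "\<bar>z - y\<bar> < d / (B + 1)" for z
      proof -
        have "B * \<bar>z - y\<bar> \<le> (B + 1) * \<bar>z - y\<bar>" by (simp add: algebra_simps)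
        then have le: "\<bar>F z - F y\<bar> \<le> (B + 1) * \<bar>z - y\<bar>" using lip[OF y z(1)] by linarith
        also have "\<dots> < d" using z(2) B0 by (simp add: field_simps)
        finally have "\<bar>g (F z) - g (F y) - g' (F y) * (F z - F y)\<bar> \<le> e / (B + 1) * \<bar>F z - F y\<bar>" by (rule d(2))
        also have "\<dots> \<le> e / (B + 1) * ((B + 1) * \<bar>z - y\<bar>)" using le e B0 by (intro mult_left_mono) auto
        also have "\<dots> = e * \<bar>z - y\<bar>" using B0 by simp
        finally show ?thesis by (simp add: algebra_simps)
      qed
      moreover have "0 < d / (B + 1)" using d(1) B0 by simp
      ultimately show "\<exists>d>0. \<forall>z\<in>{0..1}. norm (z - y) < d \<longrightarrow>
          norm (g (F z) - g' (F y) * F z - (g (F y) - g' (F y) * F y) - (z - y) * 0) \<le> e * norm (z - y)"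
        by (intro exI[of _ "d / (B + 1)"]) auto
    qed (auto intro: bounded_linear_mult_left)
    then have 1: "((\<lambda>z. g (F z) - g' (F y) * F z) has_real_derivative 0) (at y within {0..1})"
      by (simp add: has_field_derivative_def lambda_zero)
    have "((\<lambda>z. (g (F z) - g' (F y) * F z) - (integral {0..z} (\<lambda>t. g' (F t) * w t) - g' (F y) * integral {0..z} w) + g' (F y) * F 0)
       has_real_derivative 0 - 0 + 0) (at y within {0..1})"
      by (intro DERIV_add DERIV_diff 1 primitive_mult_continuous_expansion[OF w cont y] DERIV_const)
    then have "((\<lambda>z. (g (F z) - g' (F y) * F z) - (integral {0..z} (\<lambda>t. g' (F t) * w t) - g' (F y) * integral {0..z} w) + g' (F y) * F 0)
       has_real_derivative 0) (at y within {0..1})" by simp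
    moreover have "(g (F z) - g' (F y) * F z) - (integral {0..z} (\<lambda>t. g' (F t) * w t) - g' (F y) * integral {0..z} w) + g' (F y) * F 0 = R z"
      if "z \<in> {0..1}" for z
      using F[OF that] by (simp add: R_def algebra_simps)
    ultimately show ?thesis
      by (rule has_field_derivative_transform_within[OF _ zero_less_one y]) simp
  qed
  then have "R x = R 0" using x by (rule constant_on_01)
  then show ?thesis by (simp add: R_def)
qed

lemma product_rule_primitive:
  assumes w: "bounded_measurable01 w" and F: "\<And>x. x \<in> {0..1} \<Longrightarrow> F x = F 0 + integral {0..x} w"
    and deriv: "\<And>x. x \<in> {0..1} \<Longrightarrow> (k has_real_derivative k' x) (at x within {0..1})"
    and cont: "continuous_on {0..1} k'" and x: "x \<in> {0..1}"
  shows "k x * F x = k 0 * F 0 + integral {0..x} (\<lambda>t. k t * w t) + integral {0..x} (\<lambda>t. F t * k' t)"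
proof -
  have ck: "continuous_on {0..1} k" using deriv by (rule DERIV_continuous_on)
  have cF: "continuous_on {0..1} F" by (rule continuous_on_eq_primitive[OF w F])
  define R where "R y = k y * F y - integral {0..y} (\<lambda>t. k t * w t) - integral {0..y} (\<lambda>t. F t * k' t)" for y
  have "(R has_real_derivative 0) (at y within {0..1})" if y: "y \<in> {0..1}" for y
  proof -
    have "((\<lambda>z. (k z - k y) * (F z - F y)) has_derivative (\<lambda>h. h * 0)) (at y within {0..1})"
    proof -
      have "((\<lambda>z. (k z - k y) / (z - y) * (F z - F y)) \<longlongrightarrow> k' y * (F y - F y)) (at y within {0..1})"
        using deriv[OF y] bspec[OF cF[unfolded continuous_on_def] y] unfolding has_field_derivative_iff by (intro tendsto_mult tendsto_diff tendsto_const)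
      then have "((\<lambda>z. (k z - k y) * (F z - F y)) has_real_derivative 0) (at y within {0..1})"
        unfolding has_field_derivative_iff by simp
      then show ?thesis by (simp add: has_field_derivative_def lambda_zero)
    qed
    then have 1: "((\<lambda>z. (k z - k y) * (F z - F y)) has_real_derivative 0) (at y within {0..1})"
      by (simp add: has_field_derivative_def lambda_zero)
    have 2: "((\<lambda>z. integral {0..z} (\<lambda>t. F t * k' t)) has_real_derivative F y * k' y) (at y within {0..1})"
      by (rule integral_has_real_derivative[OF _ y]) (intro continuous_intros cF cont)
    have "((\<lambda>z. (k z - k y) * (F z - F y) - (integral {0..z} (\<lambda>t. k t * w t) - k y * integral {0..z} w) + k y * F 0
          + (k z - k y) * F y - integral {0..z} (\<lambda>t. F t * k' t))
       has_real_derivative 0 - 0 + 0 + (k' y - 0) * F y - F y * k' y) (at y within {0..1})"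
      by (intro DERIV_add DERIV_diff DERIV_cmult_right 1 2 primitive_mult_continuous_expansion[OF w ck y] DERIV_const deriv y)
    then have "((\<lambda>z. (k z - k y) * (F z - F y) - (integral {0..z} (\<lambda>t. k t * w t) - k y * integral {0..z} w) + k y * F 0
          + (k z - k y) * F y - integral {0..z} (\<lambda>t. F t * k' t))
       has_real_derivative 0) (at y within {0..1})" by simp
    moreover have "(k z - k y) * (F z - F y) - (integral {0..z} (\<lambda>t. k t * w t) - k y * integral {0..z} w) + k y * F 0
          + (k z - k y) * F y - integral {0..z} (\<lambda>t. F t * k' t) = R z"
      if "z \<in> {0..1}" for z
      using F[OF that] by (simp add: R_def algebra_simps)
    ultimately show ?thesis
      by (rule has_field_derivative_transform_within[OF _ zero_less_one y]) simp
  qed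
  then have "R x = R 0" using x by (rule constant_on_01)
  then show ?thesis by (simp add: R_def)
qed

section \<open>Weak derivatives and primitives\<close>

lemma weak_derivative_primitive:
  assumes w: "bounded_measurable01 w" and F: "\<And>x. x \<in> {0..1} \<Longrightarrow> F x = F 0 + integral {0..x} w"
  shows "weak_derivative01 F w"
  unfolding weak_derivative01_def
proof (intro conjI allI impI)
  have cF: "continuous_on {0..1} F" by (rule continuous_on_eq_primitive[OF w F])
  show "integrable (lebesgue_on {0<..<1}) F" "integrable (lebesgue_on {0<..<1}) w"
    by (intro bounded_measurable01_lebesgue_integrable bounded_measurable01_continuous cF w)+
  fix \<phi> :: "real \<Rightarrow> real" assume \<phi>: "\<phi> C1_differentiable_on UNIV \<and> closure {x. \<phi> x \<noteq> 0} \<subseteq> {0<..<1}"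
  then obtain \<phi>' where \<phi>': "\<And>x. (\<phi> has_real_derivative \<phi>' x) (at x)" "continuous_on UNIV \<phi>'"
    unfolding C1_differentiable_on_def has_real_derivative_iff_has_vector_derivative by blast
  have "deriv \<phi> = \<phi>'" by (intro ext DERIV_imp_deriv \<phi>'(1))
  then have d: "(\<phi> has_real_derivative deriv \<phi> x) (at x)" and cd: "continuous_on UNIV (deriv \<phi>)" for x
    using \<phi>' by simp_all
  have c: "continuous_on {0..1} (deriv \<phi>)" using cd continuous_on_subset by blast
  have c\<phi>: "continuous_on {0..1} \<phi>" using d by (auto intro: DERIV_continuous_on DERIV_subset)
  have "\<phi> 0 = 0" "\<phi> 1 = 0" using \<phi> closure_subset[of "{x. \<phi> x \<noteq> 0}"] by auto
  then have "integral {0..1} (\<lambda>t. F t * deriv \<phi> t) = - integral {0..1} (\<lambda>t. w t * \<phi> t)"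
    using product_rule_primitive[OF w F DERIV_subset[OF d subset_UNIV] c, of 1] by (simp add: mult.commute)
  then show "(LINT x|lebesgue_on {0<..<1}. F x * deriv \<phi> x) = - (LINT x|lebesgue_on {0<..<1}. w x * \<phi> x)"
    by (simp add: bounded_measurable01_lebesgue_integrable(2) bounded_measurable01_mult bounded_measurable01_continuous cF c c\<phi> w)
qed


text \<open>The test function is the primitive of \<open>\<eta> (h - c)\<close>, where \<open>\<eta>\<close> is a cutoff supported in \<open>[d, 1-d]\<close>
  and \<open>c\<close> is the \<open>\<eta>\<close>-mean of \<open>h\<close>; that choice of \<open>c\<close> makes it vanish beyond \<open>1-d\<close> as well.
  Testing with it gives \<open>\<integral> \<eta> (h - c)\<^sup>2 = 0\<close>.\<close>

lemma du_Bois_Reymond: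
  fixes h :: "real \<Rightarrow> real"
  assumes h: "continuous_on {0..1} h"
    and test: "\<And>\<phi>. \<phi> C1_differentiable_on UNIV \<Longrightarrow> closure {x. \<phi> x \<noteq> 0} \<subseteq> {0<..<1} \<Longrightarrow>
        integral {0..1} (\<lambda>x. h x * deriv \<phi> x) = 0"
    and x: "x \<in> {0..1}"
  shows "h x = h 0"
proof -
  have loc: "\<exists>c. \<forall>x. d < x \<and> x < 1 - d \<longrightarrow> h x = c" if d: "0 < d" "d < 1/2" for d
  proof -
    define \<eta> where "\<eta> x = max 0 (min (x - d) (1 - d - x))" for x
    define c where "c = integral {0..1} (\<lambda>x. \<eta> x * h x) / integral {0..1} \<eta>"
    define k where "k x = \<eta> x * (h (max 0 (min 1 x)) - c)" for x
    define \<phi> where "\<phi> x = integral {0..x} k" for x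
    have c\<eta>: "continuous_on S \<eta>" for S unfolding \<eta>_def by (intro continuous_intros)
    have ck: "continuous_on S k" for S
      unfolding k_def by (intro continuous_intros c\<eta> continuous_on_compose2[OF h]) auto
    have k0: "k x = 0" if "x \<le> d \<or> 1 - d \<le> x" for x using that d by (auto simp: k_def \<eta>_def max_def min_def)
    have k01: "k x = \<eta> x * (h x - c)" if "x \<in> {0..1}" for x using that by (simp add: k_def)
    have "integral {0..1} \<eta> \<noteq> 0"
    proof
      assume "integral {0..1} \<eta> = 0"
      then have "\<forall>x\<in>{0..1}. \<eta> x = 0"
        by (subst (asm) integral_eq_0_iff) (auto simp: \<eta>_def intro!: c\<eta>[unfolded \<eta>_def])
      then have "\<eta> (1/2) = 0" by auto
      then show False using d by (simp add: \<eta>_def max_def min_def split: if_splits)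
    qed
    moreover have "integral {0..1} k = integral {0..1} (\<lambda>x. \<eta> x * h x) - c * integral {0..1} \<eta>"
    proof -
      have "integral {0..1} k = integral {0..1} (\<lambda>x. \<eta> x * h x - c * \<eta> x)"
        by (intro integral_cong) (simp add: k01 algebra_simps)
      also have "\<dots> = integral {0..1} (\<lambda>x. \<eta> x * h x) - integral {0..1} (\<lambda>x. c * \<eta> x)"
        by (intro integral_diff integrable_continuous_real continuous_intros c\<eta> h)
      finally show ?thesis by simp
    qed
    ultimately have k1: "integral {0..1} k = 0" by (simp add: c_def)
    have ik: "k integrable_on {u..v}" for u v by (rule integrable_continuous_real[OF ck])
    have \<phi>0: "\<phi> x = 0" if "x \<le> d" for x
    proof -
      have "integral {0..x} k = integral {0..x} (\<lambda>_. 0)" using that k0 by (intro integral_cong) auto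
      then show ?thesis by (simp add: \<phi>_def)
    qed
    have \<phi>1: "\<phi> x = 0" if "1 - d \<le> x" for x
    proof -
      have tail: "integral {1 - d..v} k = 0" if "v \<ge> 1 - d" for v
      proof -
        have "integral {1 - d..v} k = integral {1 - d..v} (\<lambda>_. 0)" using k0 by (intro integral_cong) auto
        then show ?thesis by simp
      qed
      have "\<phi> v = integral {0..1-d} k" if "v \<ge> 1 - d" for v
        using Henstock_Kurzweil_Integration.integral_combine[of 0 "1 - d" v k] tail[OF that] that d ik by (simp add: \<phi>_def)
      from this[of x] this[of 1] show ?thesis using that d k1 by (simp add: \<phi>_def)
    qed
    have d\<phi>: "(\<phi> has_real_derivative k x) (at x)" for x
    proof -
      consider "x < d" | "1 - d < x" | "x \<in> {0<..<1}" using d by fastforce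
      then show ?thesis
      proof cases
        case 1
        have "((\<lambda>_. 0) has_real_derivative k x) (at x)" using 1 k0[of x] by simp
        then show ?thesis
          by (rule has_field_derivative_transform_within[of _ _ _ _ "d - x"]) (use 1 \<phi>0 in \<open>auto simp: dist_real_def\<close>)
      next
        case 2
        have "((\<lambda>_. 0) has_real_derivative k x) (at x)" using 2 k0[of x] by simp
        then show ?thesis
          by (rule has_field_derivative_transform_within[of _ _ _ _ "x - (1 - d)"]) (use 2 \<phi>1 in \<open>auto simp: dist_real_def\<close>)
      next
        case 3
        then have "(\<phi> has_real_derivative k x) (at x within {0..1})"
          unfolding \<phi>_def by (intro integral_has_real_derivative ck) auto
        then show ?thesis using 3 by (simp add: at_within_Icc_at)
      qed
    qed
    have dk: "deriv \<phi> = k" by (intro ext DERIV_imp_deriv d\<phi>)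
    have "\<phi> C1_differentiable_on UNIV"
      unfolding C1_differentiable_on_def using d\<phi> ck by (auto simp: has_real_derivative_iff_has_vector_derivative)
    moreover have "closure {x. \<phi> x \<noteq> 0} \<subseteq> {d..1-d}"
    proof (rule closure_minimal)
      show "{x. \<phi> x \<noteq> 0} \<subseteq> {d..1-d}"
      proof
        fix x assume "x \<in> {x. \<phi> x \<noteq> 0}"
        then have "\<not> x \<le> d" "\<not> 1 - d \<le> x" using \<phi>0[of x] \<phi>1[of x] by auto
        then show "x \<in> {d..1-d}" by simp
      qed
    qed simp
    then have "closure {x. \<phi> x \<noteq> 0} \<subseteq> {0<..<1}" using d by fastforce
    ultimately have "integral {0..1} (\<lambda>x. h x * k x) = 0" using test[of \<phi>] by (simp add: dk)
    moreover have "integral {0..1} (\<lambda>x. h x * k x - c * k x) = integral {0..1} (\<lambda>x. h x * k x) - integral {0..1} (\<lambda>x. c * k x)"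
      by (intro integral_diff integrable_continuous_real continuous_intros ck h)
    ultimately have "integral {0..1} (\<lambda>x. h x * k x - c * k x) = 0" using k1 by simp
    moreover have "integral {0..1} (\<lambda>x. h x * k x - c * k x) = integral {0..1} (\<lambda>x. \<eta> x * (h x - c)\<^sup>2)"
      by (intro integral_cong) (simp add: k01 algebra_simps power2_eq_square)
    ultimately have "integral {0..1} (\<lambda>x. \<eta> x * (h x - c)\<^sup>2) = 0" by simp
    then have "\<forall>x\<in>{0..1}. \<eta> x * (h x - c)\<^sup>2 = 0"
      by (subst (asm) integral_eq_0_iff) (auto intro!: continuous_intros c\<eta> h simp: \<eta>_def)
    moreover have "\<eta> x \<noteq> 0 \<and> x \<in> {0..1}" if "d < x" "x < 1 - d" for x
      using that d by (simp add: \<eta>_def)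
    ultimately have "\<forall>x. d < x \<and> x < 1 - d \<longrightarrow> h x = c" by fastforce
    then show ?thesis by blast
  qed
  have inner: "h y = h (1/2)" if "y \<in> {0<..<1}" for y
  proof -
    let ?d = "min y (1 - y) / 2"
    have "0 < ?d" "?d < 1/2" using that by (auto simp: min_def)
    from loc[OF this] obtain c where c: "\<forall>x. ?d < x \<and> x < 1 - ?d \<longrightarrow> h x = c" ..
    have "?d < y \<and> y < 1 - ?d" "?d < 1/2 \<and> 1/2 < 1 - ?d" using that by (auto simp: min_def field_simps)
    then have "h y = c" "h (1/2) = c" using c[rule_format, of y] c[rule_format, of "1/2"] by blast+
    then show ?thesis by simp
  qed
  have cl: "continuous_on (closure {0<..<1}) h" using h by simp
  have "h y = h (1/2)" if "y \<in> {0..1}" for y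
  proof (rule continuous_constant_on_closure[OF cl])
    show "y \<in> closure {0<..<1}" using that by simp
  qed (rule inner)
  from this[OF x] this[of 0] have "h x = h (1/2)" "h 0 = h (1/2)" by auto
  then show ?thesis by (rule trans[OF _ sym])
qed

lemma primitive_of_weak_derivative:
  assumes wd: "weak_derivative01 F g" and cF: "continuous_on {0..1} F"
    and w: "bounded_measurable01 w" and gw: "AE x in lebesgue_on {0<..<1}. g x = w x"
    and x: "x \<in> {0..1}"
  shows "F x = F 0 + integral {0..x} w"
proof -
  let ?W = "\<lambda>x. integral {0..x} w"
  have cW: "continuous_on {0..1} ?W" by (rule continuous_on_primitive[OF w])
  have wdW: "weak_derivative01 ?W w" by (rule weak_derivative_primitive[OF w]) simp
  have "integral {0..1} (\<lambda>x. (F x - ?W x) * deriv \<phi> x) = 0"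
    if \<phi>: "\<phi> C1_differentiable_on UNIV" "closure {x. \<phi> x \<noteq> 0} \<subseteq> {0<..<1}" for \<phi> :: "real \<Rightarrow> real"
  proof -
    obtain \<phi>' where \<phi>': "\<And>x. (\<phi> has_real_derivative \<phi>' x) (at x)" "continuous_on UNIV \<phi>'"
      using \<phi>(1) unfolding C1_differentiable_on_def has_real_derivative_iff_has_vector_derivative by blast
    have "deriv \<phi> = \<phi>'" by (intro ext DERIV_imp_deriv \<phi>'(1))
    then have c: "continuous_on {0..1} (deriv \<phi>)" using continuous_on_subset[OF \<phi>'(2)] by simp
    have c\<phi>: "continuous_on {0..1} \<phi>" by (rule DERIV_continuous_on) (rule DERIV_subset[OF \<phi>'(1) subset_UNIV])
    have m: "bounded_measurable01 (\<lambda>x. w x * \<phi> x)"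
      by (intro bounded_measurable01_mult bounded_measurable01_continuous c\<phi> w)
    have "(LINT x|lebesgue_on {0<..<1}. g x * \<phi> x) = (LINT x|lebesgue_on {0<..<1}. w x * \<phi> x)"
    proof (rule integral_cong_AE)
      have "g \<in> borel_measurable (lebesgue_on {0<..<1})" using wd by (auto simp: weak_derivative01_def)
      moreover have "\<phi> \<in> borel_measurable (lebesgue_on {0<..<1})"
        using bounded_measurable01_lebesgue_integrable(1)[OF bounded_measurable01_continuous[OF c\<phi>]] by auto
      ultimately show "(\<lambda>x. g x * \<phi> x) \<in> borel_measurable (lebesgue_on {0<..<1})" by (rule borel_measurable_times)
      show "(\<lambda>x. w x * \<phi> x) \<in> borel_measurable (lebesgue_on {0<..<1})"
        using bounded_measurable01_lebesgue_integrable(1)[OF m] by auto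
      show "AE x in lebesgue_on {0<..<1}. g x * \<phi> x = w x * \<phi> x" using gw by eventually_elim simp
    qed
    then have "(LINT x|lebesgue_on {0<..<1}. F x * deriv \<phi> x) = (LINT x|lebesgue_on {0<..<1}. ?W x * deriv \<phi> x)"
      using wd wdW \<phi> unfolding weak_derivative01_def by simp
    then have "integral {0..1} (\<lambda>x. F x * deriv \<phi> x) = integral {0..1} (\<lambda>x. ?W x * deriv \<phi> x)"
      by (simp add: bounded_measurable01_lebesgue_integrable(2) bounded_measurable01_mult bounded_measurable01_continuous cF cW c)
    moreover have "integral {0..1} (\<lambda>x. F x * deriv \<phi> x - ?W x * deriv \<phi> x) =
        integral {0..1} (\<lambda>x. F x * deriv \<phi> x) - integral {0..1} (\<lambda>x. ?W x * deriv \<phi> x)"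
      by (intro integral_diff integrable_continuous_real continuous_intros cF cW c)
    ultimately show ?thesis by (simp add: left_diff_distrib)
  qed
  from du_Bois_Reymond[OF _ this x] have "F x - ?W x = F 0 - ?W 0"
    using cF cW by (simp add: continuous_on_diff)
  then show ?thesis by simp
qed

section \<open>Elements of the space of continuously differentiable functions\<close>

definition prim :: "real \<Rightarrow> (real \<Rightarrow> real) \<Rightarrow> c1" where
  "prim s d = Abs_c1 (\<lambda>x. if x \<in> {0..1} then s + integral {0..x} d else 0)"

lemma
  assumes d: "continuous_on {0..1} d" and x: "x \<in> {0..1}"
  shows app_prim: "app (prim s d) x = s + integral {0..x} d"
    and D_prim: "D (prim s d) x = d x"
proof -
  let ?u = "\<lambda>x. if x \<in> {0..1} then s + integral {0..x} d else 0"
  have deriv: "(?u has_real_derivative d y) (at y within {0..1})" if y: "y \<in> {0..1}" for y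
  proof -
    have "((\<lambda>x. s + integral {0..x} d) has_real_derivative 0 + d y) (at y within {0..1})"
      by (intro DERIV_add DERIV_const integral_has_real_derivative d y)
    then have "((\<lambda>x. s + integral {0..x} d) has_real_derivative d y) (at y within {0..1})" by simp
    then show ?thesis by (rule has_field_derivative_transform_within[OF _ zero_less_one y]) simp
  qed
  have "?u \<in> C1_set" by (rule C1_setI[OF deriv d]) auto
  then have eq: "app (prim s d) = ?u" unfolding prim_def by (rule Abs_c1_inverse)
  show "app (prim s d) x = s + integral {0..x} d" unfolding eq using x by simp
  show "D (prim s d) x = d x" by (rule D_unique[OF x]) (unfold eq, rule deriv[OF x])
qed

lemma app_eq_integral_D:
  assumes "x \<in> {0..1}" "y \<in> {0..1}" "x \<le> y"
  shows "app u y - app u x = integral {x..y} (D u)"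
proof -
  have "(D u has_integral app u y - app u x) {x..y}"
    using assms by (intro fundamental_theorem_of_calculus)
      (auto simp flip: has_real_derivative_iff_has_vector_derivative intro: has_field_derivative_subset[OF has_derivative_D])
  then show ?thesis by (simp add: integral_unique)
qed

lemma continuous_D_on: "{x..y} \<subseteq> {0..1} \<Longrightarrow> continuous_on {x..y} (D u)"
  using continuous_D continuous_on_subset by blast

lemma app_diff_le:
  assumes "x \<in> {0..1}" "y \<in> {0..1}" "x \<le> y" and B: "\<And>t. x \<le> t \<Longrightarrow> t \<le> y \<Longrightarrow> D u t \<le> B"
  shows "app u y - app u x \<le> B * (y - x)"
proof -
  have "integral {x..y} (D u) \<le> integral {x..y} (\<lambda>_. B)"
    using assms by (intro integral_le integrable_continuous_real continuous_D_on continuous_on_const) auto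
  then show ?thesis using app_eq_integral_D[OF assms(1-3)] assms(3) by (simp add: mult.commute)
qed

lemma app_diff_ge:
  assumes "x \<in> {0..1}" "y \<in> {0..1}" "x \<le> y" and B: "\<And>t. x \<le> t \<Longrightarrow> t \<le> y \<Longrightarrow> B \<le> D u t"
  shows "B * (y - x) \<le> app u y - app u x"
proof -
  have "integral {x..y} (\<lambda>_. B) \<le> integral {x..y} (D u)"
    using assms by (intro integral_le integrable_continuous_real continuous_D_on continuous_on_const) auto
  then show ?thesis using app_eq_integral_D[OF assms(1-3)] assms(3) by (simp add: mult.commute)
qed

lemma app_lipschitz:
  assumes "x \<in> {0..1}" "y \<in> {0..1}" and B: "\<And>t. t \<in> {0..1} \<Longrightarrow> \<bar>D u t\<bar> \<le> B"
  shows "\<bar>app u y - app u x\<bar> \<le> B * \<bar>y - x\<bar>"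
proof -
  have *: "\<bar>app u y - app u x\<bar> \<le> B * (y - x)" if xy: "x \<in> {0..1}" "y \<in> {0..1}" "x \<le> y" for x y
  proof -
    have "D u t \<le> B \<and> - B \<le> D u t" if "x \<le> t" "t \<le> y" for t
      using B[of t] that xy by auto
    then show ?thesis using app_diff_le[OF xy, of u B] app_diff_ge[OF xy, of "-B" u] by (simp add: abs_le_iff)
  qed
  show ?thesis using *[of x y] *[of y x] assms by (cases "x \<le> y") (auto simp: abs_minus_commute)
qed

lemma D_diff: "x \<in> {0..1} \<Longrightarrow> D (u - v) x = D u x - D v x"
  using D_simps(2)[of x u "- v"] D_simps(3)[of x "-1" v] by (simp add: scaleR_minus1_left)

lemma app_le_norm: "x \<in> {0..1} \<Longrightarrow> \<bar>app u x\<bar> \<le> norm u"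
  and D_le_norm: "x \<in> {0..1} \<Longrightarrow> \<bar>D u x\<bar> \<le> norm u"
  using sup01_upper[OF continuous_app, of x u] sup01_upper[OF continuous_D, of x u]
    sup01_nonneg[OF continuous_app, of u] sup01_nonneg[OF continuous_D, of u]
  unfolding norm_c1_def by auto

lemma app_diff_le_dist: "x \<in> {0..1} \<Longrightarrow> \<bar>app u x - app v x\<bar> \<le> dist u v"
  using app_le_norm[of x "u - v"] by (simp add: dist_norm app_simps)

lemma norm_c1_le:
  assumes "\<bar>app u 0\<bar> \<le> s" "\<And>x. x \<in> {0..1} \<Longrightarrow> \<bar>D u x\<bar> \<le> e"
  shows "norm u \<le> s + 2 * e"
proof -
  have "\<bar>app u x\<bar> \<le> s + e" if x: "x \<in> {0..1}" for x
  proof -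
    have "e * x \<le> e" using assms(2)[OF x] x by (intro mult_left_le) auto
    then show ?thesis using app_lipschitz[of 0 x u e] assms x by auto
  qed
  then have "sup01 (app u) \<le> s + e" by (rule sup01_least)
  moreover have "sup01 (D u) \<le> e" using assms(2) by (rule sup01_least)
  ultimately show ?thesis by (simp add: norm_c1_def)
qed

lemma dist_c1_le:
  assumes "\<bar>app u 0 - app v 0\<bar> \<le> s" "\<And>x. x \<in> {0..1} \<Longrightarrow> \<bar>D u x - D v x\<bar> \<le> e"
  shows "dist u v \<le> s + 2 * e"
  unfolding dist_norm by (rule norm_c1_le) (use assms in \<open>auto simp: app_simps D_diff\<close>)

lemma tendsto_app: "x \<in> {0..1} \<Longrightarrow> (u \<longlongrightarrow> v) F \<Longrightarrow> ((\<lambda>n. app (u n) x) \<longlongrightarrow> app v x) F"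
  unfolding tendsto_iff dist_real_def using app_diff_le_dist order_le_less_trans
  by (smt (verit) eventually_mono)

section \<open>The inverse of the mean curvature flux\<close>

text \<open>\<open>\<psi> j = j / \<surd>(1 - j\<^sup>2)\<close> inverts \<open>d \<mapsto> d / \<surd>(1 + d\<^sup>2)\<close>, but it blows up at \<open>\<plusminus>1\<close>. Small solutions only
  see fluxes below \<open>1/2\<close>, where the truncation \<open>\<chi>\<close> agrees with it; \<open>\<chi>\<close> is bounded and globally
  Lipschitz, so that its initial value problems never break down.\<close>

definition psi :: "real \<Rightarrow> real" where "psi j = j / sqrt (1 - j\<^sup>2)"

definition chi :: "real \<Rightarrow> real" where "chi j = psi (max (-1/2) (min (1/2) j))"

lemma chi_eq_psi: "\<bar>j\<bar> \<le> 1/2 \<Longrightarrow> chi j = psi j"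
proof -
  assume "\<bar>j\<bar> \<le> 1/2"
  then have "max (-1/2) (min (1/2) j) = j" by (simp add: abs_le_iff)
  then show "chi j = psi j" by (simp add: chi_def)
qed

lemma psi_pos_arg: "\<bar>j\<bar> < 1 \<Longrightarrow> 0 < 1 - j\<^sup>2" for j :: real
  by (simp add: abs_square_less_1)

lemma DERIV_psi:
  assumes "\<bar>j\<bar> < 1"
  shows "(psi has_real_derivative 1 / (sqrt (1 - j\<^sup>2)) ^ 3) (at j)"
proof -
  define r where "r = sqrt (1 - j\<^sup>2)"
  have r: "0 < r" "r\<^sup>2 = 1 - j\<^sup>2" using psi_pos_arg[OF assms] by (simp_all add: r_def)
  have "((\<lambda>j. j / sqrt (1 - j\<^sup>2)) has_real_derivative (1 * r - j * (inverse r / 2 * (0 - 2 * j))) / (r * r)) (at j)"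
    unfolding r_def using psi_pos_arg[OF assms]
    by (auto intro!: derivative_eq_intros simp: field_simps)
  moreover have "(1 * r - j * (inverse r / 2 * (0 - 2 * j))) / (r * r) = 1 / r ^ 3"
    using r by (simp add: field_simps power3_eq_cube power2_eq_square)
  ultimately show ?thesis unfolding psi_def r_def by simp
qed

lemma psi_deriv_bounds:
  assumes "\<bar>j\<bar> \<le> 1/2"
  shows "1 \<le> 1 / (sqrt (1 - j\<^sup>2)) ^ 3" "1 / (sqrt (1 - j\<^sup>2)) ^ 3 \<le> 2"
proof -
  define r where "r = sqrt (1 - j\<^sup>2)"
  have j2: "j\<^sup>2 \<le> 1/4" using abs_le_square_iff[of j "1/2"] assms by (simp add: power2_eq_square)
  have "4/5 \<le> r" unfolding r_def by (rule real_le_rsqrt) (use j2 in \<open>simp add: power2_eq_square\<close>)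
  then have "(4/5) ^ 3 \<le> r ^ 3" by (intro power_mono) auto
  then have "1/2 \<le> r ^ 3" by (simp add: power3_eq_cube)
  moreover have "r ^ 3 \<le> 1" unfolding r_def using j2 by (intro power_le_one) auto
  ultimately have "1 \<le> 1 / r ^ 3" "1 / r ^ 3 \<le> 2"
    using \<open>4/5 \<le> r\<close> by (simp_all add: divide_le_eq le_divide_eq)
  then show "1 \<le> 1 / (sqrt (1 - j\<^sup>2)) ^ 3" "1 / (sqrt (1 - j\<^sup>2)) ^ 3 \<le> 2"
    unfolding r_def[symmetric] .
qed

lemma psi_diff_bounds:
  assumes "-1/2 \<le> i" "i \<le> j" "j \<le> 1/2"
  shows "j - i \<le> psi j - psi i" "psi j - psi i \<le> 2 * (j - i)"
proof -
  have "j - i \<le> psi j - psi i \<and> psi j - psi i \<le> 2 * (j - i)"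
  proof (cases "i = j")
    case False
    then have "\<exists>k. i < k \<and> k < j \<and> psi j - psi i = (j - i) * (1 / (sqrt (1 - k\<^sup>2)) ^ 3)"
      using assms by (intro MVT2) (auto intro!: DERIV_psi)
    then obtain k where k: "i < k" "k < j" "psi j - psi i = (j - i) * (1 / (sqrt (1 - k\<^sup>2)) ^ 3)" by blast
    have "\<bar>k\<bar> \<le> 1/2" using k assms by auto
    from psi_deriv_bounds[OF this] show ?thesis
      unfolding k(3) using assms(2) mult_left_mono[of 1 "1 / (sqrt (1 - k\<^sup>2)) ^ 3" "j - i"]
        mult_left_mono[of "1 / (sqrt (1 - k\<^sup>2)) ^ 3" 2 "j - i"] by auto
  qed simp
  then show "j - i \<le> psi j - psi i" "psi j - psi i \<le> 2 * (j - i)" by auto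
qed

lemma psi_0 [simp]: "psi 0 = 0" and chi_0 [simp]: "chi 0 = 0"
  by (simp_all add: psi_def chi_def)

lemma chi_mono: "i \<le> j \<Longrightarrow> chi i \<le> chi j"
  using psi_diff_bounds(1)[of "max (-1/2) (min (1/2) i)" "max (-1/2) (min (1/2) j)"]
  by (auto simp: chi_def max_def min_def split: if_splits)

lemma chi_lipschitz: "\<bar>chi i - chi j\<bar> \<le> 2 * \<bar>i - j\<bar>"
proof -
  have *: "chi j - chi i \<le> 2 * (j - i)" if "i \<le> j" for i j
    using psi_diff_bounds(2)[of "max (-1/2) (min (1/2) i)" "max (-1/2) (min (1/2) j)"] that
    by (auto simp: chi_def max_def min_def split: if_splits)
  show ?thesis
    using *[of i j] *[of j i] chi_mono[of i j] chi_mono[of j i] by (cases "i \<le> j") auto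
qed

lemma abs_chi_le: "\<bar>chi j\<bar> \<le> 2 * \<bar>j\<bar>"
  using chi_lipschitz[of j 0] by simp

lemma abs_chi_le_1: "\<bar>chi j\<bar> \<le> 1"
proof -
  let ?j = "max (-1/2) (min (1/2) j)"
  have "\<bar>?j\<bar> \<le> 1/2" by (auto simp: abs_le_iff)
  then show ?thesis using abs_chi_le[of ?j] chi_eq_psi[of ?j] by (simp add: chi_def)
qed

lemma chi_nonpos: "j \<le> 0 \<Longrightarrow> chi j \<le> 0"
  using chi_mono[of j 0] by simp

lemma chi_le_self: "-1/2 \<le> j \<Longrightarrow> j \<le> 0 \<Longrightarrow> chi j \<le> j"
  using psi_diff_bounds(1)[of j 0] chi_eq_psi[of j] by simp

lemma continuous_on_chi: "continuous_on S g \<Longrightarrow> continuous_on S (\<lambda>x. chi (g x))"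
proof (rule continuous_on_compose2[of UNIV chi])
  show "continuous_on UNIV chi"
    unfolding continuous_on_iff dist_real_def
  proof (intro ballI allI impI)
    fix x e :: real assume "0 < e"
    then show "\<exists>d>0. \<forall>x'\<in>UNIV. \<bar>x' - x\<bar> < d \<longrightarrow> \<bar>chi x' - chi x\<bar> < e"
      using chi_lipschitz by (intro exI[of _ "e/2"]) (smt (verit) field_sum_of_halves half_gt_zero)
  qed
qed auto

lemma flux_psi: "\<bar>j\<bar> < 1 \<Longrightarrow> psi j / sqrt (1 + (psi j)\<^sup>2) = j"
proof -
  assume "\<bar>j\<bar> < 1"
  note pos = psi_pos_arg[OF this]
  have "1 + (psi j)\<^sup>2 = 1 / (1 - j\<^sup>2)"
    using pos by (simp add: psi_def power_divide field_simps)
  then show ?thesis using pos by (simp add: psi_def real_sqrt_divide)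
qed

lemma psi_flux: "psi (d / sqrt (1 + d\<^sup>2)) = d"
proof -
  have pos: "0 < 1 + d\<^sup>2" by (simp add: add_pos_nonneg)
  have "1 - (d / sqrt (1 + d\<^sup>2))\<^sup>2 = 1 / (1 + d\<^sup>2)"
    using pos by (simp add: power_divide field_simps)
  then show ?thesis using pos by (simp add: psi_def real_sqrt_divide)
qed

lemma abs_flux_le: "\<bar>d / sqrt (1 + d\<^sup>2)\<bar> \<le> \<bar>d\<bar>"
proof -
  define s where "s = sqrt (1 + d\<^sup>2)"
  have "1 \<le> s" by (simp add: s_def)
  then have "\<bar>d\<bar> / s \<le> \<bar>d\<bar> / 1" by (intro divide_left_mono) auto
  then show ?thesis unfolding s_def[symmetric] using \<open>1 \<le> s\<close> by (simp add: abs_divide)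
qed

section \<open>The integral equation\<close>

text \<open>The weight is everywhere bounded here and satisfies its sign conditions at every point; this costs
  nothing, as the problem only sees the almost everywhere class.\<close>

locale indefinite_weight =
  fixes b :: "real \<Rightarrow> real" and z K :: real and f :: "real \<Rightarrow> real" and p :: real
  assumes z: "0 < z" "z < 1"
    and b: "bounded_measurable01 b" and K: "0 < K" "\<And>x. x \<in> {0..1} \<Longrightarrow> \<bar>b x\<bar> \<le> K"
    and b_nonneg: "\<And>x. 0 \<le> x \<Longrightarrow> x \<le> z \<Longrightarrow> 0 \<le> b x"
    and b_nonpos: "\<And>x. z \<le> x \<Longrightarrow> x \<le> 1 \<Longrightarrow> b x \<le> 0"
    and b_left: "0 < integral {0..z/2} b" and b_mean: "integral {0..1} b < 0"
    and f: "continuous_on UNIV f" and f_0: "f 0 = 0" and f_pos: "\<And>u. 0 < u \<Longrightarrow> 0 < f u"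
    and p: "1 < p" and f_lim: "((\<lambda>u. f u / u powr p) \<longlongrightarrow> 1) (at_right 0)"
begin

text \<open>Extending the nonlinearity by \<open>0\<close> to negative arguments freezes the flux of a solution that has crossed zero.\<close>

definition fp :: "real \<Rightarrow> real" where "fp u = f (max 0 u)"

definition bint :: "(real \<Rightarrow> real) \<Rightarrow> real \<Rightarrow> real" where
  "bint g x = integral {0..x} (\<lambda>y. b y * g y)"

definition flux :: "real \<Rightarrow> c1 \<Rightarrow> real \<Rightarrow> real" where
  "flux l u x = - l * bint (\<lambda>y. fp (app u y)) x"

definition ivp :: "real \<Rightarrow> c1 \<Rightarrow> bool" where
  "ivp l u \<longleftrightarrow> (\<forall>x\<in>{0..1}. D u x = chi (flux l u x))"

lemma fp_nonneg: "0 \<le> fp u" and fp_nonpos_arg: "u \<le> 0 \<Longrightarrow> fp u = 0"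
  using f_pos[of u] f_0 by (cases "u = 0"; auto simp: fp_def max_def)+

lemma continuous_on_fp: "continuous_on S g \<Longrightarrow> continuous_on S (\<lambda>x. fp (g x))"
  unfolding fp_def by (rule continuous_on_compose2[OF f]) (auto intro: continuous_intros)

lemma continuous_fp_app: "continuous_on {0..1} (\<lambda>y. fp (app u y))"
  by (intro continuous_on_fp continuous_app)

lemma bint_0 [simp]: "bint g 0 = 0" by (simp add: bint_def)

lemma flux_0 [simp]: "flux l u 0 = 0" by (simp add: flux_def)

lemma bm_b_mult: "continuous_on {0..1} g \<Longrightarrow> bounded_measurable01 (\<lambda>y. b y * g y)"
  by (intro bounded_measurable01_mult b bounded_measurable01_continuous)

lemma continuous_bint: "continuous_on {0..1} g \<Longrightarrow> continuous_on {0..1} (bint g)"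
  unfolding bint_def by (intro continuous_on_primitive bm_b_mult)

lemma continuous_flux: "continuous_on {0..1} (flux l u)"
  unfolding flux_def by (intro continuous_intros continuous_bint continuous_fp_app)

lemma bint_lipschitz:
  assumes g: "continuous_on {0..1} g" and C: "\<And>x. x \<in> {0..1} \<Longrightarrow> \<bar>g x\<bar> \<le> C" and xy: "x \<in> {0..1}" "y \<in> {0..1}"
  shows "\<bar>bint g y - bint g x\<bar> \<le> K * C * \<bar>y - x\<bar>"
  unfolding bint_def
proof (rule integral_diff_bound[OF bm_b_mult[OF g] xy])
  fix t :: real assume "t \<in> {0..1}"
  then show "\<bar>b t * g t\<bar> \<le> K * C" unfolding abs_mult using K C by (intro mult_mono) auto
qed

lemma bint_bound:
  assumes "continuous_on {0..1} g" "\<And>x. x \<in> {0..1} \<Longrightarrow> \<bar>g x\<bar> \<le> C" "x \<in> {0..1}"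
  shows "\<bar>bint g x\<bar> \<le> K * C"
proof -
  have "0 \<le> K * C" using assms(2)[OF assms(3)] K(1) by simp
  moreover have "\<bar>bint g x\<bar> \<le> K * C * x" using bint_lipschitz[OF assms(1,2), of 0 x] assms(3) by simp
  ultimately show ?thesis using mult_left_le[of x "K * C"] assms(3) by simp
qed

lemma bint_diff:
  assumes "continuous_on {0..1} g" "continuous_on {0..1} h" "x \<in> {0..1}"
  shows "bint g x - bint h x = bint (\<lambda>y. g y - h y) x"
proof -
  have "integral {0..x} (\<lambda>y. b y * g y - b y * h y) = bint g x - bint h x"
    unfolding bint_def
    by (intro integral_diff bounded_measurable01_integrable bm_b_mult assms) (use assms(3) in auto)
  then show ?thesis by (simp add: bint_def right_diff_distrib)
qed

lemma bint_diff_bound: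
  assumes "continuous_on {0..1} g" "continuous_on {0..1} h" "x \<in> {0..1}"
    and "\<And>x. x \<in> {0..1} \<Longrightarrow> \<bar>g x - h x\<bar> \<le> e"
  shows "\<bar>bint g x - bint h x\<bar> \<le> K * e"
  unfolding bint_diff[OF assms(1-3)] by (intro bint_bound continuous_intros assms)

lemma flux_diff:
  assumes "0 \<le> x" "x \<le> y" "y \<le> 1"
  shows "flux l u y - flux l u x = - l * integral {x..y} (\<lambda>t. b t * fp (app u t))"
  using integral_initial_diff[OF bm_b_mult[OF continuous_fp_app[of u]] assms]
  unfolding flux_def bint_def by (simp add: algebra_simps)

lemma flux_decreasing:
  assumes "0 \<le> l" "0 \<le> x" "x \<le> y" "y \<le> z"
  shows "flux l u y \<le> flux l u x"
proof -
  have "0 \<le> integral {x..y} (\<lambda>t. b t * fp (app u t))"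
    by (rule integral_nonneg[OF bounded_measurable01_integrable[OF bm_b_mult[OF continuous_fp_app]]])
      (use assms z b_nonneg fp_nonneg in auto)
  then have "0 \<le> l * integral {x..y} (\<lambda>t. b t * fp (app u t))" using assms(1) by simp
  then show ?thesis using flux_diff[of x y l u] assms z by auto
qed

lemma flux_increasing:
  assumes "0 \<le> l" "z \<le> x" "x \<le> y" "y \<le> 1"
  shows "flux l u x \<le> flux l u y"
proof -
  have "0 \<le> integral {x..y} (\<lambda>t. - (b t * fp (app u t)))"
    by (rule integral_nonneg[OF integrable_neg[OF bounded_measurable01_integrable[OF bm_b_mult[OF continuous_fp_app]]]])
      (use assms z b_nonpos fp_nonneg in \<open>auto simp: mult_nonpos_nonneg\<close>)
  then have "0 \<le> - (l * integral {x..y} (\<lambda>t. b t * fp (app u t)))"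
    using assms(1) by (simp add: mult_nonneg_nonpos)
  then show ?thesis using flux_diff[of x y l u] assms z by auto
qed

text \<open>The flux falls from \<open>0\<close> on \<open>[0, z]\<close> and rises on \<open>[z, 1]\<close>, so its end value decides its sign.\<close>

lemma flux_nonpos:
  assumes "0 \<le> l" "flux l u 1 \<le> 0" "x \<in> {0..1}"
  shows "flux l u x \<le> 0"
  using flux_decreasing[of l 0 x u] flux_increasing[of l x 1 u] assms z by (cases "x \<le> z") auto

lemma flux_ge_flux_z:
  assumes "0 \<le> l" "x \<in> {0..1}"
  shows "flux l u z \<le> flux l u x"
  using flux_decreasing[of l x z u] flux_increasing[of l z x u] assms z by (cases "x \<le> z") auto

lemma ivp_decreasing:
  assumes "ivp l u" "0 \<le> x" "x \<le> y" "y \<le> 1" and "\<And>t. x \<le> t \<Longrightarrow> t \<le> y \<Longrightarrow> flux l u t \<le> 0"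
  shows "app u y \<le> app u x"
  using app_diff_le[of x y u 0] assms unfolding ivp_def by (auto intro: chi_nonpos)

section \<open>Regular solutions and the integral equation\<close>

lemma flux_eq_primitive: "flux l u x = flux l u 0 + integral {0..x} (\<lambda>t. - l * (b t * fp (app u t)))"
  by (simp add: flux_def bint_def)

lemma bm_flux_density: "bounded_measurable01 (\<lambda>t. - l * (b t * fp (app u t)))"
  by (intro bounded_measurable01_cmult bm_b_mult continuous_fp_app)

lemma regular_solution_imp_ivp:
  assumes ab: "AE x in lebesgue_on {0<..<1}. a x = b x" and l: "0 \<le> l"
    and reg: "regular_solution a f l u" and pos: "positive u" and small: "norm u \<le> 1/2"
  shows "ivp l u" "flux l u 1 = 0" "0 < app u 0" "\<And>x. x \<in> {0..1} \<Longrightarrow> -1/2 \<le> flux l u x"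
proof -
  obtain g where wd: "weak_derivative01 (\<lambda>x. D u x / sqrt (1 + (D u x)\<^sup>2)) g"
    and g: "AE x in lebesgue_on {0<..<1}. - g x = l * a x * f (app u x)" and D0: "D u 0 = 0" and D1: "D u 1 = 0"
    using reg unfolding regular_solution_def by blast
  have fp_eq: "fp (app u x) = f (app u x)" if "x \<in> {0..1}" for x
    using pos that by (simp add: positive_def fp_def)
  have gw: "AE x in lebesgue_on {0<..<1}. g x = - l * (b x * fp (app u x))"
    using g ab AE_space by eventually_elim (simp add: fp_eq algebra_simps)
  have s: "sqrt (1 + (D u x)\<^sup>2) \<noteq> 0" for x
    by (metis add_pos_nonneg less_irrefl real_sqrt_gt_zero zero_le_power2 zero_less_one)
  have "continuous_on {0..1} (\<lambda>x. D u x / sqrt (1 + (D u x)\<^sup>2))"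
    by (intro continuous_intros continuous_D) (use s in auto)
  then have flux: "D u x / sqrt (1 + (D u x)\<^sup>2) = flux l u x" if "x \<in> {0..1}" for x
    using primitive_of_weak_derivative[OF wd _ bm_flux_density gw that] D0 flux_eq_primitive[of l u x] by simp
  have half: "\<bar>flux l u x\<bar> \<le> 1/2" if "x \<in> {0..1}" for x
    using abs_flux_le[of "D u x"] D_le_norm[OF that, of u] small unfolding flux[OF that] by linarith
  show ivp: "ivp l u" unfolding ivp_def
  proof
    fix x :: real assume x: "x \<in> {0..1}"
    show "D u x = chi (flux l u x)"
      unfolding chi_eq_psi[OF half[OF x]] using psi_flux[of "D u x"] by (simp add: flux[OF x])
  qed
  show f1: "flux l u 1 = 0" using flux[of 1] D1 by simp
  show "-1/2 \<le> flux l u x" if "x \<in> {0..1}" for x using half[OF that] by linarith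
  obtain y where y: "y \<in> {0..1}" "0 < app u y" using pos by (auto simp: positive_def)
  have "app u y \<le> app u 0"
    by (rule ivp_decreasing[OF ivp]) (use y flux_nonpos[OF l] f1 in auto)
  then show "0 < app u 0" using y by simp
qed

text \<open>A solution that touches zero stays there: where \<open>u \<le> 0\<close> the flux is constant,
  hence equal to its end value \<open>0\<close>.\<close>

lemma ivp_nonneg:
  assumes l: "0 \<le> l" and ivp: "ivp l u" and f1: "flux l u 1 = 0" and s: "0 < app u 0" and x: "x \<in> {0..1}"
  shows "0 \<le> app u x"
proof (rule ccontr)
  assume neg: "\<not> 0 \<le> app u x"
  have "continuous_on {0..x} (app u)" by (rule continuous_on_subset[OF continuous_app]) (use x in auto)
  then obtain y where y: "0 \<le> y" "y \<le> x" "app u y = 0"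
    using IVT2'[of "app u" x 0 0] neg s x by auto
  have np: "flux l u t \<le> 0" if "t \<in> {0..1}" for t using flux_nonpos[OF l _ that] f1 by simp
  have "fp (app u t) = 0" if "t \<in> {y..1}" for t
    using ivp_decreasing[OF ivp y(1), of t] np that y by (intro fp_nonpos_arg) auto
  then have "integral {v..1} (\<lambda>t. b t * fp (app u t)) = integral {v..1} (\<lambda>t. 0)" if "y \<le> v" for v
    using that by (intro integral_cong) auto
  then have z: "flux l u v = 0" if "y \<le> v" "v \<le> 1" for v
    using flux_diff[of v 1 l u] that y(1) f1 by simp
  have "0 * (x - y) \<le> app u x - app u y"
    using ivp z x y unfolding ivp_def by (intro app_diff_ge) auto
  then show False using neg y by simp
qed

lemma ivp_imp_regular_solution:
  assumes ab: "AE x in lebesgue_on {0<..<1}. a x = b x" and l: "0 \<le> l"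
    and ivp: "ivp l u" and f1: "flux l u 1 = 0" and s: "0 < app u 0" and half: "-1/2 \<le> flux l u z"
  shows "regular_solution a f l u" "positive u"
proof -
  let ?w = "\<lambda>t. - l * (b t * fp (app u t))"
  have nn: "0 \<le> app u x" if "x \<in> {0..1}" for x by (rule ivp_nonneg[OF l ivp f1 s that])
  then show "positive u" using s by (auto simp: positive_def)
  have h: "\<bar>flux l u x\<bar> \<le> 1/2" if "x \<in> {0..1}" for x
    using flux_nonpos[OF l _ that, of u] flux_ge_flux_z[OF l that, of u] f1 half by simp
  have h1: "\<bar>flux l u x\<bar> < 1" if "x \<in> {0..1}" for x using h[OF that] by simp
  have Dpsi: "D u x = psi (flux l u x)" if "x \<in> {0..1}" for x
    using ivp that h[OF that] by (simp add: ivp_def chi_eq_psi)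
  define g' where "g' j = 1 / (sqrt (1 - j\<^sup>2)) ^ 3" for j :: real
  have s0: "sqrt (1 - (flux l u x)\<^sup>2) \<noteq> 0" if "x \<in> {0..1}" for x
    using psi_pos_arg[OF h1[OF that]] by simp
  have cg: "continuous_on {0..1} (\<lambda>x. g' (flux l u x))"
    unfolding g'_def by (intro continuous_intros continuous_flux) (use s0 in auto)
  have chain: "psi (flux l u x) = psi (flux l u 0) + integral {0..x} (\<lambda>t. g' (flux l u t) * ?w t)" if "x \<in> {0..1}" for x
    by (rule chain_rule_primitive[OF bm_flux_density flux_eq_primitive _ cg that])
      (use DERIV_psi[OF h1] in \<open>simp add: g'_def\<close>)
  have bm: "bounded_measurable01 (\<lambda>t. g' (flux l u t) * ?w t)"
    by (rule bounded_measurable01_mult[OF bounded_measurable01_continuous[OF cg] bm_flux_density])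
  have "weak_derivative01 (D u) (\<lambda>t. g' (flux l u t) * ?w t)"
    by (rule weak_derivative_primitive[OF bm]) (use chain Dpsi in auto)
  moreover have "weak_derivative01 (app u) (D u)"
  proof (rule weak_derivative_primitive[OF bounded_measurable01_continuous[OF continuous_D]])
    fix x :: real assume "x \<in> {0..1}"
    then show "app u x = app u 0 + integral {0..x} (D u)" using app_eq_integral_D[of 0 x u] by simp
  qed
  ultimately have W: "app u \<in> W21" unfolding W21_def by blast
  have "weak_derivative01 (flux l u) ?w"
    by (rule weak_derivative_primitive[OF bm_flux_density flux_eq_primitive])
  moreover have fl: "D u x / sqrt (1 + (D u x)\<^sup>2) = flux l u x" if "x \<in> {0..1}" for x
    using flux_psi[OF h1[OF that]] Dpsi[OF that] by simp
  ultimately have wd: "weak_derivative01 (\<lambda>x. D u x / sqrt (1 + (D u x)\<^sup>2)) ?w"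
    using weak_derivative_primitive[OF bm_flux_density, of "\<lambda>x. D u x / sqrt (1 + (D u x)\<^sup>2)" l u]
      flux_eq_primitive[of l u] by simp
  have "AE x in lebesgue_on {0<..<1}. - ?w x = l * a x * f (app u x)"
    using ab AE_space by eventually_elim (use nn in \<open>simp add: fp_def\<close>)
  with W wd show "regular_solution a f l u"
    unfolding regular_solution_def using Dpsi[of 0] Dpsi[of 1] f1 by auto
qed

section \<open>Sign of the final flux\<close>

lemma f_near_0:
  assumes "0 < e"
  shows "\<exists>d>0. \<forall>u. 0 < u \<and> u \<le> d \<longrightarrow> \<bar>f u / u powr p - 1\<bar> < e"
proof -
  have "\<forall>\<^sub>F u in at_right 0. \<bar>f u / u powr p - 1\<bar> < e"
    using tendstoD[OF f_lim assms] by (simp add: dist_real_def)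
  then obtain d where d: "0 < d" "\<And>u. 0 < u \<Longrightarrow> u < d \<Longrightarrow> \<bar>f u / u powr p - 1\<bar> < e"
    unfolding eventually_at_right_field by auto
  show ?thesis by (rule exI[of _ "d/2"]) (use d in auto)
qed

lemma fp_le_near_0: "\<exists>d>0. \<forall>s v. 0 < s \<longrightarrow> s \<le> d \<longrightarrow> v \<le> s \<longrightarrow> fp v \<le> 2 * s powr p"
proof -
  obtain d where d: "0 < d" "\<And>u. 0 < u \<Longrightarrow> u \<le> d \<Longrightarrow> \<bar>f u / u powr p - 1\<bar> < 1" using f_near_0[of 1] by auto
  have "fp v \<le> 2 * s powr p" if "0 < s" "s \<le> d" "v \<le> s" for s v
  proof (cases "v \<le> 0")
    case True then show ?thesis by (simp add: fp_nonpos_arg)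
  next
    case False
    then have "f v / v powr p \<le> 2" using d(2)[of v] that by auto
    then have "f v \<le> 2 * v powr p" using False by (simp add: divide_le_eq)
    also have "\<dots> \<le> 2 * s powr p" using False that p by (simp add: powr_mono2)
    finally show ?thesis using False by (simp add: fp_def)
  qed
  with d(1) show ?thesis by blast
qed

lemma powr_p_eq: "0 < s \<Longrightarrow> s powr p = s * s powr (p - 1)"
  by (simp add: powr_mult_base)

lemma abs_flux_le_near_0:
  assumes l: "0 \<le> l" and s: "0 < s" and fp: "\<And>v. v \<le> s \<Longrightarrow> fp v \<le> 2 * s powr p"
    and x: "x \<in> {0..1}" and u: "\<And>y. 0 \<le> y \<Longrightarrow> y \<le> x \<Longrightarrow> app u y \<le> s"
  shows "\<bar>flux l u x\<bar> \<le> 2 * K * s * (l * s powr (p - 1))"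
proof -
  have "\<bar>bint (\<lambda>y. fp (app u y)) x - bint (\<lambda>y. fp (app u y)) 0\<bar> \<le> K * (2 * s powr p) * \<bar>x - 0\<bar>"
    unfolding bint_def
  proof (rule integral_diff_bound[OF bm_b_mult[OF continuous_fp_app] _ x])
    fix t assume "t \<in> {0..1}" "min 0 x \<le> t" "t \<le> max 0 x"
    then show "\<bar>b t * fp (app u t)\<bar> \<le> K * (2 * s powr p)"
      unfolding abs_mult using K fp[OF u[of t]] x fp_nonneg[of "app u t"] by (intro mult_mono) auto
  qed simp
  also have "\<dots> \<le> K * (2 * s powr p)" using x K by (simp add: mult_left_le)
  finally have "\<bar>bint (\<lambda>y. fp (app u y)) x\<bar> \<le> K * (2 * s powr p)" by simp
  then have "l * \<bar>bint (\<lambda>y. fp (app u y)) x\<bar> \<le> l * (K * (2 * s powr p))" using l by (rule mult_left_mono)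
  then show ?thesis using l by (simp add: flux_def abs_mult powr_p_eq[OF s] algebra_simps)
qed

text \<open>A start value \<open>s\<close> that is small compared with \<open>\<lambda>\<^sup>-\<^sup>1\<^sup>/\<^sup>(\<^sup>p\<^sup>-\<^sup>1\<^sup>)\<close> lets \<open>u\<close> stay nearly constant,
  so the final flux is about \<open>-\<lambda> s\<^sup>p \<integral> b > 0\<close>.\<close>

lemma flux_pos_of_small_start:
  "\<exists>k>0. \<exists>d>0. \<forall>l u. 0 < l \<longrightarrow> ivp l u \<longrightarrow> 0 < app u 0 \<longrightarrow> app u 0 \<le> d \<longrightarrow>
     l * app u 0 powr (p - 1) \<le> k \<longrightarrow> 0 < flux l u 1"
proof -
  define m where "m = - integral {0..1} b"
  have m: "0 < m" using b_mean by (simp add: m_def)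
  define \<theta> where "\<theta> = m / (2 * K)"
  have \<theta>: "0 < \<theta>" using m K by (simp add: \<theta>_def)
  obtain d1 where d1: "0 < d1" "\<And>u. 0 < u \<Longrightarrow> u \<le> d1 \<Longrightarrow> \<bar>f u / u powr p - 1\<bar> < \<theta>/2"
    using f_near_0[of "\<theta>/2"] \<theta> by auto
  obtain d2 where d2: "0 < d2" "\<And>s v. 0 < s \<Longrightarrow> s \<le> d2 \<Longrightarrow> v \<le> s \<Longrightarrow> fp v \<le> 2 * s powr p"
    using fp_le_near_0 by blast
  have "isCont (\<lambda>v. v powr p) (1::real)" by (intro continuous_intros) auto
  then obtain r where r: "0 < r" "\<And>v. \<bar>v - 1\<bar> < r \<Longrightarrow> \<bar>v powr p - 1\<bar> < \<theta>/2"
    using \<theta> unfolding continuous_at_eps_delta dist_real_def by (metis half_gt_zero powr_one_eq_one)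
  define e where "e = min r 1 / 2"
  have e: "0 < e" "e < r" "e < 1" using r(1) by (auto simp: e_def min_def)
  define k where "k = e / (4 * K)"
  have k: "0 < k" using e K by (simp add: k_def)
  have "0 < flux l u 1" if l: "0 < l" and ivp: "ivp l u" and s: "0 < app u 0" "app u 0 \<le> min d1 d2"
    and ls: "l * app u 0 powr (p - 1) \<le> k" for l u
  proof (rule ccontr)
    assume "\<not> 0 < flux l u 1"
    then have np: "flux l u x \<le> 0" if "x \<in> {0..1}" for x using flux_nonpos[OF _ _ that] l by simp
    define s where "s = app u 0"
    have s0: "0 < s" "s \<le> d1" "s \<le> d2" using s by (auto simp: s_def)
    have le: "app u x \<le> s" if "x \<in> {0..1}" for x
      unfolding s_def using ivp_decreasing[OF ivp, of 0 x] np that by auto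
    have fl: "\<bar>flux l u x\<bar> \<le> e * s / 2" if x: "x \<in> {0..1}" for x
    proof -
      have "\<bar>flux l u x\<bar> \<le> 2 * K * s * (l * s powr (p - 1))"
        by (rule abs_flux_le_near_0) (use l s0 d2 le x in auto)
      also have "\<dots> \<le> 2 * K * s * k" using ls K s0 by (intro mult_left_mono) (auto simp: s_def)
      finally show ?thesis using K by (simp add: k_def)
    qed
    \<comment> \<open>\<open>k\<close> was chosen to make the total drop at most \<open>e s\<close>\<close>
    have ge: "s * (1 - e) \<le> app u x" if x: "x \<in> {0..1}" for x
    proof -
      have D: "\<bar>D u t\<bar> \<le> e * s" if "t \<in> {0..1}" for t
        using abs_chi_le[of "flux l u t"] fl[OF that] ivp that by (simp add: ivp_def)
      have "\<bar>app u x - app u 0\<bar> \<le> e * s * \<bar>x - 0\<bar>"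
        by (rule app_lipschitz[OF _ x D]) auto
      moreover have "e * s * \<bar>x - 0\<bar> \<le> e * s" using x e s0 by (simp add: mult_left_le)
      ultimately show ?thesis by (simp add: s_def algebra_simps)
    qed
    have close: "\<bar>fp (app u x) - s powr p\<bar> \<le> \<theta> * s powr p" if x: "x \<in> {0..1}" for x
    proof -
      define v where "v = app u x"
      have v: "s * (1 - e) \<le> v" "v \<le> s" using ge[OF x] le[OF x] by (auto simp: v_def)
      moreover have "0 < s * (1 - e)" using s0 e by simp
      ultimately have v0: "0 < v" by linarith
      have "(1 - e) \<le> v / s" "v / s \<le> 1" using v s0 by (auto simp: field_simps)
      then have B: "\<bar>(v / s) powr p - 1\<bar> < \<theta>/2" using e by (intro r(2)) auto
      have B1: "(v / s) powr p \<le> 1" using \<open>v / s \<le> 1\<close> v0 s0 p by (simp add: powr_le1)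
      have A: "\<bar>f v / v powr p - 1\<bar> < \<theta>/2" using d1(2)[OF v0] v s0 by linarith
      have "f v = (f v / v powr p) * (v / s) powr p * s powr p"
        using v0 s0 by (simp add: powr_divide)
      then have "f v - s powr p = ((f v / v powr p - 1) * (v / s) powr p + ((v / s) powr p - 1)) * s powr p"
        by (simp add: algebra_simps)
      moreover have "\<bar>(f v / v powr p - 1) * (v / s) powr p\<bar> \<le> \<theta>/2 * 1"
        unfolding abs_mult using A B1 \<theta> by (intro mult_mono) auto
      then have "\<bar>(f v / v powr p - 1) * (v / s) powr p + ((v / s) powr p - 1)\<bar> \<le> \<theta>/2 * 1 + \<theta>/2"
        by (rule order_trans[OF abs_triangle_ineq add_mono[OF _ less_imp_le[OF B]]])
      then have "\<bar>(f v / v powr p - 1) * (v / s) powr p + ((v / s) powr p - 1)\<bar> \<le> \<theta>" by simp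
      ultimately have "\<bar>f v - s powr p\<bar> \<le> \<theta> * s powr p" by (simp add: abs_mult mult_right_mono)
      then show ?thesis using v0 by (simp add: fp_def v_def)
    qed
    have "\<bar>bint (\<lambda>y. fp (app u y)) 1 - bint (\<lambda>_. s powr p) 1\<bar> \<le> K * (\<theta> * s powr p)"
      by (rule bint_diff_bound[OF continuous_fp_app _ _ close]) auto
    moreover have "bint (\<lambda>_. s powr p) 1 = - m * s powr p" by (simp add: bint_def m_def)
    moreover have "K * (\<theta> * s powr p) = m * s powr p / 2" using K by (simp add: \<theta>_def)
    ultimately have "bint (\<lambda>y. fp (app u y)) 1 \<le> - (m * s powr p) / 2" by linarith
    also have "\<dots> < 0" using m s0 by simp
    finally have "0 < flux l u 1" using l by (simp add: flux_def mult_pos_neg)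
    then show False using \<open>\<not> 0 < flux l u 1\<close> by simp
  qed
  moreover have "0 < min d1 d2" using d1(1) d2(1) by simp
  ultimately show ?thesis using k by blast
qed

text \<open>A start value that is large compared with \<open>\<lambda>\<^sup>-\<^sup>1\<^sup>/\<^sup>(\<^sup>p\<^sup>-\<^sup>1\<^sup>)\<close> drives \<open>u\<close> below zero before \<open>z\<close>. Either
  \<open>u\<close> has lost half of its height at \<open>z/2\<close>, and concavity takes the other half until \<open>z\<close>; or
  the source on \<open>[0, z/2]\<close> is at least \<open>\<lambda> (s/2)\<^sup>p / 2\<close> times \<open>b\<close>, which makes the slope on \<open>[z/2, z]\<close>
  too steep. Beyond \<open>z\<close> the source vanishes as long as \<open>u \<le> 0\<close>, so the negative flux is not pushed back.\<close>

lemma flux_neg_of_large_start: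
  "\<exists>k>0. \<exists>d>0. \<forall>l u. 0 < l \<longrightarrow> ivp l u \<longrightarrow> 0 < app u 0 \<longrightarrow> app u 0 \<le> d \<longrightarrow>
     k \<le> l * app u 0 powr (p - 1) \<longrightarrow> -1/2 \<le> flux l u z \<longrightarrow> flux l u 1 < 0"
proof -
  define A where "A = integral {0..z/2} b"
  have A: "0 < A" using b_left by (simp add: A_def)
  obtain d where d: "0 < d" "\<And>u. 0 < u \<Longrightarrow> u \<le> d \<Longrightarrow> \<bar>f u / u powr p - 1\<bar> < 1/2"
    using f_near_0[of "1/2"] by auto
  define c where "c = (1/2) * (1/2) powr p * A * (z/2)"
  have c: "0 < c" unfolding c_def using A z by simp
  define k where "k = 2 / c"
  have k: "0 < k" using c by (simp add: k_def)
  have "flux l u 1 < 0" if l: "0 < l" and ivp: "ivp l u" and s: "0 < app u 0" "app u 0 \<le> d"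
    and ls: "k \<le> l * app u 0 powr (p - 1)" and half: "-1/2 \<le> flux l u z" for l u
  proof -
    define s where "s = app u 0"
    have s0: "0 < s" "s \<le> d" using s by (auto simp: s_def)
    have np: "flux l u x \<le> 0" if "0 \<le> x" "x \<le> z" for x
      using flux_decreasing[of l 0 x u] l that by simp
    have dec: "app u y \<le> app u x" if "0 \<le> x" "x \<le> y" "y \<le> z" for x y
      by (rule ivp_decreasing[OF ivp]) (use that np z in auto)
    have D: "D u x = chi (flux l u x)" if "x \<in> {0..1}" for x using ivp that by (simp add: ivp_def)
    \<comment> \<open>the steep case loses \<open>c \<lambda> s\<^sup>p \<ge> c k s = 2 s\<close> on \<open>[z/2, z]\<close>\<close>
    have uz: "app u z < 0"
    proof (cases "s / 2 \<le> app u (z/2)")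
      case True
      have fp: "(1/2) * (1/2) powr p * s powr p \<le> fp (app u x)" if "0 \<le> x" "x \<le> z/2" for x
      proof -
        have x: "s / 2 \<le> app u x" using dec[of x "z/2"] that z True by auto
        have "app u x \<le> s" unfolding s_def using dec[of 0 x] that z by auto
        then have "\<bar>f (app u x) / app u x powr p - 1\<bar> < 1/2" using x s0 by (intro d(2)) auto
        then have "1/2 \<le> f (app u x) / app u x powr p" by linarith
        then have "(1/2) * app u x powr p \<le> f (app u x)" using x s0 by (simp add: le_divide_eq)
        moreover have "(s / 2) powr p \<le> app u x powr p" using x s0 p by (intro powr_mono2) auto
        moreover have "(s / 2) powr p = (1/2) powr p * s powr p" using s0 by (simp add: powr_divide)
        ultimately show ?thesis using x s0 by (simp add: fp_def)
      qed
      have bi: "(\<lambda>t. b t * g t) integrable_on {0..z/2}" if "continuous_on {0..1} g" for g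
        by (rule bounded_measurable01_integrable[OF bm_b_mult[OF that]]) (use z in auto)
      have "integral {0..z/2} (\<lambda>t. b t * ((1/2) * (1/2) powr p * s powr p)) \<le> integral {0..z/2} (\<lambda>t. b t * fp (app u t))"
      proof (rule integral_le[OF bi[OF continuous_on_const] bi[OF continuous_fp_app]])
        fix t assume "t \<in> {0..z/2}"
        then show "b t * ((1/2) * (1/2) powr p * s powr p) \<le> b t * fp (app u t)"
          using fp[of t] b_nonneg[of t] z by (intro mult_left_mono) auto
      qed
      then have "A * ((1/2) * (1/2) powr p * s powr p) \<le> bint (\<lambda>t. fp (app u t)) (z/2)"
        by (simp add: bint_def A_def)
      then have fz: "flux l u (z/2) \<le> - l * (A * ((1/2) * (1/2) powr p * s powr p))"
        using l by (simp add: flux_def)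
      have "D u t \<le> flux l u (z/2)" if t: "z/2 \<le> t" "t \<le> z" for t
      proof -
        have t1: "t \<in> {0..1}" using t z by auto
        have "chi (flux l u t) \<le> flux l u t"
          using flux_ge_flux_z[of l t u] l half np[of t] t t1 by (intro chi_le_self) auto
        then show ?thesis using D[OF t1] flux_decreasing[of l "z/2" t u] l t z by auto
      qed
      then have "app u z - app u (z/2) \<le> flux l u (z/2) * (z - z/2)" using z by (intro app_diff_le) auto
      also have "\<dots> \<le> - l * (A * ((1/2) * (1/2) powr p * s powr p)) * (z - z/2)"
        using fz z by (intro mult_right_mono) auto
      also have "\<dots> = - s * (c * (l * s powr (p - 1)))"
        by (simp add: c_def powr_p_eq[OF s0(1)] algebra_simps)
      also have "\<dots> \<le> - s * (c * k)"
        using ls s0 c by (simp add: s_def)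
      also have "\<dots> = - 2 * s" using c by (simp add: k_def)
      finally show ?thesis using dec[of 0 "z/2"] z s0 by (simp add: s_def)
    next
      case False
      have "chi (flux l u (z/2)) * (z/2 - 0) \<le> app u (z/2) - app u 0"
        by (rule app_diff_ge) (use z l D in \<open>auto intro!: chi_mono flux_decreasing\<close>)
      moreover have "app u z - app u (z/2) \<le> chi (flux l u (z/2)) * (z - z/2)"
        by (rule app_diff_le) (use z l D in \<open>auto intro!: chi_mono flux_decreasing\<close>)
      ultimately show ?thesis using False by (simp add: s_def)
    qed
    have fz: "flux l u z < 0"
    proof (rule ccontr)
      assume "\<not> flux l u z < 0"
      then have "0 \<le> chi (flux l u t)" if "t \<in> {0..1}" for t
        using chi_mono[of 0 "flux l u t"] flux_ge_flux_z[of l t u] l that by auto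
      then have "0 * (z - 0) \<le> app u z - app u 0"
        using z D by (intro app_diff_ge) auto
      then show False using uz s by simp
    qed
    show ?thesis
    proof (rule ccontr)
      assume "\<not> flux l u 1 < 0"
      moreover have "continuous_on {z..1} (flux l u)" by (rule continuous_on_subset[OF continuous_flux]) (use z in auto)
      \<comment> \<open>up to a return of the flux to \<open>0\<close> the solution stays negative, so the flux cannot have moved\<close>
      ultimately obtain x where x: "z \<le> x" "x \<le> 1" "flux l u x = 0"
        using IVT'[of "flux l u" z 0 1] fz z by auto
      have "fp (app u t) = 0" if "t \<in> {z..x}" for t
      proof -
        have "app u t \<le> app u z"
          by (rule ivp_decreasing[OF ivp])
            (use that x z l flux_increasing[of l _ x u] in force)+
        then show ?thesis using uz by (intro fp_nonpos_arg) auto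
      qed
      then have "integral {z..x} (\<lambda>t. b t * fp (app u t)) = integral {z..x} (\<lambda>t. 0)"
        by (intro integral_cong) auto
      then have "flux l u x = flux l u z" using flux_diff[of z x l u] x z by simp
      then show False using fz x by simp
    qed
  qed
  with k d(1) show ?thesis by blast
qed

section \<open>The delayed problem\<close>

text \<open>Since \<open>f\<close> is merely continuous, the initial value problem may have many solutions. With
  the argument of \<open>f\<close> delayed by \<open>\<delta> > 0\<close> it has exactly one, which depends continuously on
  all data; the exact problem is the case \<open>\<delta> = 0\<close>.\<close>

definition delayed_source :: "real \<Rightarrow> c1 \<Rightarrow> real \<Rightarrow> real" where
  "delayed_source \<delta> u y = fp (app u (max 0 (y - \<delta>)))"

definition delayed_flux :: "real \<Rightarrow> real \<Rightarrow> c1 \<Rightarrow> real \<Rightarrow> real" where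
  "delayed_flux \<delta> l u x = - l * bint (delayed_source \<delta> u) x"

definition delayed_ivp :: "real \<Rightarrow> real \<Rightarrow> c1 \<Rightarrow> bool" where
  "delayed_ivp \<delta> l u \<longleftrightarrow> (\<forall>x\<in>{0..1}. D u x = chi (delayed_flux \<delta> l u x))"

lemma delayed_flux_0 [simp]: "delayed_flux 0 l u = flux l u"
proof
  fix x
  have "integral {0..x} (\<lambda>y. b y * delayed_source 0 u y) = integral {0..x} (\<lambda>y. b y * fp (app u y))"
    by (intro integral_cong) (simp add: delayed_source_def)
  then show "delayed_flux 0 l u x = flux l u x" by (simp add: delayed_flux_def flux_def bint_def)
qed

lemma delayed_ivp_0 [simp]: "delayed_ivp 0 l u \<longleftrightarrow> ivp l u"
  by (simp add: delayed_ivp_def ivp_def)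

lemma continuous_delayed_source:
  assumes "0 \<le> \<delta>"
  shows "continuous_on {0..1} (delayed_source \<delta> u)"
  unfolding delayed_source_def
  by (intro continuous_on_fp continuous_on_compose2[OF continuous_app] continuous_intros) (use assms in auto)

lemma continuous_delayed_flux: "0 \<le> \<delta> \<Longrightarrow> continuous_on {0..1} (delayed_flux \<delta> l u)"
  unfolding delayed_flux_def by (intro continuous_intros continuous_bint continuous_delayed_source)

lemma delayed_source_uniform_limit:
  assumes u: "(u \<longlongrightarrow> v) F" and \<delta>: "(\<delta> \<longlongrightarrow> \<delta>0) F" and nn: "\<And>n. 0 \<le> \<delta> n" "0 \<le> \<delta>0" and e: "0 < e"
  shows "\<forall>\<^sub>F n in F. \<forall>y\<in>{0..1}. \<bar>delayed_source (\<delta> n) (u n) y - delayed_source \<delta>0 v y\<bar> < e"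
proof -
  define R where "R = norm v"
  have "continuous_on {-R-1..R+1} fp" by (rule continuous_on_fp) simp
  then have "uniformly_continuous_on {-R-1..R+1} fp" by (rule compact_uniformly_continuous) simp
  then have "\<forall>e>0. \<exists>d>0. \<forall>s\<in>{-R-1..R+1}. \<forall>t\<in>{-R-1..R+1}. \<bar>t - s\<bar> < d \<longrightarrow> \<bar>fp t - fp s\<bar> < e"
    unfolding uniformly_continuous_on_def dist_real_def .
  from this[THEN spec, THEN mp, OF e] obtain \<eta> where \<eta>1: "0 < \<eta>" and
    \<eta>2: "\<forall>s\<in>{-R-1..R+1}. \<forall>t\<in>{-R-1..R+1}. \<bar>t - s\<bar> < \<eta> \<longrightarrow> \<bar>fp t - fp s\<bar> < e" by (elim exE conjE)
  note \<eta> = \<eta>1 \<eta>2[rule_format]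
  have "((\<lambda>n. dist (u n) v) \<longlongrightarrow> 0) F" using u by (simp only: tendsto_dist_iff[symmetric])
  from tendsto_add[OF this tendsto_mult[OF tendsto_const tendsto_rabs[OF tendsto_diff[OF \<delta> tendsto_const]]], of R \<delta>0]
  have "((\<lambda>n. dist (u n) v + R * \<bar>\<delta> n - \<delta>0\<bar>) \<longlongrightarrow> 0) F" by simp
  from order_tendstoD(2)[OF this, of "min 1 \<eta>"]
  have "\<forall>\<^sub>F n in F. dist (u n) v + R * \<bar>\<delta> n - \<delta>0\<bar> < min 1 \<eta>" using \<eta>(1) by simp
  then show ?thesis
  proof (rule eventually_mono, intro ballI)
    fix n y assume n: "dist (u n) v + R * \<bar>\<delta> n - \<delta>0\<bar> < min 1 \<eta>" and y: "y \<in> {0..1::real}"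
    let ?y = "max 0 (y - \<delta> n)" and ?s = "max 0 (y - \<delta>0)"
    have mem: "?y \<in> {0..1}" "?s \<in> {0..1}" using y nn(1)[of n] nn(2) by auto
    have "\<bar>app v ?y - app v ?s\<bar> \<le> R * \<bar>?y - ?s\<bar>"
      unfolding R_def by (rule app_lipschitz[OF mem(2,1) D_le_norm])
    also have "\<dots> \<le> R * \<bar>\<delta> n - \<delta>0\<bar>" unfolding R_def by (rule mult_left_mono[OF _ norm_ge_zero]) linarith
    finally have "\<bar>app v ?y - app v ?s\<bar> \<le> R * \<bar>\<delta> n - \<delta>0\<bar>" .
    moreover have "\<bar>i - j\<bar> \<le> d \<Longrightarrow> \<bar>j - k\<bar> \<le> r \<Longrightarrow> d + r < m \<Longrightarrow> \<bar>i - k\<bar> < m" for i j k d r m :: real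
      by linarith
    ultimately have close: "\<bar>app (u n) ?y - app v ?s\<bar> < min 1 \<eta>"
      using app_diff_le_dist[OF mem(1)] n by blast
    have bd: "\<bar>app v ?s\<bar> \<le> R" unfolding R_def by (rule app_le_norm[OF mem(2)])
    have "app (u n) ?y \<in> {-R-1..R+1}" "app v ?s \<in> {-R-1..R+1}" "\<bar>app (u n) ?y - app v ?s\<bar> < \<eta>"
      using close bd by (auto simp only: min_less_iff_conj atLeastAtMost_iff abs_le_iff abs_less_iff)
    then show "\<bar>delayed_source (\<delta> n) (u n) y - delayed_source \<delta>0 v y\<bar> < e"
      unfolding delayed_source_def by (intro \<eta>(2))
  qed
qed

lemma delayed_flux_uniform_limit:
  assumes u: "(u \<longlongrightarrow> v) F" and \<delta>: "(\<delta> \<longlongrightarrow> \<delta>0) F" and nn: "\<And>n. 0 \<le> \<delta> n" "0 \<le> \<delta>0"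
    and l: "(l \<longlongrightarrow> l0) F" and e: "0 < e"
  shows "\<forall>\<^sub>F n in F. \<forall>x\<in>{0..1}. \<bar>delayed_flux (\<delta> n) (l n) (u n) x - delayed_flux \<delta>0 l0 v x\<bar> < e"
proof -
  have "continuous_on {0..1} (bint (delayed_source \<delta>0 v))"
    by (intro continuous_bint continuous_delayed_source nn)
  define C where "C = sup01 (bint (delayed_source \<delta>0 v))"
  have C: "\<bar>bint (delayed_source \<delta>0 v) x\<bar> \<le> C" if "x \<in> {0..1}" for x
    unfolding C_def by (rule sup01_upper) fact+
  have C0: "0 \<le> C" using C[of 0] by simp
  define e1 where "e1 = e / (2 * (\<bar>l0\<bar> + 1) * K)"
  have e1: "0 < e1" using e K by (simp add: e1_def)
  have "\<forall>\<^sub>F n in F. \<bar>l n - l0\<bar> < min 1 (e / (2 * (C + 1)))"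
    using tendstoD[OF l, of "min 1 (e / (2 * (C + 1)))"] e C0 by (simp add: dist_real_def)
  moreover note delayed_source_uniform_limit[OF u \<delta> nn e1]
  ultimately show ?thesis
  proof eventually_elim
    case (elim n)
    show ?case
    proof
      fix x :: real assume x: "x \<in> {0..1}"
      let ?B = "bint (delayed_source \<delta>0 v) x" and ?Bn = "bint (delayed_source (\<delta> n) (u n)) x"
      have "\<bar>?Bn - ?B\<bar> \<le> K * e1"
        by (rule bint_diff_bound[OF continuous_delayed_source continuous_delayed_source x])
          (use nn elim(2) in \<open>auto intro: less_imp_le\<close>)
      moreover have "\<bar>l n\<bar> \<le> \<bar>l0\<bar> + 1" using elim(1) by linarith
      ultimately have "\<bar>l n\<bar> * \<bar>?Bn - ?B\<bar> \<le> (\<bar>l0\<bar> + 1) * (K * e1)" by (intro mult_mono) auto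
      also have "\<dots> = e / 2" using K by (simp add: e1_def field_simps add_nonneg_eq_0_iff)
      finally have 1: "\<bar>l n\<bar> * \<bar>?Bn - ?B\<bar> \<le> e / 2" .
      have "\<bar>l n - l0\<bar> * \<bar>?B\<bar> \<le> e / (2 * (C + 1)) * C" using elim(1) C[OF x] C0 by (intro mult_mono) auto
      also have "\<dots> < e / 2" using C0 e by (simp add: field_simps)
      finally have 2: "\<bar>l n - l0\<bar> * \<bar>?B\<bar> < e / 2" .
      have eq: "delayed_flux (\<delta> n) (l n) (u n) x - delayed_flux \<delta>0 l0 v x = - (l n * (?Bn - ?B) + (l n - l0) * ?B)"
        by (simp add: delayed_flux_def algebra_simps)
      have "\<bar>l n * (?Bn - ?B) + (l n - l0) * ?B\<bar> \<le> \<bar>l n\<bar> * \<bar>?Bn - ?B\<bar> + \<bar>l n - l0\<bar> * \<bar>?B\<bar>"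
        unfolding abs_mult[symmetric] by (rule abs_triangle_ineq)
      then show "\<bar>delayed_flux (\<delta> n) (l n) (u n) x - delayed_flux \<delta>0 l0 v x\<bar> < e"
        unfolding eq abs_minus_cancel using 1 2 by linarith
    qed
  qed
qed

lemma delayed_flux_tendsto:
  assumes "(u \<longlongrightarrow> v) F" "(\<delta> \<longlongrightarrow> \<delta>0) F" "\<And>n. 0 \<le> \<delta> n" "0 \<le> \<delta>0" "(l \<longlongrightarrow> l0) F" "x \<in> {0..1}"
  shows "((\<lambda>n. delayed_flux (\<delta> n) (l n) (u n) x) \<longlongrightarrow> delayed_flux \<delta>0 l0 v x) F"
  unfolding tendsto_iff dist_real_def
  using delayed_flux_uniform_limit[OF assms(1-5)] assms(6) by (blast intro: eventually_mono)

definition delay_step :: "real \<Rightarrow> real \<Rightarrow> real \<Rightarrow> c1 \<Rightarrow> c1" where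
  "delay_step \<delta> l s u = prim s (\<lambda>x. chi (delayed_flux \<delta> l u x))"

definition delay_iter :: "real \<Rightarrow> real \<Rightarrow> real \<Rightarrow> nat \<Rightarrow> c1" where
  "delay_iter \<delta> l s n = (delay_step \<delta> l s ^^ n) (prim s (\<lambda>_. 0))"

lemma D_delay_step: "0 \<le> \<delta> \<Longrightarrow> x \<in> {0..1} \<Longrightarrow> D (delay_step \<delta> l s u) x = chi (delayed_flux \<delta> l u x)"
  and app_delay_step: "0 \<le> \<delta> \<Longrightarrow> x \<in> {0..1} \<Longrightarrow> app (delay_step \<delta> l s u) x = s + integral {0..x} (\<lambda>x. chi (delayed_flux \<delta> l u x))"
  unfolding delay_step_def by (intro D_prim app_prim continuous_on_chi continuous_delayed_flux; assumption)+

lemma delay_step_tendsto: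
  assumes \<delta>: "0 \<le> \<delta>" and u: "(u \<longlongrightarrow> v) F" and l: "(l \<longlongrightarrow> l0) F" and s: "(s \<longlongrightarrow> s0) F"
  shows "((\<lambda>n. delay_step \<delta> (l n) (s n) (u n)) \<longlongrightarrow> delay_step \<delta> l0 s0 v) F"
  unfolding tendsto_iff
proof (intro allI impI)
  fix e :: real assume e: "0 < e"
  have "\<forall>\<^sub>F n in F. \<bar>s n - s0\<bar> < e / 2" using tendstoD[OF s, of "e/2"] e by (simp add: dist_real_def)
  moreover have "\<forall>\<^sub>F n in F. \<forall>x\<in>{0..1}. \<bar>delayed_flux \<delta> (l n) (u n) x - delayed_flux \<delta> l0 v x\<bar> < e / 8"
    by (rule delayed_flux_uniform_limit[OF u tendsto_const \<delta> \<delta> l]) (use e in simp)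
  ultimately show "\<forall>\<^sub>F n in F. dist (delay_step \<delta> (l n) (s n) (u n)) (delay_step \<delta> l0 s0 v) < e"
  proof eventually_elim
    case (elim n)
    have "dist (delay_step \<delta> (l n) (s n) (u n)) (delay_step \<delta> l0 s0 v) \<le> \<bar>s n - s0\<bar> + 2 * (2 * (e / 8))"
    proof (rule dist_c1_le)
      fix x :: real assume x: "x \<in> {0..1}"
      then have "\<bar>delayed_flux \<delta> (l n) (u n) x - delayed_flux \<delta> l0 v x\<bar> < e / 8" using elim(2) by blast
      then show "\<bar>D (delay_step \<delta> (l n) (s n) (u n)) x - D (delay_step \<delta> l0 s0 v) x\<bar> \<le> 2 * (e / 8)"
        unfolding D_delay_step[OF \<delta> x]
        by (intro order_trans[OF chi_lipschitz] mult_left_mono less_imp_le) auto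
    qed (simp add: app_delay_step \<delta>)
    then show ?case using elim(1) by linarith
  qed
qed

lemma prim_const_tendsto:
  assumes "(s \<longlongrightarrow> s0) F"
  shows "((\<lambda>n. prim (s n) (\<lambda>_. 0)) \<longlongrightarrow> prim s0 (\<lambda>_. 0)) F"
proof -
  have "dist (prim a (\<lambda>_. 0)) (prim c (\<lambda>_. 0)) \<le> dist a c + 2 * 0" for a c :: real
    by (rule dist_c1_le) (simp_all add: app_prim D_prim dist_real_def)
  then show ?thesis by (intro metric_tendsto_imp_tendsto[OF assms] always_eventually) simp
qed

lemma delay_iter_tendsto:
  assumes "0 \<le> \<delta>" "(l \<longlongrightarrow> l0) F" "(s \<longlongrightarrow> s0) F"
  shows "((\<lambda>w. delay_iter \<delta> (l w) (s w) n) \<longlongrightarrow> delay_iter \<delta> l0 s0 n) F"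
proof (induction n)
  case 0
  then show ?case using prim_const_tendsto[OF assms(3)] by (simp add: delay_iter_def)
next
  case (Suc n)
  then show ?case using delay_step_tendsto[OF assms(1) Suc assms(2,3)] by (simp add: delay_iter_def)
qed

text \<open>Each step of the iteration settles the solution on one more interval of length \<open>\<delta>\<close>.\<close>

lemma delay_iter_stable:
  assumes \<delta>: "0 \<le> \<delta>" and x: "x \<in> {0..1}" "x \<le> n * \<delta>"
  shows "app (delay_iter \<delta> l s (Suc n)) x = app (delay_iter \<delta> l s n) x"
  using x
proof (induction n arbitrary: x)
  case 0
  then show ?case by (simp add: delay_iter_def app_delay_step \<delta> app_prim)
next
  case (Suc n)
  have eq: "delayed_flux \<delta> l (delay_iter \<delta> l s (Suc n)) y = delayed_flux \<delta> l (delay_iter \<delta> l s n) y"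
    if "y \<in> {0..x}" for y
  proof -
    have "integral {0..y} (\<lambda>t. b t * delayed_source \<delta> (delay_iter \<delta> l s (Suc n)) t) =
        integral {0..y} (\<lambda>t. b t * delayed_source \<delta> (delay_iter \<delta> l s n) t)"
    proof (rule integral_cong)
      fix t assume t: "t \<in> {0..y}"
      have "max 0 (t - \<delta>) \<in> {0..1}" "max 0 (t - \<delta>) \<le> n * \<delta>"
        using t that Suc.prems \<delta> by (auto simp: algebra_simps)
      then show "b t * delayed_source \<delta> (delay_iter \<delta> l s (Suc n)) t = b t * delayed_source \<delta> (delay_iter \<delta> l s n) t"
        using Suc.IH by (simp add: delayed_source_def)
    qed
    then show ?thesis by (simp add: delayed_flux_def bint_def)
  qed
  have "app (delay_iter \<delta> l s (Suc (Suc n))) x = s + integral {0..x} (\<lambda>y. chi (delayed_flux \<delta> l (delay_iter \<delta> l s (Suc n)) y))"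
    using app_delay_step[OF \<delta> Suc.prems(1)] by (simp add: delay_iter_def)
  also have "integral {0..x} (\<lambda>y. chi (delayed_flux \<delta> l (delay_iter \<delta> l s (Suc n)) y)) =
      integral {0..x} (\<lambda>y. chi (delayed_flux \<delta> l (delay_iter \<delta> l s n) y))"
    by (intro integral_cong) (simp add: eq)
  also have "s + \<dots> = app (delay_iter \<delta> l s (Suc n)) x"
    using app_delay_step[OF \<delta> Suc.prems(1)] by (simp add: delay_iter_def)
  finally show ?case .
qed

text \<open>\<open>N + 1\<close> steps of length \<open>1 / (N + 1)\<close> cover \<open>[0, 1]\<close>, so this iterate is a fixed point of the step.\<close>

definition approx :: "nat \<Rightarrow> real \<Rightarrow> real \<Rightarrow> c1" where
  "approx N l s = delay_iter (1 / Suc N) l s (Suc N)"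

lemma approx_delayed_ivp: "delayed_ivp (1 / Suc N) l (approx N l s)"
proof -
  have nn: "0 \<le> 1 / real (Suc N)" by simp
  have "app (delay_step (1 / Suc N) l s (approx N l s)) x = app (approx N l s) x" for x
  proof (cases "x \<in> {0..1}")
    case True
    then have "x \<le> real (Suc N) * (1 / Suc N)" by simp
    from delay_iter_stable[OF nn True this] show ?thesis by (simp add: approx_def delay_iter_def)
  qed (simp add: app_outside)
  then have "delay_step (1 / Suc N) l s (approx N l s) = approx N l s" by (rule c1_eqI)
  then show ?thesis
    using D_delay_step[OF nn, of _ l s "approx N l s"] by (simp add: delayed_ivp_def)
qed

lemma app_approx_0: "app (approx N l s) 0 = s"
  by (simp add: approx_def delay_iter_def app_delay_step)

lemma continuous_on_approx:
  assumes "continuous_on S l" "continuous_on S s"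
  shows "continuous_on S (\<lambda>w. approx N (l w) (s w))"
  using assms unfolding continuous_on_def approx_def by (auto intro: delay_iter_tendsto)

lemma continuous_on_delayed_flux:
  assumes "0 \<le> \<delta>" "x \<in> {0..1}" "continuous_on S l" "continuous_on S u"
  shows "continuous_on S (\<lambda>w. delayed_flux \<delta> (l w) (u w) x)"
  using assms unfolding continuous_on_def by (auto intro!: delayed_flux_tendsto)

text \<open>Solutions have slopes bounded by \<open>1\<close>, because \<open>\<bar>\<chi>\<bar> \<le> 1\<close>, and therefore equi-Lipschitz fluxes. A uniform limit of
  the fluxes determines a \<open>C\<^sup>1\<close> limit of the solutions, and with vanishing delay the limit solves the exact problem.\<close>

lemma delayed_ivp_compactness:
  fixes u :: "nat \<Rightarrow> c1" and l \<delta> :: "nat \<Rightarrow> real"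
  assumes ivp: "\<And>n. delayed_ivp (\<delta> n) (l n) (u n)" and \<delta>: "\<And>n. 0 \<le> \<delta> n" "\<delta> \<longlonglongrightarrow> 0"
    and l: "\<And>n. \<bar>l n\<bar> \<le> L" and S: "\<And>n. \<bar>app (u n) 0\<bar> \<le> S"
  obtains r l0 v where "strict_mono r" "(\<lambda>n. l (r n)) \<longlonglongrightarrow> l0" "(\<lambda>n. u (r n)) \<longlonglongrightarrow> v" "ivp l0 v"
    "\<forall>x\<in>{0..1}. (\<lambda>n. delayed_flux (\<delta> (r n)) (l (r n)) (u (r n)) x) \<longlonglongrightarrow> flux l0 v x"
proof -
  have L0: "0 \<le> L" using l[of 0] by linarith
  have D1: "\<bar>D (u n) x\<bar> \<le> 1" if "x \<in> {0..1}" for n x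
    using ivp[of n] that abs_chi_le_1 by (simp add: delayed_ivp_def)
  have bd: "app (u n) x \<in> {-S-1..S+1}" if x: "x \<in> {0..1}" for n x
  proof -
    have "\<bar>app (u n) x - app (u n) 0\<bar> \<le> 1 * \<bar>x - 0\<bar>" by (rule app_lipschitz[OF _ x D1]) auto
    then show ?thesis using S[of n] x by auto
  qed
  have "compact (fp ` {-S-1..S+1})" by (intro compact_continuous_image continuous_on_fp) auto
  then have "bounded (fp ` {-S-1..S+1})" by (rule compact_imp_bounded)
  then obtain C where C: "\<And>t. t \<in> {-S-1..S+1} \<Longrightarrow> \<bar>fp t\<bar> \<le> C"
    unfolding bounded_real by (auto simp only: ball_simps)
  have src: "\<bar>delayed_source (\<delta> n) (u n) y\<bar> \<le> C" if "y \<in> {0..1}" for n y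
    unfolding delayed_source_def by (rule C[OF bd]) (use that \<delta>(1)[of n] in auto)
  have C0: "0 \<le> C" using src[of 0 0] by simp
  let ?J = "\<lambda>n. delayed_flux (\<delta> n) (l n) (u n)"
  have lip: "\<bar>?J n x - ?J n y\<bar> \<le> L * (K * C) * \<bar>x - y\<bar>" if "x \<in> {0..1}" "y \<in> {0..1}" for n x y
  proof -
    have "?J n x - ?J n y = - l n * (bint (delayed_source (\<delta> n) (u n)) x - bint (delayed_source (\<delta> n) (u n)) y)"
      by (simp add: delayed_flux_def algebra_simps)
    moreover have "\<bar>l n\<bar> * \<bar>bint (delayed_source (\<delta> n) (u n)) x - bint (delayed_source (\<delta> n) (u n)) y\<bar> \<le> L * (K * C * \<bar>x - y\<bar>)"
      using l L0 by (intro mult_mono bint_lipschitz continuous_delayed_source \<delta> src that) auto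
    ultimately show ?thesis by (simp add: abs_mult)
  qed
  have J0: "\<bar>?J n x\<bar> \<le> L * (K * C)" if x: "x \<in> {0..1}" for n x
  proof -
    have "\<bar>?J n x - ?J n 0\<bar> \<le> L * (K * C) * \<bar>x - 0\<bar>" using lip[OF x, of 0 n] by simp
    also have "\<dots> \<le> L * (K * C)" using x L0 K C0 by (simp add: mult_left_le)
    finally show ?thesis by (simp add: delayed_flux_def)
  qed
  have box: "\<forall>n. (l n, app (u n) 0) \<in> {-L..L} \<times> {-S..S}"
  proof
    fix n show "(l n, app (u n) 0) \<in> {-L..L} \<times> {-S..S}" using l[of n] S[of n] by auto
  qed
  have "seq_compact ({-L..L} \<times> {-S..S} :: (real \<times> real) set)"
    by (intro compact_imp_seq_compact compact_Times) auto
  from seq_compactE[OF this box] obtain w r1 where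
    r1: "strict_mono (r1::nat\<Rightarrow>nat)" "((\<lambda>n. (l n, app (u n) 0)) \<circ> r1) \<longlonglongrightarrow> w" .
  have AA: "\<exists>g k. continuous_on {0..1} g \<and> strict_mono (k :: nat \<Rightarrow> nat) \<and>
      (\<forall>e>0. \<exists>N. \<forall>n x. n \<ge> N \<and> x \<in> {0..1} \<longrightarrow> norm (?J (r1 (k n)) x - g x) < e)"
  proof (rule Arzela_Ascoli[of "{0..1::real}" "\<lambda>n. ?J (r1 n)" "L * (K * C)"])
    fix x e :: real assume x: "x \<in> {0..1}" and e: "0 < e"
    have pos: "0 < L * (K * C) + 1" using L0 K C0 by (simp add: add_nonneg_pos)
    have "norm (?J (r1 n) x - ?J (r1 n) y) < e" if "y \<in> {0..1}" "norm (x - y) < e / (L * (K * C) + 1)" for n y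
    proof -
      have "\<bar>?J (r1 n) x - ?J (r1 n) y\<bar> \<le> L * (K * C) * \<bar>x - y\<bar>" by (rule lip[OF x that(1)])
      also have "\<dots> \<le> (L * (K * C) + 1) * \<bar>x - y\<bar>" by (intro mult_right_mono) auto
      also have "\<dots> < e" using that(2) pos by (simp add: field_simps)
      finally show ?thesis by simp
    qed
    then show "\<exists>d>0. \<forall>n y. y \<in> {0..1} \<and> norm (x - y) < d \<longrightarrow> norm (?J (r1 n) x - ?J (r1 n) y) < e"
      using e pos by (intro exI[of _ "e / (L * (K * C) + 1)"]) auto
  qed (use J0 in auto)
  then obtain g k where g: "continuous_on {0..1} g" and k: "strict_mono (k :: nat \<Rightarrow> nat)"
    and unif: "\<And>e. 0 < e \<Longrightarrow> \<exists>N. \<forall>n x. n \<ge> N \<and> x \<in> {0..1} \<longrightarrow> norm (?J (r1 (k n)) x - g x) < e"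
    by blast
  define r where "r = r1 \<circ> k"
  have r: "strict_mono r" unfolding r_def by (rule strict_mono_o[OF r1(1) k])
  have lim: "(\<lambda>n. (l (r n), app (u (r n)) 0)) \<longlonglongrightarrow> w"
    using LIMSEQ_subseq_LIMSEQ[OF r1(2) k] by (simp add: r_def o_def)
  have ll: "(\<lambda>n. l (r n)) \<longlonglongrightarrow> fst w" and ls: "(\<lambda>n. app (u (r n)) 0) \<longlonglongrightarrow> snd w"
    using tendsto_fst[OF lim] tendsto_snd[OF lim] by simp_all
  define v where "v = prim (snd w) (\<lambda>x. chi (g x))"
  have Dv: "D v x = chi (g x)" if "x \<in> {0..1}" for x
    unfolding v_def by (rule D_prim[OF continuous_on_chi[OF g] that])
  have v0: "app v 0 = snd w" by (simp add: v_def app_prim continuous_on_chi g)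
  have uv: "(\<lambda>n. u (r n)) \<longlonglongrightarrow> v"
    unfolding tendsto_iff
  proof (intro allI impI)
    fix e :: real assume e: "0 < e"
    have "\<forall>\<^sub>F n in sequentially. \<bar>app (u (r n)) 0 - snd w\<bar> < e / 2"
      using tendstoD[OF ls, of "e/2"] e by (simp add: dist_real_def)
    moreover have "\<forall>\<^sub>F n in sequentially. \<forall>x\<in>{0..1}. \<bar>?J (r n) x - g x\<bar> < e / 8"
    proof -
      have "0 < e / 8" using e by simp
      from unif[OF this] show ?thesis unfolding eventually_sequentially r_def o_def real_norm_def by blast
    qed
    ultimately show "\<forall>\<^sub>F n in sequentially. dist (u (r n)) v < e"
    proof eventually_elim
      case (elim n)
      have "dist (u (r n)) v \<le> \<bar>app (u (r n)) 0 - snd w\<bar> + 2 * (2 * (e / 8))"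
      proof (rule dist_c1_le)
        fix x :: real assume x: "x \<in> {0..1}"
        then have "\<bar>?J (r n) x - g x\<bar> < e / 8" using elim(2) by blast
        then show "\<bar>D (u (r n)) x - D v x\<bar> \<le> 2 * (e / 8)"
          using chi_lipschitz[of "?J (r n) x" "g x"] ivp[of "r n"] x by (simp add: Dv delayed_ivp_def)
      qed (simp add: v0)
      then show ?case using elim(1) by linarith
    qed
  qed
  have fl: "(\<lambda>n. ?J (r n) x) \<longlonglongrightarrow> flux (fst w) v x" if "x \<in> {0..1}" for x
    using delayed_flux_tendsto[OF uv LIMSEQ_subseq_LIMSEQ[OF \<delta>(2) r, unfolded o_def] \<delta>(1) order_refl ll that] by simp
  have "flux (fst w) v x = g x" if x: "x \<in> {0..1}" for x
  proof (rule LIMSEQ_unique[OF fl[OF x]])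
    show "(\<lambda>n. ?J (r n) x) \<longlonglongrightarrow> g x"
      unfolding tendsto_iff
    proof (intro allI impI)
      fix e :: real assume "0 < e"
      from unif[OF this] show "\<forall>\<^sub>F n in sequentially. dist (?J (r n) x) (g x) < e"
        using x unfolding eventually_sequentially r_def dist_norm by auto
    qed
  qed
  then have "ivp (fst w) v" by (simp add: ivp_def Dv)
  then show ?thesis using that r ll uv fl by blast
qed

end

section \<open>The branch of small solutions\<close>

text \<open>\<open>d\<close> bounds the \<open>C\<^sup>1\<close> norm of the solutions that are followed; norms up to \<open>1/2\<close> keep the flux in the range
  where \<open>\<chi>\<close> is exact. \<open>l0_large\<close> keeps the solutions of the boundary value problem with \<open>\<lambda> s\<^sup>p\<^sup>-\<^sup>1 \<le> k\<^sub>2\<close> within norm \<open>d\<close>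
  once \<open>\<lambda> \<ge> \<lambda>\<^sub>0\<close> and \<open>s\<close> is the start value determined by \<open>\<lambda>\<close> and \<open>\<lambda> s\<^sup>p\<^sup>-\<^sup>1\<close>.\<close>

locale small_branch = indefinite_weight +
  fixes k1 k2 d l0 :: real
  assumes k: "0 < k1" "k1 < k2" and d: "0 < d" "d \<le> 1/2" and l0: "0 < l0"
    and fp_le: "\<And>s v. 0 < s \<Longrightarrow> s \<le> d \<Longrightarrow> v \<le> s \<Longrightarrow> fp v \<le> 2 * s powr p"
    and flux_pos: "\<And>l u. 0 < l \<Longrightarrow> ivp l u \<Longrightarrow> 0 < app u 0 \<Longrightarrow> app u 0 \<le> d \<Longrightarrow>
        l * app u 0 powr (p - 1) \<le> k1 \<Longrightarrow> 0 < flux l u 1"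
    and flux_neg: "\<And>l u. 0 < l \<Longrightarrow> ivp l u \<Longrightarrow> 0 < app u 0 \<Longrightarrow> app u 0 \<le> d \<Longrightarrow>
        k2 \<le> l * app u 0 powr (p - 1) \<Longrightarrow> -1/2 \<le> flux l u z \<Longrightarrow> flux l u 1 < 0"
    and l0_large: "(k2 / l0) powr (1 / (p - 1)) * (1 + 8 * K * k2) \<le> d"
begin

text \<open>Start values are measured by the scale invariant quantity \<open>t = \<lambda> s\<^sup>p\<^sup>-\<^sup>1\<close>.\<close>

definition start :: "real \<Rightarrow> real \<Rightarrow> real" where
  "start l t = (t / l) powr (1 / (p - 1))"

definition Z :: "(real \<times> c1) set" where
  "Z = {(l, u). l0 \<le> l \<and> ivp l u \<and> flux l u 1 = 0 \<and> 0 < app u 0 \<and> norm u \<le> d \<and> -1/2 \<le> flux l u z}"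

lemma Z_D:
  assumes "(l, u) \<in> Z"
  shows "l0 \<le> l" "ivp l u" "flux l u 1 = 0" "0 < app u 0" "norm u \<le> d" "-1/2 \<le> flux l u z"
  using assms by (simp_all add: Z_def)

lemma start_pos: "0 < l \<Longrightarrow> 0 < t \<Longrightarrow> 0 < start l t"
  by (simp add: start_def)

lemma start_level: "0 < l \<Longrightarrow> 0 < t \<Longrightarrow> l * start l t powr (p - 1) = t"
  using p by (simp add: start_def powr_powr)

lemma factor_ge_1: "1 \<le> 1 + 8 * K * k2"
  using K k by simp

lemma start_le:
  assumes "l0 \<le> l" "0 < t" "t \<le> k2"
  shows "start l t * (1 + 8 * K * k2) \<le> d"
proof -
  have "t / l \<le> k2 / l0" using assms l0 by (intro frac_le) auto
  then have "start l t \<le> (k2 / l0) powr (1 / (p - 1))"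
    unfolding start_def using assms l0 p by (intro powr_mono2) auto
  then have "start l t * (1 + 8 * K * k2) \<le> (k2 / l0) powr (1 / (p - 1)) * (1 + 8 * K * k2)"
    using factor_ge_1 by (intro mult_right_mono) auto
  then show ?thesis using l0_large by linarith
qed

lemma continuous_on_start:
  "continuous_on S (\<lambda>w. start (fst w) (snd w))" if "\<And>w. w \<in> S \<Longrightarrow> 0 < fst w \<and> 0 < snd w"
  unfolding start_def
  by (intro continuous_on_powr' continuous_on_divide continuous_on_fst continuous_on_snd continuous_on_id continuous_on_const)
    (use that in force)+

lemma flux_bound:
  assumes "l0 \<le> l" "0 < app u 0" "app u 0 \<le> d" "l * app u 0 powr (p - 1) \<le> k2" "x \<in> {0..1}"
    and "\<And>y. 0 \<le> y \<Longrightarrow> y \<le> x \<Longrightarrow> app u y \<le> app u 0"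
  shows "\<bar>flux l u x\<bar> \<le> 2 * K * app u 0 * k2"
proof -
  have "\<bar>flux l u x\<bar> \<le> 2 * K * app u 0 * (l * app u 0 powr (p - 1))"
    by (rule abs_flux_le_near_0) (use assms l0 fp_le in auto)
  also have "\<dots> \<le> 2 * K * app u 0 * k2"
    using assms K by (intro mult_left_mono) auto
  finally show ?thesis .
qed

lemma norm_bound:
  assumes "l0 \<le> l" "ivp l u" "0 < app u 0" "app u 0 \<le> d" "l * app u 0 powr (p - 1) \<le> k2" "flux l u 1 \<le> 0"
  shows "norm u \<le> app u 0 * (1 + 8 * K * k2)"
proof -
  have np: "flux l u x \<le> 0" if "x \<in> {0..1}" for x using flux_nonpos[OF _ _ that] assms l0 by simp
  have "\<bar>D u x\<bar> \<le> 4 * K * app u 0 * k2" if x: "x \<in> {0..1}" for x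
  proof -
    have "\<bar>flux l u x\<bar> \<le> 2 * K * app u 0 * k2"
      by (rule flux_bound) (use assms x np in \<open>auto intro!: ivp_decreasing[OF assms(2)]\<close>)
    then show ?thesis using abs_chi_le[of "flux l u x"] assms(2) x by (simp add: ivp_def)
  qed
  then have "norm u \<le> app u 0 + 2 * (4 * K * app u 0 * k2)" by (intro norm_c1_le) (use assms in auto)
  then show ?thesis by (simp add: algebra_simps)
qed

text \<open>The flux is smallest at \<open>z\<close>; up to there \<open>u \<le> u(0)\<close> holds whatever the sign of the final flux is.\<close>

lemma flux_z_bound:
  assumes "l0 \<le> l" "ivp l u" "0 < app u 0" "app u 0 * (1 + 8 * K * k2) \<le> d" "l * app u 0 powr (p - 1) \<le> k2"
  shows "-1/2 \<le> flux l u z"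
proof -
  have s: "app u 0 \<le> app u 0 * (1 + 8 * K * k2)" using factor_ge_1 assms(3) by simp
  have "\<bar>flux l u z\<bar> \<le> 2 * K * app u 0 * k2"
  proof (rule flux_bound)
    fix y assume y: "0 \<le> y" "y \<le> z"
    show "app u y \<le> app u 0"
      by (rule ivp_decreasing[OF assms(2)])
        (use y z l0 assms(1) flux_decreasing[of l 0 _ u] in auto)
  qed (use assms(1,3,5) z order_trans[OF s assms(4)] in auto)
  moreover have "8 * (K * app u 0 * k2) \<le> d" using assms(3,4) by (simp add: algebra_simps)
  ultimately show ?thesis using d by linarith
qed

lemma
  assumes "l0 \<le> l" "ivp l v"
  shows start_bottom: "app v 0 = start l k1 \<Longrightarrow> 0 < flux l v 1"
    and start_top: "app v 0 = start l k2 \<Longrightarrow> flux l v 1 < 0"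
    and start_in_Z: "app v 0 = start l t \<Longrightarrow> k1 \<le> t \<Longrightarrow> t \<le> k2 \<Longrightarrow> flux l v 1 = 0 \<Longrightarrow> (l, v) \<in> Z"
proof -
  have l: "0 < l" using assms l0 by simp
  have start: "0 < start l t" "start l t \<le> d" "l * start l t powr (p - 1) = t" if "k1 \<le> t" "t \<le> k2" for t
  proof -
    have "0 < t" using that k by simp
    then show "0 < start l t" "l * start l t powr (p - 1) = t" using start_pos start_level l by auto
    then have "start l t \<le> start l t * (1 + 8 * K * k2)" using factor_ge_1 by simp
    then show "start l t \<le> d" using start_le[OF assms(1) \<open>0 < t\<close> that(2)] by linarith
  qed
  have half: "-1/2 \<le> flux l v z" if "app v 0 = start l t" "k1 \<le> t" "t \<le> k2" for t
    by (rule flux_z_bound[OF assms]) (use start[OF that(2,3)] start_le[OF assms(1)] that k in auto)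
  show "0 < flux l v 1" if "app v 0 = start l k1"
    by (rule flux_pos[OF l assms(2)]) (use start[of k1] k that in auto)
  show "flux l v 1 < 0" if "app v 0 = start l k2"
    by (rule flux_neg[OF l assms(2)]) (use start[of k2] k that half[OF that] in auto)
  show "(l, v) \<in> Z" if v: "app v 0 = start l t" "k1 \<le> t" "t \<le> k2" "flux l v 1 = 0"
  proof -
    have "norm v \<le> app v 0 * (1 + 8 * K * k2)"
      by (rule norm_bound[OF assms]) (use start[OF v(2,3)] v in auto)
    also have "\<dots> \<le> d" using start_le[OF assms(1), of t] v k by auto
    finally show ?thesis using assms v start(1)[OF v(2,3)] half[OF v(1-3)] by (simp add: Z_def)
  qed
qed

lemma Z_level:
  assumes "(l, u) \<in> Z"
  shows "k1 < l * app u 0 powr (p - 1)" "l * app u 0 powr (p - 1) < k2" "app u 0 \<le> d"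
proof -
  have u: "l0 \<le> l" "ivp l u" "flux l u 1 = 0" "0 < app u 0" "norm u \<le> d" "-1/2 \<le> flux l u z"
    using assms by (auto simp: Z_def)
  show s: "app u 0 \<le> d" using app_le_norm[of 0 u] u(5) by simp
  show "k1 < l * app u 0 powr (p - 1)" "l * app u 0 powr (p - 1) < k2"
    using flux_pos[of l u] flux_neg[of l u] u s l0 by (auto simp: not_less[symmetric])
qed

lemma Z_norm_le:
  assumes "(l, u) \<in> Z"
  shows "norm u \<le> start l k2 * (1 + 8 * K * k2)"
proof -
  have u: "l0 \<le> l" "ivp l u" "flux l u 1 = 0" "0 < app u 0" using assms by (auto simp: Z_def)
  note lev = Z_level[OF assms]
  have l: "0 < l" using u l0 by simp
  have "app u 0 = (app u 0 powr (p - 1)) powr (1 / (p - 1))" using u(4) p by (simp add: powr_powr)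
  also have "\<dots> \<le> start l k2"
    unfolding start_def using lev(2) l p by (intro powr_mono2) (auto simp: field_simps)
  finally have "app u 0 * (1 + 8 * K * k2) \<le> start l k2 * (1 + 8 * K * k2)"
    using factor_ge_1 by (intro mult_right_mono) auto
  moreover have "norm u \<le> app u 0 * (1 + 8 * K * k2)"
    by (rule norm_bound) (use u lev in auto)
  ultimately show ?thesis by linarith
qed

lemma compact_Z: "compact {w \<in> Z. fst w \<le> L}"
  unfolding compact_eq_seq_compact_metric seq_compact_def
proof (intro allI impI)
  fix w :: "nat \<Rightarrow> real \<times> c1"
  assume "\<forall>n. w n \<in> {w \<in> Z. fst w \<le> L}"
  then have w: "(fst (w n), snd (w n)) \<in> Z" "fst (w n) \<le> L" for n by auto
  have ivp: "delayed_ivp 0 (fst (w n)) (snd (w n))" for n using Z_D(2)[OF w(1)] by simp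
  have bl: "\<bar>fst (w n)\<bar> \<le> L" for n using Z_D(1)[OF w(1), of n] w(2)[of n] l0 by linarith
  have bs: "\<bar>app (snd (w n)) 0\<bar> \<le> d" for n
    using app_le_norm[of 0 "snd (w n)"] Z_D(5)[OF w(1), of n] by simp
  obtain r l v where r: "strict_mono r" and l: "(\<lambda>n. fst (w (r n))) \<longlonglongrightarrow> l" and v: "(\<lambda>n. snd (w (r n))) \<longlonglongrightarrow> v"
    and lv: "ivp l v" and fl0: "\<forall>x\<in>{0..1}. (\<lambda>n. delayed_flux 0 (fst (w (r n))) (snd (w (r n))) x) \<longlonglongrightarrow> flux l v x"
    by (rule delayed_ivp_compactness[where \<delta> = "\<lambda>_. 0" and l = "\<lambda>n. fst (w n)" and u = "\<lambda>n. snd (w n)",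
          OF ivp order_refl tendsto_const bl bs]) (rule that)
  have fl: "(\<lambda>n. flux (fst (w (r n))) (snd (w (r n))) x) \<longlonglongrightarrow> flux l v x" if "x \<in> {0..1}" for x
    using bspec[OF fl0 that] by simp
  have Zr: "(fst (w (r n)), snd (w (r n))) \<in> Z" for n by (rule w(1))
  have s: "(\<lambda>n. app (snd (w (r n))) 0) \<longlonglongrightarrow> app v 0" by (rule tendsto_app[OF _ v]) simp
  have "l0 \<le> l" by (rule LIMSEQ_le_const[OF l]) (use Z_D(1)[OF Zr] in blast)
  moreover have "l \<le> L" by (rule LIMSEQ_le_const2[OF l]) (use w(2) in blast)
  moreover have "flux l v 1 = 0"
    using LIMSEQ_unique[OF fl[of 1], of 0] Z_D(3)[OF Zr] by simp
  moreover have "-1/2 \<le> flux l v z"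
    by (rule LIMSEQ_le_const[OF fl]) (use Z_D(6)[OF Zr] z in auto)
  moreover have "norm v \<le> d"
    by (rule LIMSEQ_le_const2[OF tendsto_norm[OF v]]) (use Z_D(5)[OF Zr] in blast)
  moreover have "0 < app v 0"
  proof -
    have nn: "\<forall>\<^sub>F n in sequentially. 0 \<le> app (snd (w (r n))) 0"
      by (intro always_eventually allI less_imp_le Z_D(4)[OF Zr])
    have "(\<lambda>n. fst (w (r n)) * app (snd (w (r n))) 0 powr (p - 1)) \<longlonglongrightarrow> l * app v 0 powr (p - 1)"
      using p by (intro tendsto_mult l tendsto_powr2 s tendsto_const nn) auto
    then have "k1 \<le> l * app v 0 powr (p - 1)"
      by (rule LIMSEQ_le_const) (use less_imp_le[OF Z_level(1)[OF Zr]] in blast)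
    moreover have "0 \<le> app v 0" by (rule LIMSEQ_le_const[OF s]) (use less_imp_le[OF Z_D(4)[OF Zr]] in blast)
    ultimately show ?thesis using k by (cases "app v 0 = 0") auto
  qed
  ultimately have "(l, v) \<in> {w \<in> Z. fst w \<le> L}" using lv by (simp add: Z_def)
  moreover have "(w \<circ> r) \<longlonglongrightarrow> (l, v)"
    using tendsto_Pair[OF l v] by (simp add: o_def)
  ultimately show "\<exists>l\<in>{w \<in> Z. fst w \<le> L}. \<exists>r. strict_mono r \<and> (w \<circ> r) \<longlonglongrightarrow> l" using r by blast
qed

text \<open>A separation of the exact solutions would separate the solutions of the delayed problem for small
  delays: the five ways in which a point of the parameter rectangle can contradict the planar lemma are closed
  conditions, so that they would pass to an exact solution in the limit.\<close>

lemma Z_not_separated: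
  assumes L: "l0 < L" and AB: "compact A" "compact B" "A \<inter> B = {}" "A \<union> B = {w \<in> Z. fst w \<le> L}"
    and left: "\<And>w. w \<in> Z \<Longrightarrow> fst w = l0 \<Longrightarrow> w \<in> A" and right: "\<And>w. w \<in> Z \<Longrightarrow> fst w = L \<Longrightarrow> w \<in> B"
  shows False
proof -
  obtain Q :: "real \<times> c1 \<Rightarrow> real" where Q: "continuous_on UNIV Q"
    "\<And>w. w \<in> A \<Longrightarrow> Q w = 1" "\<And>w. w \<in> B \<Longrightarrow> Q w = -1"
    using Urysohn_metric[OF compact_imp_closed[OF AB(1)] compact_imp_closed[OF AB(2)] AB(3)] by metis
  let ?R = "{l0..L} \<times> {k1..k2}"
  define U where "U N w = approx N (fst w) (start (fst w) (snd w))" for N w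
  define H where "H N w = delayed_flux (1 / Suc N) (fst w) (U N w) 1" for N w
  define q where "q N w = Q (fst w, U N w)" for N w
  \<comment> \<open>each disjunct is the failure of one hypothesis of \<open>zero_set_not_separated\<close>, the last one its conclusion\<close>
  define Bad where "Bad w h y \<longleftrightarrow> (snd w = k1 \<and> h \<le> 0) \<or> (snd w = k2 \<and> 0 \<le> h) \<or>
      (fst w = l0 \<and> h = 0 \<and> y \<le> 0) \<or> (fst w = L \<and> h = 0 \<and> 0 \<le> y) \<or> (h = 0 \<and> y = 0)"
    for w :: "real \<times> real" and h y :: real
  have cU: "continuous_on ?R (U N)" for N
    unfolding U_def by (intro continuous_on_approx continuous_on_start continuous_on_fst continuous_on_id) (use l0 k in auto)
  have cH: "continuous_on ?R (H N)" for N
    unfolding H_def by (intro continuous_on_delayed_flux continuous_on_fst continuous_on_id cU) auto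
  have cq: "continuous_on ?R (q N)" for N
    unfolding q_def
    by (rule continuous_on_compose2[OF Q(1)]) (auto intro!: continuous_on_Pair continuous_on_fst continuous_on_id cU)
  have "\<exists>w \<in> ?R. Bad w (H N w) (q N w)" for N
  proof (rule ccontr)
    assume "\<not> ?thesis"
    then have no: "\<not> Bad w (H N w) (q N w)" if "w \<in> ?R" for w using that by blast
    have "\<exists>w \<in> ?R. H N w = 0 \<and> q N w = 0"
    proof (rule zero_set_not_separated[OF L less_imp_le[OF k(2)] cq cH])
      show "0 < H N (x, k1)" "H N (x, k2) < 0" if "x \<in> {l0..L}" for x
        using no[of "(x, k1)"] no[of "(x, k2)"] that k by (auto simp: Bad_def)
      show "0 < q N (l0, y)" if "y \<in> {k1..k2}" "H N (l0, y) = 0" for y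
        using no[of "(l0, y)"] that L by (auto simp: Bad_def)
      show "q N (L, y) < 0" if "y \<in> {k1..k2}" "H N (L, y) = 0" for y
        using no[of "(L, y)"] that L by (auto simp: Bad_def)
    qed
    then show False using no by (auto simp: Bad_def)
  qed
  then have "\<exists>w. w \<in> ?R \<and> Bad w (H N w) (q N w)" for N by blast
  then obtain w where w: "\<And>N. w N \<in> ?R" "\<And>N. Bad (w N) (H N (w N)) (q N (w N))" by metis
  have "compact ?R" by (intro compact_Times) auto
  then have "seq_compact ?R" by (rule compact_imp_seq_compact)
  moreover have "\<forall>n. w n \<in> ?R" using w(1) by blast
  ultimately obtain w0 r1 where r1: "w0 \<in> ?R" "strict_mono (r1::nat\<Rightarrow>nat)" "(w \<circ> r1) \<longlonglongrightarrow> w0"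
    by (rule seq_compactE)
  define w' where "w' n = w (r1 n)" for n
  have w': "fst (w' n) \<in> {l0..L}" "snd (w' n) \<in> {k1..k2}" for n
    using w(1)[of "r1 n"] by (auto simp: w'_def mem_Times_iff)
  have lim: "w' \<longlonglongrightarrow> w0" using r1(3) unfolding w'_def o_def .
  have dl: "(\<lambda>n. 1 / real (Suc (r1 n))) \<longlonglongrightarrow> 0"
    using LIMSEQ_subseq_LIMSEQ[OF LIMSEQ_Suc[OF lim_inverse_n'] r1(2)] by (simp add: o_def)
  have bl: "\<bar>fst (w' n)\<bar> \<le> L" for n using w'(1)[of n] l0 by auto
  have bs: "\<bar>app (U (r1 n) (w' n)) 0\<bar> \<le> d" for n
  proof -
    have t: "l0 \<le> fst (w' n)" "0 < snd (w' n)" "snd (w' n) \<le> k2" using w'[of n] k by auto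
    have "0 < start (fst (w' n)) (snd (w' n))" using t l0 by (intro start_pos) auto
    moreover from this have "start (fst (w' n)) (snd (w' n)) \<le> start (fst (w' n)) (snd (w' n)) * (1 + 8 * K * k2)"
      using factor_ge_1 by simp
    ultimately show ?thesis unfolding U_def app_approx_0 using start_le[OF t] by linarith
  qed
  have iv: "delayed_ivp (1 / Suc (r1 n)) (fst (w' n)) (U (r1 n) (w' n))" for n
    unfolding U_def by (rule approx_delayed_ivp)
  obtain r l v where r: "strict_mono r" and l: "(\<lambda>n. fst (w' (r n))) \<longlonglongrightarrow> l"
    and v: "(\<lambda>n. U (r1 (r n)) (w' (r n))) \<longlonglongrightarrow> v" and lv: "ivp l v"
    and fl: "\<forall>x\<in>{0..1}. (\<lambda>n. delayed_flux (1 / Suc (r1 (r n))) (fst (w' (r n))) (U (r1 (r n)) (w' (r n))) x) \<longlonglongrightarrow> flux l v x"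
    by (rule delayed_ivp_compactness[where \<delta> = "\<lambda>n. 1 / Suc (r1 n)" and l = "\<lambda>n. fst (w' n)" and u = "\<lambda>n. U (r1 n) (w' n)",
          OF iv divide_nonneg_nonneg[OF zero_le_one of_nat_0_le_iff] dl bl bs]) (rule that)
  define t where "t = snd w0"
  have lim': "(\<lambda>n. w' (r n)) \<longlonglongrightarrow> w0" using LIMSEQ_subseq_LIMSEQ[OF lim r] by (simp add: o_def)
  have lw: "l = fst w0" by (rule LIMSEQ_unique[OF l tendsto_fst[OF lim']])
  have lt: "l0 \<le> l" "l \<le> L" "k1 \<le> t" "t \<le> k2" using r1(1) by (auto simp: lw t_def mem_Times_iff)
  have hlim: "(\<lambda>n. H (r1 (r n)) (w' (r n))) \<longlonglongrightarrow> flux l v 1" using bspec[OF fl, of 1] by (simp add: H_def)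
  have qlim: "(\<lambda>n. q (r1 (r n)) (w' (r n))) \<longlonglongrightarrow> Q (l, v)"
    unfolding q_def
    by (rule continuous_on_tendsto_compose[OF Q(1) tendsto_Pair[OF l v]]) auto
  have v0: "app v 0 = start l t"
  proof (rule LIMSEQ_unique)
    show "(\<lambda>n. app (U (r1 (r n)) (w' (r n))) 0) \<longlonglongrightarrow> app v 0" by (rule tendsto_app[OF _ v]) simp
    have "continuous_on ?R (\<lambda>w. start (fst w) (snd w))" by (rule continuous_on_start) (use l0 k in auto)
    from continuous_on_tendsto_compose[OF this lim' r1(1)]
    show "(\<lambda>n. app (U (r1 (r n)) (w' (r n))) 0) \<longlonglongrightarrow> start l t"
      using w' by (simp add: U_def app_approx_0 lw t_def mem_Times_iff)
  qed
  have "closed {x :: (real \<times> real) \<times> real \<times> real. Bad (fst x) (fst (snd x)) (snd (snd x))}"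
    unfolding Bad_def
    by (intro closed_Collect_disj closed_Collect_conj closed_Collect_eq closed_Collect_le continuous_intros)
  moreover have "(\<lambda>n. (w' (r n), H (r1 (r n)) (w' (r n)), q (r1 (r n)) (w' (r n)))) \<longlonglongrightarrow> (w0, flux l v 1, Q (l, v))"
    by (intro tendsto_Pair lim' hlim qlim)
  moreover have "Bad (w' n) (H (r1 n) (w' n)) (q (r1 n) (w' n))" for n using w(2)[of "r1 n"] by (simp add: w'_def)
  ultimately have "(w0, flux l v 1, Q (l, v)) \<in> {x. Bad (fst x) (fst (snd x)) (snd (snd x))}"
    by (intro Lim_in_closed_set[OF _ _ sequentially_bot]) auto
  then have bad: "Bad w0 (flux l v 1) (Q (l, v))" by simp
  have inZ: "(l, v) \<in> Z" if "flux l v 1 = 0" by (rule start_in_Z[OF lt(1) lv v0 lt(3,4) that])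
  have vals: "Q (l, v) = 1 \<or> Q (l, v) = -1" if "flux l v 1 = 0"
  proof -
    have "(l, v) \<in> A \<union> B" unfolding AB(4) using inZ[OF that] lt by simp
    then show ?thesis using Q(2,3) by blast
  qed
  have "Q (l, v) = 1" if "flux l v 1 = 0" "l = l0" using left[OF inZ[OF that(1)]] that Q(2) by simp
  moreover have "Q (l, v) = -1" if "flux l v 1 = 0" "l = L" using right[OF inZ[OF that(1)]] that Q(3) by simp
  moreover have "0 < flux l v 1" if "t = k1" using start_bottom[OF lt(1) lv] v0 that by simp
  moreover have "flux l v 1 < 0" if "t = k2" using start_top[OF lt(1) lv] v0 that by simp
  ultimately show False using bad vals unfolding Bad_def lw[symmetric] t_def[symmetric] by fastforce
qed

lemma connected_branch: "\<exists>S \<subseteq> Z. connected S \<and> {l0..} \<subseteq> fst ` S"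
proof (rule connected_set_over_half_line[OF compact_Z])
  show "l0 \<le> fst w" if "w \<in> Z" for w using that by (auto simp: Z_def)
qed (use Z_not_separated in blast)

text \<open>The component may contain large solutions as well. Being small is decided by the norm alone: a positive
  solution of norm at most \<open>d\<close> belongs to \<open>Z\<close>. So the minimal norm is sought within the compact slice of \<open>Z\<close>. Choosing
  \<open>\<lambda>\<^sub>0\<close> beyond the principal eigenvalue keeps the two trivial pairs away from these slices.\<close>

lemma component_of_small_solutions:
  assumes ab: "AE x in lebesgue_on {0<..<1}. a x = b x" and ev: "principal_eigenvalue a < l0"
  shows "\<exists>C \<in> components (Sr_plus a f). {l0<..} \<subseteq> fst ` C \<and>
    (\<exists>m :: real \<Rightarrow> real. (\<forall>l > l0. m l \<in> {norm u | u. (l, u) \<in> C} \<and> (\<forall>u. (l, u) \<in> C \<longrightarrow> m l \<le> norm u)) \<and>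
      (m \<longlongrightarrow> 0) at_top)"
proof -
  have ZS: "Z \<subseteq> Sr_plus a f"
  proof
    fix w assume "w \<in> Z"
    then obtain l u where w: "w = (l, u)" "l0 \<le> l" "ivp l u" "flux l u 1 = 0" "0 < app u 0" "-1/2 \<le> flux l u z"
      by (auto simp: Z_def)
    have "0 \<le> l" using w l0 by simp
    from ivp_imp_regular_solution[OF ab this w(3-6)] this show "w \<in> Sr_plus a f"
      by (simp add: Sr_plus_def w(1))
  qed
  have SZ: "(l, u) \<in> Z" if "(l, u) \<in> Sr_plus a f" "l0 < l" "norm u \<le> d" for l u
  proof -
    have "regular_solution a f l u" "positive u" "0 \<le> l" using that ev l0 by (auto simp: Sr_plus_def)
    from regular_solution_imp_ivp[OF ab this(3,1,2)] show ?thesis using that d z by (auto simp: Z_def)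
  qed
  obtain S where S: "S \<subseteq> Z" "connected S" "{l0..} \<subseteq> fst ` S" using connected_branch by blast
  then obtain w0 where w0: "w0 \<in> S" by fastforce
  define C where "C = connected_component_set (Sr_plus a f) w0"
  have C: "C \<in> components (Sr_plus a f)" using w0 S ZS by (auto simp: C_def components_def)
  have SC: "S \<subseteq> C" unfolding C_def by (rule connected_component_maximal) (use w0 S ZS in auto)
  have CS: "C \<subseteq> Sr_plus a f" using C by (rule in_components_subset)
  define E where "E l = start l k2 * (1 + 8 * K * k2)" for l
  have "\<exists>y. (y \<in> {norm u | u. (l, u) \<in> C} \<and> (\<forall>u. (l, u) \<in> C \<longrightarrow> y \<le> norm u)) \<and> 0 \<le> y \<and> y \<le> E l" if l: "l0 < l" for l
  proof -
    have "l \<in> fst ` S" using S(3) l by auto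
    then obtain u where u: "(l, u) \<in> S" by auto
    have uE: "norm u \<le> E l" unfolding E_def by (rule Z_norm_le) (use u S in auto)
    have ud: "norm u \<le> d" using u S(1) by (auto simp: Z_def)
    let ?M = "{w \<in> Z. fst w \<le> l} \<inter> C \<inter> {w. fst w = l}"
    have "closedin (top_of_set (Sr_plus a f)) C" by (rule closedin_component[OF C])
    then obtain T where T: "closed T" "C = Sr_plus a f \<inter> T" by (auto simp: closedin_closed)
    have M: "?M = {w \<in> Z. fst w \<le> l} \<inter> (T \<inter> {w. fst w = l})" using T(2) ZS by auto
    have "closed {w::real \<times> c1. fst w = l}" by (intro closed_Collect_eq continuous_intros)
    then have "compact ?M" unfolding M by (intro compact_Int_closed compact_Z closed_Int T)
    moreover have "(l, u) \<in> ?M" using u S SC by auto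
    moreover have "continuous_on ?M (\<lambda>w. norm (snd w))" by (intro continuous_intros)
    ultimately obtain y where y: "y \<in> ?M" "\<And>w. w \<in> ?M \<Longrightarrow> norm (snd y) \<le> norm (snd w)"
      using continuous_attains_inf[of ?M "\<lambda>w. norm (snd w)"] by blast
    have yl: "y = (l, snd y)" using y(1) by (cases y) auto
    have yu: "norm (snd y) \<le> norm u" using y(2)[of "(l, u)"] \<open>(l, u) \<in> ?M\<close> by simp
    have "norm (snd y) \<le> norm v" if v: "(l, v) \<in> C" for v
    proof (cases "norm v \<le> d")
      case True
      then have "(l, v) \<in> ?M" using SZ[of l v] CS v l by auto
      then show ?thesis using y(2)[of "(l, v)"] by simp
    next
      case False
      then show ?thesis using yu ud by linarith
    qed
    moreover have "(l, snd y) \<in> C" using y(1) yl by auto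
    ultimately show ?thesis using yu uE by (intro exI[of _ "norm (snd y)"]) auto
  qed
  then have "\<forall>l\<in>{l0<..}. \<exists>y. (y \<in> {norm u | u. (l, u) \<in> C} \<and> (\<forall>u. (l, u) \<in> C \<longrightarrow> y \<le> norm u)) \<and> 0 \<le> y \<and> y \<le> E l"
    by simp
  from bchoice[OF this] obtain m where
    m: "\<forall>l\<in>{l0<..}. (m l \<in> {norm u | u. (l, u) \<in> C} \<and> (\<forall>u. (l, u) \<in> C \<longrightarrow> m l \<le> norm u)) \<and> 0 \<le> m l \<and> m l \<le> E l" ..
  have "((\<lambda>l. k2 / l) \<longlongrightarrow> 0) at_top"
    by (rule tendsto_divide_0[OF tendsto_const filterlim_mono[OF filterlim_ident at_top_le_at_infinity order_refl]])
  moreover have "\<forall>\<^sub>F l in at_top. 0 \<le> k2 / l"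
    using eventually_gt_at_top[of 0] by eventually_elim (use k in simp)
  ultimately have "((\<lambda>l. start l k2) \<longlongrightarrow> 0 powr (1 / (p - 1))) at_top"
    unfolding start_def using p by (intro tendsto_powr2 tendsto_const) auto
  then have "((\<lambda>l. start l k2 * (1 + 8 * K * k2)) \<longlongrightarrow> 0 * (1 + 8 * K * k2)) at_top"
    by (intro tendsto_mult tendsto_const) simp
  then have E0: "(E \<longlongrightarrow> 0) at_top" unfolding E_def by simp
  have "(m \<longlongrightarrow> 0) at_top"
  proof (rule tendsto_sandwich[OF _ _ tendsto_const E0])
    show "\<forall>\<^sub>F l in at_top. 0 \<le> m l" "\<forall>\<^sub>F l in at_top. m l \<le> E l"
      using eventually_gt_at_top[of l0] by (eventually_elim, use m in simp)+
  qed
  moreover have "{l0<..} \<subseteq> fst ` C"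
    using order_trans[OF S(3) image_mono[OF SC]] by (rule order_trans[rotated]) auto
  ultimately show ?thesis using C m by (intro bexI[of _ C] conjI exI[of _ m]) auto
qed

end

lemma (in indefinite_weight) ex_small_branch:
  "\<exists>k1 k2 d l0. small_branch b z K f p k1 k2 d l0 \<and> c < l0"
proof -
  obtain k1 d1 where k1: "0 < k1" "0 < d1" and pos: "\<And>l u. 0 < l \<Longrightarrow> ivp l u \<Longrightarrow> 0 < app u 0 \<Longrightarrow> app u 0 \<le> d1 \<Longrightarrow>
     l * app u 0 powr (p - 1) \<le> k1 \<Longrightarrow> 0 < flux l u 1"
    using flux_pos_of_small_start by metis
  obtain k2 d2 where k2: "0 < k2" "0 < d2" and neg: "\<And>l u. 0 < l \<Longrightarrow> ivp l u \<Longrightarrow> 0 < app u 0 \<Longrightarrow> app u 0 \<le> d2 \<Longrightarrow>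
     k2 \<le> l * app u 0 powr (p - 1) \<Longrightarrow> -1/2 \<le> flux l u z \<Longrightarrow> flux l u 1 < 0"
    using flux_neg_of_large_start by metis
  obtain d3 where d3: "0 < d3" and le: "\<And>s v. 0 < s \<Longrightarrow> s \<le> d3 \<Longrightarrow> v \<le> s \<Longrightarrow> fp v \<le> 2 * s powr p"
    using fp_le_near_0 by metis
  define d where "d = min (min d1 d2) (min d3 (1/2))"
  have d: "0 < d" "d \<le> d1" "d \<le> d2" "d \<le> d3" "d \<le> 1/2" using k1 k2 d3 by (auto simp: d_def)
  define \<rho> where "\<rho> = d / (1 + 8 * K * (k1 + k2))"
  have fac: "0 < 1 + 8 * K * (k1 + k2)" using K k1 k2 by (simp add: add_pos_nonneg)
  then have \<rho>: "0 < \<rho>" using d by (simp add: \<rho>_def)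
  define l0 where "l0 = max (\<bar>c\<bar> + 1) ((k1 + k2) / \<rho> powr (p - 1))"
  have l0: "0 < l0" "c < l0" by (auto simp: l0_def)
  have "(k1 + k2) / \<rho> powr (p - 1) \<le> l0" by (simp add: l0_def)
  then have "(k1 + k2) / l0 \<le> \<rho> powr (p - 1)" using l0 \<rho> by (simp add: field_simps)
  then have "((k1 + k2) / l0) powr (1 / (p - 1)) \<le> (\<rho> powr (p - 1)) powr (1 / (p - 1))"
    using l0 k1 k2 p by (intro powr_mono2) auto
  also have "\<dots> = \<rho>" using p \<rho> by (simp add: powr_powr)
  finally have "((k1 + k2) / l0) powr (1 / (p - 1)) * (1 + 8 * K * (k1 + k2)) \<le> d"
    using fac by (simp add: \<rho>_def le_divide_eq)
  then have "small_branch b z K f p k1 (k1 + k2) d l0"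
    using k1 k2 d l0 pos neg le by unfold_locales auto
  then show ?thesis using l0 by blast
qed

section \<open>A bounded representative of the weight\<close>

lemma AE_open_interval_join:
  fixes x y z :: real
  assumes "x < z" "z < y" "AE t in lebesgue_on {x<..<z}. P t" "AE t in lebesgue_on {z<..<y}. P t"
  shows "AE t in lebesgue_on {x<..<y}. P t"
proof -
  have "AE t in lebesgue. t \<noteq> z" by (rule AE_completion[OF AE_lborel_singleton])
  moreover have "AE t in lebesgue. t \<in> {x<..<z} \<longrightarrow> P t" "AE t in lebesgue. t \<in> {z<..<y} \<longrightarrow> P t"
    using assms(3,4) by (simp_all add: AE_restrict_space_iff)
  ultimately have "AE t in lebesgue. t \<in> {x<..<y} \<longrightarrow> P t"
    by eventually_elim auto
  then show ?thesis by (simp add: AE_restrict_space_iff)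
qed

lemma bounded_representative:
  fixes a :: "real \<Rightarrow> real"
  assumes a: "a \<in> Linfty01" and z: "0 < z" "z < 1"
    and pos: "AE x in lebesgue_on {0<..<z}. a x > 0" and neg: "AE x in lebesgue_on {z<..<1}. a x < 0"
  obtains b K where "0 < K" "bounded_measurable01 b" "\<forall>x. \<bar>b x\<bar> \<le> K"
    "\<forall>x\<le>z. 0 \<le> b x" "\<forall>x\<ge>z. b x \<le> 0"
    "AE x in lebesgue_on {0<..<1}. a x = b x"
proof -
  obtain K0 where m: "a \<in> borel_measurable (lebesgue_on {0<..<1})" and K0: "AE x in lebesgue_on {0<..<1}. \<bar>a x\<bar> \<le> K0"
    using a by (auto simp: Linfty01_def)
  define K where "K = max 1 K0"
  define a' where "a' x = (if x \<in> {0<..<1} then a x else 0)" for x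
  define b where "b x = (if x \<in> {0<..<z} then max 0 (min K (a' x)) else if x \<in> {z<..<1} then min 0 (max (-K) (a' x)) else 0)" for x
  have "a' \<in> borel_measurable lebesgue"
    using m unfolding a'_def by (intro borel_measurable_if_I) auto
  then have "b \<in> borel_measurable lebesgue"
    unfolding b_def by (intro measurable_If borel_measurable_max borel_measurable_min) auto
  then have "b \<in> borel_measurable (lebesgue_on {0..1})" by (rule measurable_restrict_space1)
  moreover have bK: "\<bar>b x\<bar> \<le> K" for x by (auto simp: b_def K_def)
  ultimately have "bounded_measurable01 b" by (auto simp: bounded_measurable01_def)
  moreover have "AE x in lebesgue_on {0<..<1}. a x = b x"
  proof (rule AE_open_interval_join[OF z])
    have K0': "AE x in lebesgue. x \<in> {0<..<1} \<longrightarrow> \<bar>a x\<bar> \<le> K0" using K0 by (simp add: AE_restrict_space_iff)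
    have "AE x in lebesgue. x \<in> {0<..<z} \<longrightarrow> a x > 0" using pos by (simp add: AE_restrict_space_iff)
    with K0' have "AE x in lebesgue. x \<in> {0<..<z} \<longrightarrow> a x = b x"
      by eventually_elim (use z in \<open>auto simp: b_def a'_def K_def\<close>)
    then show "AE x in lebesgue_on {0<..<z}. a x = b x" by (simp add: AE_restrict_space_iff)
    have "AE x in lebesgue. x \<in> {z<..<1} \<longrightarrow> a x < 0" using neg by (simp add: AE_restrict_space_iff)
    with K0' have "AE x in lebesgue. x \<in> {z<..<1} \<longrightarrow> a x = b x"
      by eventually_elim (use z in \<open>auto simp: b_def a'_def K_def\<close>)
    then show "AE x in lebesgue_on {z<..<1}. a x = b x" by (simp add: AE_restrict_space_iff)
  qed
  moreover have "0 \<le> b x" if "x \<le> z" for x using that by (auto simp: b_def)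
  moreover have "b x \<le> 0" if "z \<le> x" for x using that by (auto simp: b_def)
  moreover have "0 < K" by (simp add: K_def)
  ultimately show ?thesis using bK that by blast
qed

lemma integral_pos_of_AE_pos:
  assumes b: "bounded_measurable01 b" and x: "0 < x" "x \<le> 1" and pos: "AE t in lebesgue_on {0<..<x}. 0 < b t"
  shows "0 < integral {0..x} b"
proof -
  have "b absolutely_integrable_on {0<..<x}"
    by (rule set_integrable_subset[OF bounded_measurable01_abs_integrable[OF b, of 0 x]]) (use x in auto)
  then have int: "integrable (lebesgue_on {0<..<x}) b"
    by (simp add: integrable_restrict_space set_integrable_def)
  have nn: "AE t in lebesgue_on {0<..<x}. 0 \<le> b t" using pos by eventually_elim simp
  have "(LINT t|lebesgue_on {0<..<x}. b t) \<noteq> 0"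
  proof
    assume "(LINT t|lebesgue_on {0<..<x}. b t) = 0"
    then have "AE t in lebesgue_on {0<..<x}. b t = 0"
      using integral_nonneg_eq_0_iff_AE[OF int nn] by simp
    with pos have "AE t in lebesgue_on {0<..<x}. False" by eventually_elim simp
    then have "emeasure (lebesgue_on {0<..<x}) (space (lebesgue_on {0<..<x})) = 0"
      by (simp only: ae_filter_eq_bot_iff[symmetric] trivial_limit_def[symmetric])
    then show False using x by (simp add: emeasure_restrict_space)
  qed
  moreover have "0 \<le> (LINT t|lebesgue_on {0<..<x}. b t)" using nn by (rule integral_nonneg_AE)
  moreover have "(LINT t|lebesgue_on {0<..<x}. b t) = integral {0..x} b"
    using int by (simp add: lebesgue_integral_eq_integral integral_open_interval_real)
  ultimately show ?thesis by linarith
qed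

theorem theorem5p2:
  fixes a f :: "real \<Rightarrow> real" and z h p q :: real
  assumes "a \<in> Linfty01"
    and "(LINT x|lebesgue_on {0<..<1}. a x) < 0"
    and "0 < z" and "z < 1"
    and "AE x in lebesgue_on {0<..<z}. a x > 0"
    and "AE x in lebesgue_on {z<..<1}. a x < 0"
    and "continuous_on UNIV f"
    and "f 0 = 0"
    and "\<And>u. u > 0 \<Longrightarrow> f u > 0"
    and "h > 0" and "1 < p" and "0 < q" and "q < 1"
    and "((\<lambda>u. f u / u powr p) \<longlongrightarrow> 1) (at_right 0)"
    and "((\<lambda>u. f u / u powr (- q)) \<longlongrightarrow> h) at_top"
  shows "\<exists>C \<in> components (Sr_plus a f). \<exists>l0 > 0.
           {l0<..} \<subseteq> fst ` C \<and>
           (\<exists>m :: real \<Rightarrow> real.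
              (\<forall>l > l0. m l \<in> {norm u | u. (l, u) \<in> C} \<and>
                        (\<forall>u. (l, u) \<in> C \<longrightarrow> m l \<le> norm u)) \<and>
              (m \<longlongrightarrow> 0) at_top)"
proof -
  obtain b K where K: "0 < K" and b: "bounded_measurable01 b" "\<forall>x. \<bar>b x\<bar> \<le> K"
    "\<forall>x\<le>z. 0 \<le> b x" "\<forall>x\<ge>z. b x \<le> 0" and ab: "AE x in lebesgue_on {0<..<1}. a x = b x"
    by (rule bounded_representative[OF assms(1,3-6)]) (rule that)
  have "(LINT x|lebesgue_on {0<..<1}. a x) = (LINT x|lebesgue_on {0<..<1}. b x)"
  proof (rule integral_cong_AE)
    show "a \<in> borel_measurable (lebesgue_on {0<..<1})" using assms(1) by (simp add: Linfty01_def)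
    show "b \<in> borel_measurable (lebesgue_on {0<..<1})"
      using bounded_measurable01_lebesgue_integrable(1)[OF b(1)] by auto
  qed (rule ab)
  then have mean: "integral {0..1} b < 0"
    using assms(2) bounded_measurable01_lebesgue_integrable(2)[OF b(1)] by simp
  have left: "0 < integral {0..z/2} b"
  proof (rule integral_pos_of_AE_pos[OF b(1)])
    have "AE x in lebesgue. x \<in> {0<..<z} \<longrightarrow> a x > 0" "AE x in lebesgue. x \<in> {0<..<1} \<longrightarrow> a x = b x"
      using assms(5) ab by (simp_all add: AE_restrict_space_iff)
    then have "AE x in lebesgue. x \<in> {0<..<z/2} \<longrightarrow> 0 < b x"
      by eventually_elim (use assms(3,4) in auto)
    then show "AE x in lebesgue_on {0<..<z/2}. 0 < b x" by (simp add: AE_restrict_space_iff)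
  qed (use assms(3,4) in auto)
  interpret indefinite_weight b z K f p
    by unfold_locales (use assms b K mean left in auto)
  obtain k1 k2 d l0 where sb: "small_branch b z K f p k1 k2 d l0" and ev: "principal_eigenvalue a < l0"
    using ex_small_branch by blast
  interpret small_branch b z K f p k1 k2 d l0 by (rule sb)
  have "0 < l0" by (rule small_branch.l0[OF sb])
  then show ?thesis using component_of_small_solutions[OF ab ev] by blast
qed

end
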